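(* Let $M$ be a connected smooth manifold and let $N\in\Omega^1(M;TM)$ be such that $N^2=N$ and $\mathrm{Im}\,N$ is involutive. Define $L:=-T_N\in\Omega^2(M;TM)$. Then the derivations of degree $1$ of $\Omega(M)$ given by $D_1=\mathcal{L}_N+\imath_L$ and $D_2=\imath_L$ are cohomology operators, that is, $D_1^2=0=D_2^2$.
   Context: $\Omega(M)$ is the graded algebra of differential forms and $\Omega^k(M;TM)=\Gamma(\Lambda^kT^*M\otimes TM)$ the vector-valued $k$-forms; elements of $\Omega^1(M;TM)$ are identified with bundle endomorphisms of $TM$. Involutivity of $\mathrm{Im}\,N$ means that $[NX,NY]$ is a section of $\mathrm{Im}\,N$ for all vector fields $X,Y$. The Nijenhuis torsion of $N$ is $T_N(X,Y)=[NX,NY]-N[NX,Y]-N[X,NY]+N^2[X,Y]$. A derivation of degree $l$ of $\Omega(M)$ is a linear map raising degree by $l$ with $D(\alpha\wedge\beta)=D\alpha\wedge\beta+(-1)^{l|\alpha|}\alpha\wedge D\beta$. For $K\in\Omega^{k+1}(M;TM)$, the insertion $\imath_K$ is the derivation of degree $k$ defined on a $p$-form $\omega$ by $$\imath_K\omega(Z_1,\dots,Z_{k+p})=\sum_{\sigma\in S_{k+1,p-1}}\mathrm{sgn}(\sigma)\,\omega\big(K(Z_{\sigma(1)},\dots,Z_{\sigma(k+1)}),Z_{\sigma(k+2)},\dots,Z_{\sigma(k+p)}\big)$$ (sum over shuffles; it vanishes on functions). The Lie derivative along $K$ is $\mathcal{L}_K=\imath_K\circ d-(-1)^kd\circ\imath_K$,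 so $\mathcal{L}_N=\imath_N\circ d-d\circ\imath_N$ for $N\in\Omega^1(M;TM)$. *)

theory Defs
  imports "HOL-Analysis.Analysis" "HOL-Combinatorics.Permutations"
begin

section \<open>Smooth manifolds\<close>

text \<open>In finite dimension, \<open>k\<close>-fold continuous differentiability on an open set is the
  existence and continuity of all iterated directional derivatives.\<close>

primrec Ck_on :: "nat \<Rightarrow> ('a::real_normed_vector \<Rightarrow> 'b::real_normed_vector) \<Rightarrow> 'a set \<Rightarrow> bool" where
  "Ck_on 0 f S \<longleftrightarrow> continuous_on S f"
| "Ck_on (Suc k) f S \<longleftrightarrow>
     (\<forall>x\<in>S. f differentiable (at x)) \<and> (\<forall>v. Ck_on k (\<lambda>x. frechet_derivative f (at x) v) S)"

definition smooth_on :: "('a::real_normed_vector \<Rightarrow> 'b::real_normed_vector) \<Rightarrow> 'a set \<Rightarrow> bool" where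
  "smooth_on f S \<longleftrightarrow> (\<forall>k. Ck_on k f S)"

text \<open>The manifold is the whole of a (Hausdorff, second countable) type \<open>'m\<close>; a chart is a pair of
  an open domain and a map which is only relevant on that domain. The model space is a
  finite-dimensional real inner product space rather than a type of class \<open>euclidean_space\<close>,
  because the latter class excludes dimension \<open>0\<close>. The atlas need not be maximal.\<close>

type_synonym ('m, 'e) atlas = "('m set \<times> ('m \<Rightarrow> 'e)) set"

definition smooth_atlas :: "('m::{t2_space,second_countable_topology}, 'e::real_inner) atlas \<Rightarrow> bool" where
  "smooth_atlas A \<longleftrightarrow>
     (\<exists>B::'e set. finite B \<and> span B = UNIV) \<and>
     (\<Union>(U, \<phi>)\<in>A. U) = UNIV \<and>
     (\<forall>(U, \<phi>)\<in>A. open U \<and> open (\<phi> ` U) \<and> homeomorphism U (\<phi> ` U) \<phi> (inv_into U \<phi>)) \<and>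
     (\<forall>(U, \<phi>)\<in>A. \<forall>(V, \<psi>)\<in>A. smooth_on (\<psi> \<circ> inv_into U \<phi>) (\<phi> ` (U \<inter> V)))"

definition smooth_functions :: "('m::topological_space, 'e::real_inner) atlas \<Rightarrow> ('m \<Rightarrow> real) set" where
  "smooth_functions A = {f. \<forall>(U, \<phi>)\<in>A. smooth_on (f \<circ> inv_into U \<phi>) (\<phi> ` U)}"


section \<open>Tangent vectors and vector fields\<close>

text \<open>A tangent vector at \<open>p\<close> is a derivation at \<open>p\<close> of the algebra of smooth functions. It is
  made \<open>0\<close> on non-smooth functions so that equality of tangent vectors is equality of functions.\<close>

type_synonym 'm tvec = "('m \<Rightarrow> real) \<Rightarrow> real"

definition tangent_space :: "('m::topological_space, 'e::real_inner) atlas \<Rightarrow> 'm \<Rightarrow> 'm tvec set" where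
  "tangent_space A p = {v.
     (\<forall>f. f \<notin> smooth_functions A \<longrightarrow> v f = 0) \<and>
     (\<forall>f\<in>smooth_functions A. \<forall>g\<in>smooth_functions A. v (\<lambda>q. f q + g q) = v f + v g) \<and>
     (\<forall>f\<in>smooth_functions A. \<forall>c. v (\<lambda>q. c * f q) = c * v f) \<and>
     (\<forall>f\<in>smooth_functions A. \<forall>g\<in>smooth_functions A. v (\<lambda>q. f q * g q) = v f * g p + f p * v g)}"

text \<open>A section \<open>X\<close> of the tangent bundle is smooth iff \<open>X f\<close> is smooth for every smooth \<open>f\<close>.\<close>

definition vector_fields :: "('m::topological_space, 'e::real_inner) atlas \<Rightarrow> ('m \<Rightarrow> 'm tvec) set" where
  "vector_fields A = {X. (\<forall>p. X p \<in> tangent_space A p) \<and>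
     (\<forall>f\<in>smooth_functions A. (\<lambda>p. X p f) \<in> smooth_functions A)}"

definition lie_bracket :: "('m \<Rightarrow> 'm tvec) \<Rightarrow> ('m \<Rightarrow> 'm tvec) \<Rightarrow> ('m \<Rightarrow> 'm tvec)" where
  "lie_bracket X Y = (\<lambda>p f. X p (\<lambda>q. Y q f) - Y p (\<lambda>q. X q f))"

text \<open>Some smooth vector field through a given tangent vector. It is only used below in
  expressions whose value at \<open>p\<close> does not depend on the choice.\<close>

definition extend_tvec :: "('m::topological_space, 'e::real_inner) atlas \<Rightarrow> 'm \<Rightarrow> 'm tvec \<Rightarrow> ('m \<Rightarrow> 'm tvec)" where
  "extend_tvec A p v = (SOME X. X \<in> vector_fields A \<and> X p = v)"


section \<open>Differential forms\<close>

text \<open>A form is evaluated at a point on a list of tangent vectors. One function on lists carries an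
  element of the whole direct sum of the spaces of \<open>k\<close>-forms: its component of degree \<open>k\<close> is the
  restriction to lists of length \<open>k\<close>. The sum is automatically finite, since alternating forms
  vanish above the dimension. Forms are \<open>0\<close> on lists that do not consist of tangent vectors at
  the given point.\<close>

type_synonym 'm form = "'m \<Rightarrow> 'm tvec list \<Rightarrow> real"
type_synonym 'm vform = "'m \<Rightarrow> 'm tvec list \<Rightarrow> 'm tvec"

definition alternating_multilinear :: "'m tvec set \<Rightarrow> ('m tvec list \<Rightarrow> real) \<Rightarrow> bool" where
  "alternating_multilinear T \<omega> \<longleftrightarrow>
     (\<forall>vs. \<not> set vs \<subseteq> T \<longrightarrow> \<omega> vs = 0) \<and>
     (\<forall>us ws. \<forall>v\<in>T. \<forall>w\<in>T. set us \<subseteq> T \<longrightarrow> set ws \<subseteq> T \<longrightarrow>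
        \<omega> (us @ (\<lambda>f. v f + w f) # ws) = \<omega> (us @ v # ws) + \<omega> (us @ w # ws)) \<and>
     (\<forall>us ws. \<forall>v\<in>T. \<forall>c. set us \<subseteq> T \<longrightarrow> set ws \<subseteq> T \<longrightarrow>
        \<omega> (us @ (\<lambda>f. c * v f) # ws) = c * \<omega> (us @ v # ws)) \<and>
     (\<forall>vs. set vs \<subseteq> T \<longrightarrow> \<not> distinct vs \<longrightarrow> \<omega> vs = 0)"

text \<open>A section is smooth iff its values on smooth vector fields are smooth.\<close>

definition diff_forms :: "('m::topological_space, 'e::real_inner) atlas \<Rightarrow> 'm form set" where
  "diff_forms A = {\<omega>.
     (\<forall>p. alternating_multilinear (tangent_space A p) (\<omega> p)) \<and>
     (\<forall>Xs. set Xs \<subseteq> vector_fields A \<longrightarrow> (\<lambda>p. \<omega> p (map (\<lambda>X. X p) Xs)) \<in> smooth_functions A)}"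

definition diff_forms_deg :: "('m::topological_space, 'e::real_inner) atlas \<Rightarrow> nat \<Rightarrow> 'm form set" where
  "diff_forms_deg A k = {\<omega> \<in> diff_forms A. \<forall>p vs. length vs \<noteq> k \<longrightarrow> \<omega> p vs = 0}"

text \<open>The vector-valued \<open>k\<close>-forms. A vector-valued \<open>1\<close>-form \<open>N\<close> is identified with the bundle
  endomorphism sending a tangent vector \<open>v\<close> at \<open>p\<close> to \<open>N p [v]\<close>.\<close>

definition vector_forms :: "('m::topological_space, 'e::real_inner) atlas \<Rightarrow> nat \<Rightarrow> 'm vform set" where
  "vector_forms A k = {K.
     (\<forall>p vs f. length vs \<noteq> k \<longrightarrow> K p vs f = 0) \<and>
     (\<forall>p vs. K p vs \<in> tangent_space A p) \<and>
     (\<forall>p f. alternating_multilinear (tangent_space A p) (\<lambda>vs. K p vs f)) \<and>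
     (\<forall>Xs. set Xs \<subseteq> vector_fields A \<longrightarrow> (\<lambda>p. K p (map (\<lambda>X. X p) Xs)) \<in> vector_fields A)}"

definition endo_field :: "'m vform \<Rightarrow> ('m \<Rightarrow> 'm tvec) \<Rightarrow> ('m \<Rightarrow> 'm tvec)" where
  "endo_field N X = (\<lambda>p. N p [X p])"


section \<open>Exterior algebra and derivations\<close>

definition unshuffles :: "nat \<Rightarrow> nat \<Rightarrow> (nat \<Rightarrow> nat) set" where
  "unshuffles a b = {\<sigma>. \<sigma> permutes {..<a + b} \<and>
     strict_mono_on {..<a} \<sigma> \<and> strict_mono_on {a..<a + b} \<sigma>}"

definition wedge :: "'m form \<Rightarrow> 'm form \<Rightarrow> 'm form" where
  "wedge \<alpha> \<beta> = (\<lambda>p zs. let n = length zs in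
     \<Sum>k\<le>n. \<Sum>\<sigma>\<in>unshuffles k (n - k). of_int (sign \<sigma>) *
       \<alpha> p (map (\<lambda>i. zs ! \<sigma> i) [0..<k]) * \<beta> p (map (\<lambda>i. zs ! \<sigma> i) [k..<n]))"

text \<open>The exterior derivative is given by the invariant formula, evaluated on smooth vector fields
  through the given tangent vectors; the result at \<open>p\<close> only depends on these vectors.\<close>

definition koszul :: "'m form \<Rightarrow> ('m \<Rightarrow> 'm tvec) list \<Rightarrow> 'm \<Rightarrow> real" where
  "koszul \<omega> Xs p =
     (\<Sum>i<length Xs. (-1) ^ i * (Xs ! i) p (\<lambda>q. \<omega> q (map (\<lambda>X. X q) (nths Xs (- {i}))))) +
     (\<Sum>j<length Xs. \<Sum>i<j. (-1) ^ (i + j) *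
        \<omega> p (map (\<lambda>X. X p) (lie_bracket (Xs ! i) (Xs ! j) # nths Xs (- {i, j}))))"

definition ext_deriv :: "('m::topological_space, 'e::real_inner) atlas \<Rightarrow> 'm form \<Rightarrow> 'm form" where
  "ext_deriv A \<omega> = (\<lambda>p vs.
     if set vs \<subseteq> tangent_space A p then koszul \<omega> (map (extend_tvec A p) vs) p else 0)"

text \<open>\<open>insertion k K\<close> is the insertion of a vector-valued form \<open>K\<close> of degree \<open>k + 1\<close>, a derivation
  of degree \<open>k\<close>; on a list of length \<open>k + p\<close> it evaluates the component of degree \<open>p\<close> of \<open>\<omega>\<close>.\<close>

definition insertion :: "nat \<Rightarrow> 'm vform \<Rightarrow> 'm form \<Rightarrow> 'm form" where
  "insertion k K \<omega> = (\<lambda>x zs. let n = length zs in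
     if n < k + 1 then 0
     else \<Sum>\<sigma>\<in>unshuffles (k + 1) (n - (k + 1)). of_int (sign \<sigma>) *
       \<omega> x (K x (map (\<lambda>i. zs ! \<sigma> i) [0..<k + 1]) # map (\<lambda>i. zs ! \<sigma> i) [k + 1..<n]))"

definition lie_deriv :: "('m::topological_space, 'e::real_inner) atlas \<Rightarrow> nat \<Rightarrow> 'm vform \<Rightarrow> 'm form \<Rightarrow> 'm form" where
  "lie_deriv A k K \<omega> = (\<lambda>p zs.
     insertion k K (ext_deriv A \<omega>) p zs - (-1) ^ k * ext_deriv A (insertion k K \<omega>) p zs)"

definition graded_derivation ::
  "('m::topological_space, 'e::real_inner) atlas \<Rightarrow> nat \<Rightarrow> ('m form \<Rightarrow> 'm form) \<Rightarrow> bool" where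
  "graded_derivation A l D \<longleftrightarrow>
     (\<forall>\<alpha>\<in>diff_forms A. D \<alpha> \<in> diff_forms A) \<and>
     (\<forall>\<alpha>\<in>diff_forms A. \<forall>\<beta>\<in>diff_forms A.
        D (\<lambda>p zs. \<alpha> p zs + \<beta> p zs) = (\<lambda>p zs. D \<alpha> p zs + D \<beta> p zs)) \<and>
     (\<forall>\<alpha>\<in>diff_forms A. \<forall>c. D (\<lambda>p zs. c * \<alpha> p zs) = (\<lambda>p zs. c * D \<alpha> p zs)) \<and>
     (\<forall>k. \<forall>\<alpha>\<in>diff_forms_deg A k. D \<alpha> \<in> diff_forms_deg A (k + l)) \<and>
     (\<forall>k. \<forall>\<alpha>\<in>diff_forms_deg A k. \<forall>\<beta>\<in>diff_forms A.
        D (wedge \<alpha> \<beta>) = (\<lambda>p zs. wedge (D \<alpha>) \<beta> p zs + (-1) ^ (l * k) * wedge \<alpha> (D \<beta>) p zs))"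

definition cohomology_operator ::
  "('m::topological_space, 'e::real_inner) atlas \<Rightarrow> ('m form \<Rightarrow> 'm form) \<Rightarrow> bool" where
  "cohomology_operator A D \<longleftrightarrow>
     graded_derivation A 1 D \<and> (\<forall>\<omega>\<in>diff_forms A. D (D \<omega>) = (\<lambda>p zs. 0))"


section \<open>Nijenhuis torsion and involutivity\<close>

definition torsion_field :: "'m vform \<Rightarrow> ('m \<Rightarrow> 'm tvec) \<Rightarrow> ('m \<Rightarrow> 'm tvec) \<Rightarrow> ('m \<Rightarrow> 'm tvec)" where
  "torsion_field N X Y = (\<lambda>p f.
     lie_bracket (endo_field N X) (endo_field N Y) p f
     - endo_field N (lie_bracket (endo_field N X) Y) p f
     - endo_field N (lie_bracket X (endo_field N Y)) p f
     + endo_field N (endo_field N (lie_bracket X Y)) p f)"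

text \<open>The torsion as a vector-valued \<open>2\<close>-form: the value of \<open>torsion_field N X Y\<close> at \<open>p\<close> only
  depends on the values of \<open>X\<close> and \<open>Y\<close> at \<open>p\<close>.\<close>

definition nijenhuis_torsion ::
  "('m::topological_space, 'e::real_inner) atlas \<Rightarrow> 'm vform \<Rightarrow> 'm vform" where
  "nijenhuis_torsion A N = (\<lambda>p vs.
     if length vs = 2 \<and> set vs \<subseteq> tangent_space A p
     then torsion_field N (extend_tvec A p (vs ! 0)) (extend_tvec A p (vs ! 1)) p
     else (\<lambda>f. 0))"

definition involutive_image ::
  "('m::topological_space, 'e::real_inner) atlas \<Rightarrow> 'm vform \<Rightarrow> bool" where
  "involutive_image A N \<longleftrightarrow> (\<forall>X\<in>vector_fields A. \<forall>Y\<in>vector_fields A. \<forall>p.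
     lie_bracket (endo_field N X) (endo_field N Y) p \<in> (\<lambda>v. N p [v]) ` tangent_space A p)"

end

theory Submission
  imports Defs "HOL-Library.Function_Algebras"
begin

text \<open>Put \<open>F = Im N\<close>. The operators \<open>D\<^sub>1\<close> and \<open>D\<^sub>2\<close> are Chevalley--Eilenberg differentials of Lie algebroid
  structures on \<open>TM\<close>. For \<open>D\<^sub>1\<close> the anchor is \<open>N\<close> and the bracket that of \<open>F \<ltimes> (TM / F)\<close>, with \<open>F\<close> acting on
  the abelian ideal \<open>TM / F = Ker N\<close> by the Bott connection. For \<open>D\<^sub>2\<close> the anchor is zero and the bracket
  is the torsion \<open>T\<^sub>N\<close>, which takes values in \<open>F\<close> and vanishes if an argument lies in \<open>F\<close>, so that
  double brackets are zero. Cartan's formula \<open>i\<^sub>X d = L\<^sub>X - d i\<^sub>X\<close> defines such a differential by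
  recursion on the list of arguments, and both the derivation property and \<open>d\<^sup>2 = 0\<close> follow by induction
  on this list. To pass between forms on tangent vectors and tensorial cochains on vector fields one
  writes a tangent vector near a point in a frame of global vector fields, using Hadamard's lemma.\<close>

section \<open>Calculus on finite-dimensional inner product spaces\<close>

text \<open>The correction \<open>L\<close> is forced. The commutator of i_N and d is the
  Chevalley-Eilenberg operator with anchor N and bracket [NX, Y] + [X, NY] - N[X, Y]. In general
  this is no Lie bracket, since N maps it to [NX, NY] - T_N(X, Y). Because dF(X, Y) contains
  -F([X, Y]), inserting a vector-valued 2-form K is the operator with anchor 0 and bracket -K;
  adding i_L therefore adds T_N to the bracket. If N is idempotent with involutive image, the sum
  becomes [NX, NY] + (1 - N)([NX, Y] + [X, NY]), and T_N(X, Y) becomes N[(1 - N)X, (1 - N)Y].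
  Brackets and Lie derivatives need fields, while forms take tangent vectors at one point. Hence the
  weight put on multilinearity over smooth functions: it is what lets an operator on cochains
  descend to forms. Tangent vectors are derivations of the globally defined functions, so extending
  them to fields requires cut-off functions, and with them compact balls and calculus in a model
  space known only to be a finitely spanned inner product space.\<close>

text \<open>Coordinates for the model space. The set \<open>D\<close> may be empty, so dimension 0
  is included, and the real line is an instance as well.\<close>

locale orthonormal_basis =
  fixes D :: "'e::real_inner set"
  assumes finite_D: "finite D"
    and inner_D: "\<And>c d. c \<in> D \<Longrightarrow> d \<in> D \<Longrightarrow> c \<bullet> d = (if c = d then 1 else 0)"
    and rep_D: "\<And>x. x = (\<Sum>d\<in>D. (x \<bullet> d) *\<^sub>R d)"

lemma orthonormal_basis_real: "orthonormal_basis {1::real}"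
  by standard auto

lemma orthonormal_basis_exists:
  assumes "finite (B::'e::real_inner set)" "span B = UNIV"
  shows "\<exists>D::'e set. orthonormal_basis D"
proof -
  obtain C where C: "finite C" "span C = (UNIV::'e set)" "pairwise orthogonal C"
    using basis_orthogonal[OF assms(1)] assms(2) by metis
  \<comment> \<open>Pairwise orthogonality allows \<open>0 \<in> C\<close>, a vector that cannot be
    normalised and adds nothing to the span.\<close>
  define D where "D = (\<lambda>c. c /\<^sub>R norm c) ` (C - {0})"
  have fin: "finite D" using C(1) by (simp add: D_def)
  have inn: "c \<bullet> d = (if c = d then 1 else 0)" if cd: "c \<in> D" "d \<in> D" for c d
  proof -
    obtain a where a: "a \<in> C" "a \<noteq> 0" "c = a /\<^sub>R norm a" using cd unfolding D_def by blast
    obtain b where b: "b \<in> C" "b \<noteq> 0" "d = b /\<^sub>R norm b" using cd unfolding D_def by blast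
    show ?thesis
    proof (cases "a = b")
      case True
      then show ?thesis using a b
        by (simp add: dot_square_norm power2_eq_square)
    next
      case False
      then have "a \<bullet> b = 0" using C(3) a(1) b(1) by (auto simp: pairwise_def orthogonal_def)
      then have "c \<bullet> d = 0" using a b by simp
      moreover have "c \<bullet> c \<noteq> 0" using a by simp
      ultimately show ?thesis by auto
    qed
  qed
  have rep: "x = (\<Sum>d\<in>D. (x \<bullet> d) *\<^sub>R d)" for x
  proof -
    have "C \<subseteq> span D"
    proof
      fix c assume "c \<in> C"
      show "c \<in> span D"
      proof (cases "c = 0")
        case False
        then have "c /\<^sub>R norm c \<in> span D" using \<open>c \<in> C\<close> by (auto simp: D_def intro!: span_base)
        then have "norm c *\<^sub>R (c /\<^sub>R norm c) \<in> span D" by (rule span_mul)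
        then show ?thesis using False by simp
      qed (simp add: span_zero)
    qed
    then have "x \<in> span D" using C(2) span_mono[of C "span D"] by (auto simp: span_span)
    then obtain u where u: "x = (\<Sum>d\<in>D. u d *\<^sub>R d)"
      using span_finite[OF fin] by auto
    have "x \<bullet> d = u d" if "d \<in> D" for d
    proof -
      have "x \<bullet> d = (\<Sum>e\<in>D. u e * (e \<bullet> d))" by (simp add: u inner_sum_left)
      also have "\<dots> = (\<Sum>e\<in>D. if e = d then u d else 0)"
        using that inn by (intro sum.cong) auto
      finally show ?thesis using that fin by simp
    qed
    then show ?thesis using u by simp
  qed
  have "orthonormal_basis D" by standard (use fin inn rep in auto)
  then show ?thesis ..
qed

context orthonormal_basis begin

lemma norm_D: "d \<in> D \<Longrightarrow> norm d = 1"
  using inner_D[of d d] by (simp add: norm_eq_sqrt_inner)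

lemma inner_rep: "x \<bullet> y = (\<Sum>d\<in>D. (x \<bullet> d) * (y \<bullet> d))"
  by (subst rep_D[of y]) (simp add: inner_sum_right mult.commute)

text \<open>Heine-Borel by sequences: finitely many bounded coordinates converge along one common
  subsequence, and with them the combination of \<open>D\<close> that they describe. Compact balls
  later make supports in a chart closed in the whole manifold.\<close>

lemma compact_cball_D: "compact (cball (a::'e) r)"
proof -
  have "seq_compact (cball a r)"
  proof (rule seq_compactI)
    fix f :: "nat \<Rightarrow> 'e" assume f: "\<forall>n. f n \<in> cball a r"
    have b: "bounded (range f)" by (rule bounded_subset[OF bounded_cball]) (use f in auto)
    have "\<exists>l::'e. \<exists>r. strict_mono r \<and>
        (\<forall>e>0. eventually (\<lambda>n. \<forall>i\<in>D. dist (f (r n) \<bullet> i) (l \<bullet> i) < e) sequentially)"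
    proof -
      have "\<forall>d\<subseteq>D. \<exists>l::'e. \<exists>r. strict_mono r \<and>
        (\<forall>e>0. eventually (\<lambda>n. \<forall>i\<in>d. dist (f (r n) \<bullet> i) (l \<bullet> i) < e) sequentially)"
      proof (rule compact_lemma_general[where unproj="\<lambda>e. \<Sum>i\<in>D. e i *\<^sub>R i"])
        show "finite D" by (rule finite_D)
        show "bounded ((\<lambda>x. x \<bullet> k) ` range f)" for k
          using bounded_linear_image[OF b bounded_linear_inner_left] .
        show "(\<Sum>i\<in>D. e i *\<^sub>R i) \<bullet> k = e k" if "k \<in> D" for e k
        proof -
          have "(\<Sum>i\<in>D. e i *\<^sub>R i) \<bullet> k = (\<Sum>i\<in>D. if i = k then e k else 0)"
            unfolding inner_sum_left using inner_D that by (intro sum.cong) auto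
          then show ?thesis using that finite_D by simp
        qed
        show "(\<Sum>i\<in>D. (x \<bullet> i) *\<^sub>R i) = x" for x using rep_D[of x] by simp
      qed
      then show ?thesis by blast
    qed
    then obtain l s where s: "strict_mono s"
      "\<And>e. e > 0 \<Longrightarrow> eventually (\<lambda>n. \<forall>i\<in>D. dist (f (s n) \<bullet> i) (l \<bullet> i) < e) sequentially"
      by blast
    have "(\<lambda>n. f (s n) \<bullet> i) \<longlonglongrightarrow> l \<bullet> i" if "i \<in> D" for i
    proof (rule tendstoI)
      fix e :: real assume "e > 0"
      from s(2)[OF this] show "eventually (\<lambda>n. dist (f (s n) \<bullet> i) (l \<bullet> i) < e) sequentially"
        by eventually_elim (use that in auto)
    qed
    then have "(\<lambda>n. \<Sum>i\<in>D. (f (s n) \<bullet> i) *\<^sub>R i) \<longlonglongrightarrow> (\<Sum>i\<in>D. (l \<bullet> i) *\<^sub>R i)"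
      by (intro tendsto_sum tendsto_scaleR tendsto_const)
    then have lim: "(f \<circ> s) \<longlonglongrightarrow> l" by (simp add: rep_D[symmetric] o_def)
    moreover have "l \<in> cball a r"
      by (rule closed_sequentially[OF closed_cball _ lim]) (use f in auto)
    ultimately show "\<exists>l\<in>cball a r. \<exists>s. strict_mono s \<and> (f \<circ> s) \<longlonglongrightarrow> l"
      using s(1) by blast
  qed
  then show ?thesis by (simp add: compact_eq_seq_compact_metric)
qed

end

section \<open>Maps of class C^k on open sets: closure properties and the chain rule\<close>

lemma Ck_on_continuous: "Ck_on k f S \<Longrightarrow> continuous_on S f"
  by (cases k) (auto intro: differentiable_imp_continuous_on
      simp: differentiable_on_def differentiable_at_withinI)

lemma Ck_on_Suc_D: "Ck_on (Suc k) f S \<Longrightarrow> Ck_on k f S"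
proof (induction k arbitrary: f)
  case 0
  then show ?case using Ck_on_continuous[of "Suc 0"] by simp
next
  case (Suc k)
  then show ?case by (metis Ck_on.simps(2))
qed

lemma Ck_on_cong:
  assumes "open S" "\<And>x. x \<in> S \<Longrightarrow> f x = g x" "Ck_on k f S"
  shows "Ck_on k g S"
  using assms(2,3)
proof (induction k arbitrary: f g)
  case 0
  then show ?case using continuous_on_cong[of S S f g] by (simp cong: continuous_on_cong_simp)
next
  case (Suc k)
  have der: "(g has_derivative frechet_derivative f (at x)) (at x)" if "x \<in> S" for x
  proof (rule has_derivative_transform_within_open[where s=S])
    show "(f has_derivative frechet_derivative f (at x)) (at x)"
      using Suc.prems(2) that by (auto simp: frechet_derivative_works)
  qed (use Suc.prems(1) assms(1) that in auto)
  have fd: "frechet_derivative g (at x) = frechet_derivative f (at x)" if "x \<in> S" for x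
    using frechet_derivative_at[OF der[OF that]] by simp
  show ?case
  proof (simp, intro conjI ballI allI)
    show "g differentiable at x" if "x \<in> S" for x using der[OF that] by (auto simp: differentiable_def)
    show "Ck_on k (\<lambda>x. frechet_derivative g (at x) v) S" for v
      by (rule Suc.IH[where f="\<lambda>x. frechet_derivative f (at x) v"]) (use Suc.prems(2) fd in auto)
  qed
qed

lemma Ck_on_subset: "Ck_on k f S \<Longrightarrow> T \<subseteq> S \<Longrightarrow> Ck_on k f T"
  by (induction k arbitrary: f) (auto intro: continuous_on_subset)

lemma Ck_on_Un:
  assumes "open S" "open T" "Ck_on k f S" "Ck_on k f T"
  shows "Ck_on k f (S \<union> T)"
  using assms(3,4)
  by (induction k arbitrary: f) (auto intro: continuous_on_open_Un assms)

lemma Ck_on_const: "Ck_on k (\<lambda>x. c) S"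
  by (induction k arbitrary: c) (auto)

text \<open>Replaces the choice operator behind \<open>frechet_derivative\<close> by any explicitly
  known derivative; the product and chain rules below are inductions on \<open>k\<close> through
  this rule.\<close>

lemma Ck_on_SucI:
  assumes "open S" "\<And>x. x \<in> S \<Longrightarrow> (f has_derivative f' x) (at x)"
    "\<And>v. Ck_on k (\<lambda>x. f' x v) S"
  shows "Ck_on (Suc k) f S"
proof -
  have fd: "frechet_derivative f (at x) = f' x" if "x \<in> S" for x
    using frechet_derivative_at[OF assms(2)[OF that]] by simp
  show ?thesis
    by (auto simp: differentiable_def intro: assms(2)
        intro!: Ck_on_cong[OF assms(1) _ assms(3)] simp: fd)
qed

lemma Ck_on_Suc_E:
  assumes "Ck_on (Suc k) f S"
  shows "x \<in> S \<Longrightarrow> (f has_derivative frechet_derivative f (at x)) (at x)"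
    and "Ck_on k (\<lambda>x. frechet_derivative f (at x) v) S"
  using assms by (auto simp: frechet_derivative_works)

lemma Ck_on_add:
  assumes "open S" "Ck_on k f S" "Ck_on k g S"
  shows "Ck_on k (\<lambda>x. f x + g x) S"
  using assms(2,3)
proof (induction k arbitrary: f g)
  case 0
  then show ?case by (auto intro: continuous_intros)
next
  case (Suc k)
  show ?case
    by (rule Ck_on_SucI[OF assms(1) has_derivative_add]) (use Suc.prems in \<open>auto intro!: Suc.IH simp: frechet_derivative_works\<close>)
qed

lemma Ck_on_bounded_linear:
  assumes "open S" "bounded_linear h" "Ck_on k f S"
  shows "Ck_on k (\<lambda>x. h (f x)) S"
  using assms(3)
proof (induction k arbitrary: f)
  case 0
  then show ?case using bounded_linear.continuous_on[OF assms(2), of S f] by simp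
next
  case (Suc k)
  show ?case
    by (rule Ck_on_SucI[OF assms(1) bounded_linear.has_derivative[OF assms(2)]])
      (use Suc.prems in \<open>auto intro!: Suc.IH simp: frechet_derivative_works\<close>)
qed

lemma Ck_on_mult:
  fixes f g :: "'a::real_normed_vector \<Rightarrow> real"
  assumes "open S" "Ck_on k f S" "Ck_on k g S"
  shows "Ck_on k (\<lambda>x. f x * g x) S"
  using assms(2,3)
proof (induction k arbitrary: f g)
  case 0
  then show ?case by (auto intro: continuous_intros)
next
  case (Suc k)
  note E = Ck_on_Suc_E[OF Suc.prems(1)] Ck_on_Suc_E[OF Suc.prems(2)]
  show ?case
    by (rule Ck_on_SucI[OF assms(1) has_derivative_mult[OF E(1) E(3)]])
      (assumption | intro Ck_on_add[OF assms(1)] Suc.IH E Ck_on_Suc_D[OF Suc.prems(1)] Ck_on_Suc_D[OF Suc.prems(2)])+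
qed

lemma Ck_on_sum:
  assumes "open S" "\<And>i. i \<in> I \<Longrightarrow> Ck_on k (f i) S"
  shows "Ck_on k (\<lambda>x. \<Sum>i\<in>I. f i x) S"
  using assms(2)
  by (induction I rule: infinite_finite_induct) (auto intro: Ck_on_const Ck_on_add assms(1))

lemma Ck_on_linear:
  assumes "open S" "bounded_linear f"
  shows "Ck_on k f S"
proof (cases k)
  case 0
  then show ?thesis using assms by (simp add: linear_continuous_on)
next
  case (Suc n)
  show ?thesis unfolding Suc
    by (rule Ck_on_SucI[OF assms(1), of _ "\<lambda>_. f"])
      (use assms in \<open>auto intro: Ck_on_const bounded_linear_imp_has_derivative\<close>)
qed

text \<open>\<open>Ck_on\<close> follows derivatives in fixed directions, whereas the chain rule
  differentiates \<open>f\<close> in a direction that moves with \<open>x\<close>. Expanding this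
  direction in \<open>D\<close> leaves derivatives of \<open>f\<close> along fixed vectors, composed
  with \<open>g\<close>, to which the induction hypothesis applies.\<close>

lemma (in orthonormal_basis) Ck_on_compose:
  fixes f :: "'e \<Rightarrow> real" and g :: "'a::real_normed_vector \<Rightarrow> 'e"
  assumes "open S" "open T" "g ` S \<subseteq> T" "Ck_on k f T" "Ck_on k g S"
  shows "Ck_on k (\<lambda>x. f (g x)) S"
  using assms(4,5)
proof (induction k arbitrary: f)
  case 0
  then show ?case using assms(3) by (auto intro: continuous_on_compose2)
next
  case (Suc k)
  note E = Ck_on_Suc_E[OF Suc.prems(1)] Ck_on_Suc_E[OF Suc.prems(2)]
  let ?h = "\<lambda>x v. \<Sum>d\<in>D. (frechet_derivative g (at x) v \<bullet> d) * frechet_derivative f (at (g x)) d"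
  have der: "((\<lambda>x. f (g x)) has_derivative ?h x) (at x)" if "x \<in> S" for x
  proof -
    have fx: "(f has_derivative frechet_derivative f (at (g x))) (at (g x))"
      using E(1) assms(3) that by auto
    have lin: "linear (frechet_derivative f (at (g x)))"
      using fx by (simp add: has_derivative_linear)
    have eq: "frechet_derivative f (at (g x)) w = (\<Sum>d\<in>D. (w \<bullet> d) * frechet_derivative f (at (g x)) d)" for w
      by (subst rep_D[of w]) (simp add: linear_sum[OF lin] linear_scale[OF lin])
    show ?thesis
      using has_derivative_compose[OF E(3)[OF that] fx] ext[of "\<lambda>v. frechet_derivative f (at (g x)) (frechet_derivative g (at x) v)" "?h x", OF eq]
      by simp
  qed
  show ?case
  proof (rule Ck_on_SucI[OF assms(1) der])
    fix v
    show "Ck_on k (\<lambda>x. ?h x v) S"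
    proof (intro Ck_on_sum Ck_on_mult assms(1))
      show "Ck_on k (\<lambda>x. frechet_derivative g (at x) v \<bullet> d) S" for d
        using Ck_on_bounded_linear[OF assms(1) bounded_linear_inner_left E(4)] .
      show "Ck_on k (\<lambda>x. frechet_derivative f (at (g x)) d) S" for d
        by (rule Suc.IH[OF E(2) Ck_on_Suc_D[OF Suc.prems(2)]])
    qed
  qed
qed

section \<open>Directional derivatives, averages over segments and Hadamard's lemma\<close>

context orthonormal_basis begin

text \<open>The increment is split along the basis, and the mean value inequality controls one
  coordinate at a time; continuity of the partial derivatives at \<open>x\<close> makes each error
  small.\<close>

lemma directional_imp_has_derivative:
  fixes f :: "'e \<Rightarrow> real"
  assumes S: "open S"
    and dir: "\<And>x v. x \<in> S \<Longrightarrow> ((\<lambda>s. f (x + s *\<^sub>R v)) has_real_derivative f' x v) (at 0)"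
    and cont: "\<And>v. continuous_on S (\<lambda>x. f' x v)"
    and x: "x \<in> S"
  shows "(f has_derivative f' x) (at x)"
proof -
  define A where "A h = (\<Sum>d\<in>D. (h \<bullet> d) * f' x d)" for h
  have normsum: "norm (\<Sum>d\<in>E. (h \<bullet> d) *\<^sub>R d) \<le> real (card D) * norm h" if "E \<subseteq> D" for E h
  proof -
    have "norm (\<Sum>d\<in>E. (h \<bullet> d) *\<^sub>R d) \<le> (\<Sum>d\<in>E. norm h)"
    proof (rule sum_norm_le)
      fix d assume "d \<in> E"
      then have "norm d = 1" using that norm_D by auto
      then show "norm ((h \<bullet> d) *\<^sub>R d) \<le> norm h"
        using Cauchy_Schwarz_ineq2[of h d] by simp
    qed
    also have "\<dots> \<le> real (card D) * norm h"
      using card_mono[OF finite_D that] by (simp add: mult_right_mono)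
    finally show ?thesis .
  qed
  have step: "\<exists>\<delta>>0. \<forall>y h. norm (y - x) < \<delta> \<longrightarrow> norm h < \<delta> \<longrightarrow>
      \<bar>f (y + (\<Sum>d\<in>E. (h \<bullet> d) *\<^sub>R d)) - f y - (\<Sum>d\<in>E. (h \<bullet> d) * f' x d)\<bar> \<le> e * norm h"
    if "E \<subseteq> D" "e > 0" for E e
  proof -
    have "finite E" using that finite_D by (meson finite_subset)
    then show ?thesis using that
    proof (induction E arbitrary: e)
      case empty
      then show ?case by (intro exI[of _ 1]) auto
    next
      case (insert d E)
      have d: "d \<in> D" "E \<subseteq> D" using insert.prems by auto
      obtain \<delta>1 where \<delta>1: "\<delta>1 > 0" "\<And>y h. norm (y - x) < \<delta>1 \<Longrightarrow> norm h < \<delta>1 \<Longrightarrow>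
        \<bar>f (y + (\<Sum>d\<in>E. (h \<bullet> d) *\<^sub>R d)) - f y - (\<Sum>d\<in>E. (h \<bullet> d) * f' x d)\<bar> \<le> e/2 * norm h"
        using insert.IH[of "e/2"] insert.prems by auto
      obtain r1 where r1: "r1 > 0" "ball x r1 \<subseteq> S" using S x openE by blast
      have "isCont (\<lambda>z. f' z d) x" using cont S x by (simp add: continuous_on_eq_continuous_at)
      then obtain r2 where r2: "r2 > 0" "\<And>z. dist z x < r2 \<Longrightarrow> dist (f' z d) (f' x d) < e/2"
        using \<open>e > 0\<close> unfolding continuous_at_eps_delta by (meson half_gt_zero)
      define r where "r = min r1 r2"
      \<comment> \<open>The points \<open>y' + t *\<^sub>R d\<close> stay within
        \<open>\<delta> + card D * \<delta> + \<delta>\<close> of \<open>x\<close>, hence the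
        divisor \<open>card D + 2\<close>. Within \<open>r\<close> the partial derivative along
        \<open>d\<close> moves by less than \<open>e/2\<close>.\<close>
      define \<delta> where "\<delta> = min \<delta>1 (r / (real (card D) + 2))"
      have "r > 0" using r1 r2 by (simp add: r_def)
      have "\<delta> > 0" using \<delta>1 \<open>r > 0\<close> by (simp add: \<delta>_def)
      moreover have "\<bar>f (y + (\<Sum>d\<in>insert d E. (h \<bullet> d) *\<^sub>R d)) - f y - (\<Sum>d\<in>insert d E. (h \<bullet> d) * f' x d)\<bar> \<le> e * norm h"
        if yh: "norm (y - x) < \<delta>" "norm h < \<delta>" for y h
      proof -
        define y' where "y' = y + (\<Sum>d\<in>E. (h \<bullet> d) *\<^sub>R d)"
        define c where "c = h \<bullet> d"
        have c: "\<bar>c\<bar> \<le> norm h" using Cauchy_Schwarz_ineq2[of h d] norm_D[OF d(1)] by (simp add: c_def)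
        have near: "norm (y' + t *\<^sub>R d - x) < r" if "\<bar>t\<bar> \<le> norm h" for t
        proof -
          have "y' + t *\<^sub>R d - x = (y - x) + ((\<Sum>d\<in>E. (h \<bullet> d) *\<^sub>R d) + t *\<^sub>R d)"
            by (simp add: y'_def)
          then have "norm (y' + t *\<^sub>R d - x) \<le> norm (y - x) + (norm (\<Sum>d\<in>E. (h \<bullet> d) *\<^sub>R d) + norm (t *\<^sub>R d))"
            by (simp only:) (intro order_trans[OF norm_triangle_ineq] add_left_mono norm_triangle_ineq)
          also have "\<dots> \<le> norm (y - x) + (real (card D) * norm h + norm h)"
            using normsum[OF d(2), of h] norm_D[OF d(1)] that by simp
          also have "\<dots> < \<delta> + (real (card D) * \<delta> + \<delta>)"
            using yh by (intro add_less_le_mono add_mono mult_left_mono) auto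
          also have "\<dots> = \<delta> * (real (card D) + 2)" by (simp add: algebra_simps)
          also have "\<dots> \<le> r / (real (card D) + 2) * (real (card D) + 2)"
            by (intro mult_right_mono) (auto simp: \<delta>_def)
          also have "\<dots> = r" by simp
          finally show ?thesis .
        qed
        define I where "I = {- norm h..norm h}"
        \<comment> \<open>Subtracting the linear part first lets the mean value inequality bound the
          error itself.\<close>
        have "norm ((f (y' + c *\<^sub>R d) - c * f' x d) - (f (y' + 0 *\<^sub>R d) - 0 * f' x d)) \<le> e/2 * norm (c - 0)"
        proof (rule field_differentiable_bound[where S=I and f="\<lambda>t. f (y' + t *\<^sub>R d) - t * f' x d"
              and f'="\<lambda>t. f' (y' + t *\<^sub>R d) d - f' x d"])
          show "convex I" by (simp add: I_def)
          show "c \<in> I" "0 \<in> I" using c by (auto simp: I_def)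
          fix t assume t: "t \<in> I"
          then have n: "norm (y' + t *\<^sub>R d - x) < r" by (intro near) (auto simp: I_def)
          then have "y' + t *\<^sub>R d \<in> S" using r1 by (auto simp: r_def dist_norm norm_minus_commute)
          from dir[OF this, of d]
          have "((\<lambda>s. f (y' + (t + s) *\<^sub>R d)) has_real_derivative f' (y' + t *\<^sub>R d) d) (at 0)"
            by (simp add: algebra_simps)
          then have "((\<lambda>t. f (y' + t *\<^sub>R d)) has_real_derivative f' (y' + t *\<^sub>R d) d) (at t)"
            using DERIV_shift[of "\<lambda>t. f (y' + t *\<^sub>R d)" _ 0 t] by (simp add: add.commute)
          then show "((\<lambda>t. f (y' + t *\<^sub>R d) - t * f' x d) has_real_derivative f' (y' + t *\<^sub>R d) d - f' x d) (at t within I)"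
            by (auto intro!: derivative_eq_intros intro: has_field_derivative_at_within)
          show "norm (f' (y' + t *\<^sub>R d) d - f' x d) \<le> e/2"
            using r2(2)[of "y' + t *\<^sub>R d"] n by (simp add: r_def dist_norm)
        qed
        also have "\<dots> \<le> e/2 * norm h" using c \<open>e > 0\<close> by simp
        finally have 1: "\<bar>f (y' + c *\<^sub>R d) - f y' - c * f' x d\<bar> \<le> e/2 * norm h" by (simp add: algebra_simps)
        have 2: "\<bar>f y' - f y - (\<Sum>d\<in>E. (h \<bullet> d) * f' x d)\<bar> \<le> e/2 * norm h"
          unfolding y'_def by (rule \<delta>1(2)) (use yh in \<open>auto simp: \<delta>_def\<close>)
        have "y + (\<Sum>d\<in>insert d E. (h \<bullet> d) *\<^sub>R d) = y' + c *\<^sub>R d"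
          using insert.hyps by (simp add: y'_def c_def)
        moreover have "(\<Sum>d\<in>insert d E. (h \<bullet> d) * f' x d) = c * f' x d + (\<Sum>d\<in>E. (h \<bullet> d) * f' x d)"
          using insert.hyps by (simp add: c_def)
        moreover have "e * norm h = e/2 * norm h + e/2 * norm h" by simp
        ultimately show ?thesis using 1 2 by (simp only:)
      qed
      ultimately show ?case by blast
    qed
  qed
  have der: "(f has_derivative A) (at x)"
    unfolding has_derivative_at_alt
  proof (intro conjI allI impI)
    show "bounded_linear A" unfolding A_def
      by (rule bounded_linear_sum) (rule bounded_linear_mult_const[OF bounded_linear_inner_left])
    fix e :: real assume "0 < e"
    obtain \<delta> where \<delta>0: "\<delta> > 0" and "\<And>y h. norm (y - x) < \<delta> \<Longrightarrow> norm h < \<delta> \<Longrightarrow>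
        \<bar>f (y + (\<Sum>d\<in>D. (h \<bullet> d) *\<^sub>R d)) - f y - A h\<bar> \<le> e * norm h"
      using step[OF order_refl \<open>0 < e\<close>] unfolding A_def by blast
    from this(2)[of x] have this_x: "norm (x - x) < \<delta> \<Longrightarrow> norm h < \<delta> \<Longrightarrow> \<bar>f (x + (\<Sum>d\<in>D. (h \<bullet> d) *\<^sub>R d)) - f x - A h\<bar> \<le> e * norm h" for h .
    have \<delta>: "\<bar>f (x + h) - f x - A h\<bar> \<le> e * norm h" if "norm h < \<delta>" for h
    proof -
      have "(\<Sum>d\<in>D. (h \<bullet> d) *\<^sub>R d) = h" using rep_D[of h] by (rule sym)
      then show ?thesis using that \<delta>0 this_x[of h] by simp
    qed
    show "\<exists>d>0. \<forall>y. norm (y - x) < d \<longrightarrow> norm (f y - f x - A (y - x)) \<le> e * norm (y - x)"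
    proof (intro exI[of _ \<delta>] conjI allI impI \<delta>0)
      fix y assume "norm (y - x) < \<delta>"
      from \<delta>[OF this] show "norm (f y - f x - A (y - x)) \<le> e * norm (y - x)"
        by simp
    qed
  qed
  \<comment> \<open>\<open>A\<close> was assembled from the basis directions; in any other direction
    it agrees with \<open>f' x\<close> because one-variable derivatives are unique.\<close>
  have "f' x v = A v" for v
  proof -
    have "((\<lambda>s. x + s *\<^sub>R v) has_derivative (\<lambda>s. s *\<^sub>R v)) (at 0)"
      by (auto intro!: derivative_eq_intros)
    moreover have "(f has_derivative A) (at (x + 0 *\<^sub>R v))" using der by simp
    ultimately have "((\<lambda>s. f (x + s *\<^sub>R v)) has_derivative (\<lambda>s. A (s *\<^sub>R v))) (at 0)"
      by (rule has_derivative_compose)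
    moreover have "A (s *\<^sub>R v) = A v * s" for s
      using bounded_linear.linear[OF has_derivative_bounded_linear[OF der]] by (simp add: linear_scale)
    ultimately have "((\<lambda>s. f (x + s *\<^sub>R v)) has_real_derivative A v) (at 0)"
      by (simp add: has_field_derivative_def)
    then show ?thesis using dir[OF x] DERIV_unique by blast
  qed
  then have "f' x = A" by (rule ext)
  then show ?thesis using der by simp
qed

text \<open>Each differentiation under the integral sign brings out a factor \<open>t\<close>, so
  the weight \<open>t ^ n\<close> makes the family closed under differentiation.\<close>

definition segment_average :: "nat \<Rightarrow> 'e \<Rightarrow> ('e \<Rightarrow> real) \<Rightarrow> 'e \<Rightarrow> real" where
  "segment_average n y w x = integral (cbox 0 1) (\<lambda>t. t ^ n * w (y + t *\<^sub>R (x - y)))"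

text \<open>The Leibniz rule for one real parameter gives the derivative along a line, namely the
  average of weight \<open>n + 1\<close> of a directional derivative of \<open>w\<close>;
  \<open>directional_imp_has_derivative\<close> upgrades this to a total derivative, and the
  induction on \<open>k\<close> continues with it.\<close>

lemma Ck_on_segment_average:
  assumes S: "open S" "convex S" "y \<in> S" and "Ck_on k w S"
  shows "Ck_on k (segment_average n y w) S"
proof -
  have inS: "y + t *\<^sub>R (x - y) \<in> S" if "x \<in> S" "t \<in> cbox 0 1" for x t
  proof -
    have "(1 - t) *\<^sub>R y + t *\<^sub>R x \<in> S"
      by (rule convexD[OF S(2,3) that(1)]) (use that in auto)
    then show ?thesis by (simp add: algebra_simps)
  qed
  have cont: "continuous_on (S \<times> cbox 0 1) (\<lambda>(x, t). t ^ n * w (y + t *\<^sub>R (x - y)))"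
    if "continuous_on S w" for w :: "'e \<Rightarrow> real" and n
    unfolding split_beta
    by (intro continuous_intros continuous_on_compose2[OF that]) (use inS in auto)
  show ?thesis
    using assms(4)
  proof (induction k arbitrary: n w)
    case 0
    then show ?case using integral_continuous_on_param[OF cont, of w n]
      by (simp add: segment_average_def[abs_def] del: cbox_interval)
  next
    case (Suc k)
    note E = Ck_on_Suc_E[OF Suc.prems]
    have cw: "continuous_on S w" by (rule Ck_on_continuous[OF Suc.prems])
    have cw': "continuous_on S (\<lambda>x. frechet_derivative w (at x) v)" for v by (rule Ck_on_continuous[OF E(2)])
    let ?f' = "\<lambda>x v. segment_average (Suc n) y (\<lambda>x. frechet_derivative w (at x) v) x"
    have "(segment_average n y w has_derivative ?f' x) (at x)" if "x \<in> S" for x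
    proof (rule directional_imp_has_derivative[where f'="?f'", OF S(1) _ _ that])
      show "continuous_on S (\<lambda>x. ?f' x v)" for v
        using integral_continuous_on_param[OF cont[OF cw'[of v], of "Suc n"]]
        by (simp add: segment_average_def[abs_def] del: cbox_interval power_Suc)
      fix x v assume x: "x \<in> S"
      \<comment> \<open>The parameters for which the line through \<open>x\<close> stays in
        \<open>S\<close>. As \<open>U\<close> is open and contains 0, a derivative within
        \<open>U\<close> is a derivative at 0.\<close>
      define U where "U = {s::real. x + s *\<^sub>R v \<in> S}"
      have "open U" unfolding U_def
        by (rule open_vimage[of S "\<lambda>s. x + s *\<^sub>R v", unfolded vimage_def])
           (auto intro!: continuous_intros S)
      have "convex U"
      proof (rule convexI)
        fix s t a b :: real assume st: "s \<in> U" "t \<in> U" and ab: "0 \<le> a" "0 \<le> b" "a + b = 1"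
        have "a *\<^sub>R (x + s *\<^sub>R v) + b *\<^sub>R (x + t *\<^sub>R v) \<in> S"
          by (rule convexD[OF S(2)]) (use st ab in \<open>auto simp: U_def\<close>)
        moreover have "a *\<^sub>R (x + s *\<^sub>R v) + b *\<^sub>R (x + t *\<^sub>R v) = (a + b) *\<^sub>R x + (a *\<^sub>R s + b *\<^sub>R t) *\<^sub>R v"
          by (simp add: algebra_simps)
        ultimately show "a *\<^sub>R s + b *\<^sub>R t \<in> U" using ab by (simp add: U_def)
      qed
      have at0: "at 0 within U = at 0" by (rule at_within_open[OF _ \<open>open U\<close>]) (use x in \<open>simp add: U_def\<close>)
      have U: "x + s *\<^sub>R v \<in> S" if "s \<in> U" for s using that by (simp add: U_def)
      have sub: "continuous_on (U \<times> cbox 0 1) (\<lambda>(s, t). t ^ m * u (y + t *\<^sub>R (x + s *\<^sub>R v - y)))"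
        if "continuous_on S u" for u :: "'e \<Rightarrow> real" and m
        unfolding split_beta
        by (intro continuous_intros continuous_on_compose2[OF that]) (use inS U in auto)
      have "((\<lambda>s. integral (cbox 0 1) (\<lambda>t. t ^ n * w (y + t *\<^sub>R (x + s *\<^sub>R v - y)))) has_field_derivative
          integral (cbox 0 1) (\<lambda>t. t ^ Suc n * frechet_derivative w (at (y + t *\<^sub>R (x + 0 *\<^sub>R v - y))) v)) (at 0 within U)"
      proof (rule leibniz_rule_field_derivative[where fx="\<lambda>s t. t ^ Suc n * frechet_derivative w (at (y + t *\<^sub>R (x + s *\<^sub>R v - y))) v"])
        show "0 \<in> U" using x by (simp add: U_def)
        show "convex U" by fact
        show "continuous_on (U \<times> cbox 0 1) (\<lambda>(s, t). t ^ Suc n * frechet_derivative w (at (y + t *\<^sub>R (x + s *\<^sub>R v - y))) v)"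
          using sub[OF cw'] .
        show "(\<lambda>t. t ^ n * w (y + t *\<^sub>R (x + s *\<^sub>R v - y))) integrable_on cbox 0 1" if "s \<in> U" for s
          by (intro integrable_continuous continuous_intros continuous_on_compose2[OF cw]) (use inS U that in auto)
        fix s t :: real assume s: "s \<in> U" and t: "t \<in> cbox 0 1"
        let ?z = "y + t *\<^sub>R (x + s *\<^sub>R v - y)"
        have z: "?z \<in> S" by (rule inS[OF U[OF s] t])
        have lin: "linear (frechet_derivative w (at ?z))" using E(1)[OF z] by (rule has_derivative_linear)
        have "((\<lambda>s. y + t *\<^sub>R (x + s *\<^sub>R v - y)) has_derivative (\<lambda>h. t *\<^sub>R h *\<^sub>R v)) (at s)"
          by (auto intro!: derivative_eq_intros)
        from has_derivative_compose[OF this E(1)[OF z]]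
        have "((\<lambda>s. w (y + t *\<^sub>R (x + s *\<^sub>R v - y))) has_derivative (\<lambda>h. t * frechet_derivative w (at ?z) v * h)) (at s)"
          by (rule has_derivative_eq_rhs) (simp add: linear_scale[OF lin] mult_ac fun_eq_iff)
        then have "((\<lambda>s. w (y + t *\<^sub>R (x + s *\<^sub>R v - y))) has_field_derivative (t * frechet_derivative w (at ?z) v)) (at s)"
          by (simp add: has_field_derivative_def)
        from has_field_derivative_at_within[OF DERIV_cmult[OF this, of "t ^ n"], of U]
        show "((\<lambda>s. t ^ n * w (y + t *\<^sub>R (x + s *\<^sub>R v - y))) has_field_derivative t ^ Suc n * frechet_derivative w (at ?z) v) (at s within U)"
          by (simp add: mult_ac)
      qed
      then have "((\<lambda>s. segment_average n y w (x + s *\<^sub>R v)) has_real_derivative ?f' x v) (at 0 within U)"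
        unfolding segment_average_def scaleR_zero_left add_0_right .
      then show "((\<lambda>s. segment_average n y w (x + s *\<^sub>R v)) has_real_derivative ?f' x v) (at 0)"
        unfolding at0 .
    qed
    then show ?case
    proof (rule Ck_on_SucI[OF S(1)])
      show "Ck_on k (\<lambda>x. ?f' x v) S" for v using Suc.IH[OF E(2)[of v], of "Suc n"] .
    qed
  qed
qed

text \<open>The fundamental theorem of calculus on the segment from \<open>y\<close> to
  \<open>x\<close>, with the derivative expanded in \<open>D\<close>. What matters is that the
  coefficients \<open>h d\<close> are again smooth, so that a derivation can be applied to the
  identity.\<close>

lemma hadamard:
  assumes S: "open S" "convex S" "y \<in> S" and g: "smooth_on g S"
  defines "h \<equiv> \<lambda>d. segment_average 0 y (\<lambda>x. frechet_derivative g (at x) d)"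
  shows "smooth_on (h d) S"
    and "h d y = frechet_derivative g (at y) d"
    and "x \<in> S \<Longrightarrow> g x = g y + (\<Sum>d\<in>D. ((x - y) \<bullet> d) * h d x)"
proof -
  have E: "(g has_derivative frechet_derivative g (at x)) (at x)" if "x \<in> S" for x
    by (rule Ck_on_Suc_E(1)[OF _ that]) (use g in \<open>auto simp: smooth_on_def simp del: Ck_on.simps\<close>)
  have E2: "Ck_on k (\<lambda>x. frechet_derivative g (at x) v) S" for k v
    by (rule Ck_on_Suc_E(2)) (use g in \<open>auto simp: smooth_on_def simp del: Ck_on.simps\<close>)
  show "smooth_on (h d) S" unfolding smooth_on_def h_def
    by (intro allI Ck_on_segment_average[OF S E2])
  show "h d y = frechet_derivative g (at y) d" by (simp add: h_def segment_average_def)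
  assume x: "x \<in> S"
  have inS: "y + t *\<^sub>R (x - y) \<in> S" if "t \<in> {0..1}" for t
  proof -
    have "(1 - t) *\<^sub>R y + t *\<^sub>R x \<in> S"
      by (rule convexD[OF S(2,3) x]) (use that in auto)
    then show ?thesis by (simp add: algebra_simps)
  qed
  let ?F = "\<lambda>t. \<Sum>d\<in>D. ((x - y) \<bullet> d) * frechet_derivative g (at (y + t *\<^sub>R (x - y))) d"
  have "(?F has_integral (g (y + 1 *\<^sub>R (x - y)) - g (y + 0 *\<^sub>R (x - y)))) {0..1}"
  proof (rule fundamental_theorem_of_calculus)
    fix t :: real assume t: "t \<in> {0..1}"
    let ?z = "y + t *\<^sub>R (x - y)"
    note Ez = E[OF inS[OF t]]
    have lin: "linear (frechet_derivative g (at ?z))" using Ez by (rule has_derivative_linear)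
    have eq: "frechet_derivative g (at ?z) (x - y) = ?F t"
      by (rule trans[OF arg_cong[OF rep_D]]) (simp add: linear_sum[OF lin] linear_scale[OF lin])
    have "((\<lambda>t. y + t *\<^sub>R (x - y)) has_derivative (\<lambda>h. h *\<^sub>R (x - y))) (at t)"
      by (auto intro!: derivative_eq_intros)
    from has_derivative_compose[OF this Ez]
    have "((\<lambda>t. g (y + t *\<^sub>R (x - y))) has_derivative (\<lambda>h. h *\<^sub>R frechet_derivative g (at ?z) (x - y))) (at t)"
      by (simp add: linear_scale[OF lin])
    then show "((\<lambda>t. g (y + t *\<^sub>R (x - y))) has_vector_derivative ?F t) (at t within {0..1})"
      unfolding eq has_vector_derivative_def by (rule has_derivative_at_withinI)
  qed simp
  then have "integral {0..1} ?F = g x - g y" by (simp add: integral_unique)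
  moreover have "integral {0..1} ?F = (\<Sum>d\<in>D. ((x - y) \<bullet> d) * h d x)"
  proof -
    have "(\<lambda>t. frechet_derivative g (at (y + t *\<^sub>R (x - y))) d) integrable_on {0..1}" for d
      by (intro integrable_continuous_interval continuous_on_compose2[OF Ck_on_continuous[OF E2]] continuous_intros)
        (use inS in auto)
    from integrable_on_mult_right[OF this]
    have "(\<lambda>t. ((x - y) \<bullet> d) * frechet_derivative g (at (y + t *\<^sub>R (x - y))) d) integrable_on {0..1}" for d .
    then show ?thesis
      by (subst integral_sum[OF finite_D]) (simp_all add: h_def segment_average_def)
  qed
  ultimately show "g x = g y + (\<Sum>d\<in>D. ((x - y) \<bullet> d) * h d x)"
    by linarith
qed

end

section \<open>A smooth bump function built from exp(-1/t)\<close>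

definition flat_exp :: "nat \<Rightarrow> real \<Rightarrow> real" where
  "flat_exp n t = (if t > 0 then exp (- inverse t) * inverse t ^ n else 0)"

text \<open>The term of order \<open>n + 2\<close> in the exponential series at
  \<open>u = 1/t\<close> is at most \<open>exp u\<close>. This leaves two powers of \<open>t\<close>
  to spare, one more than the difference quotient at 0 consumes.\<close>

lemma flat_exp_bound: "\<bar>flat_exp n t\<bar> \<le> fact (n + 2) * t\<^sup>2"
proof (cases "t > 0")
  case True
  define u where "u = inverse t"
  have u: "u > 0" using True by (simp add: u_def)
  have "u ^ (n + 2) / fact (n + 2) \<le> exp u"
  proof -
    have "(\<Sum>i<n+3. u ^ i /\<^sub>R fact i) \<le> exp u"
      unfolding exp_def using u by (intro sum_le_suminf summable_exp_generic) auto
    moreover have "u ^ (n + 2) /\<^sub>R fact (n + 2) \<le> (\<Sum>i<n+3. u ^ i /\<^sub>R fact i)"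
      using u by (intro member_le_sum) auto
    ultimately show ?thesis by (simp add: divide_inverse mult.commute)
  qed
  then have "exp (- u) * u ^ n \<le> fact (n + 2) / u ^ 2"
    using u by (simp add: exp_minus field_simps power_add power2_eq_square del: fact_Suc of_nat_Suc add_2_eq_Suc')
  also have "\<dots> = fact (n + 2) * t\<^sup>2" using True by (simp add: u_def field_simps)
  finally show ?thesis using True u by (simp add: flat_exp_def u_def abs_mult)
qed (simp add: flat_exp_def)

lemma flat_exp_deriv: "(flat_exp n has_real_derivative flat_exp (n + 2) t - real n * flat_exp (n + 1) t) (at t)"
proof -
  consider "t > 0" | "t < 0" | "t = 0" by linarith
  then show ?thesis
  proof cases
    case 1
    have i: "(inverse has_real_derivative - (inverse t * inverse t)) (at t)"
      using DERIV_inverse[of t UNIV] 1 by (simp add: power2_eq_square)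
    have e: "((\<lambda>t. exp (- inverse t)) has_real_derivative exp (- inverse t) * (inverse t * inverse t)) (at t)"
      using DERIV_chain2[OF DERIV_exp DERIV_minus[OF i]] by simp
    have "real n * (inverse t ^ (n - Suc 0)) * (inverse t * inverse t) = real n * inverse t ^ (n + 1)"
      by (cases n) (auto simp: mult_ac)
    then have "((\<lambda>t. exp (- inverse t) * inverse t ^ n) has_real_derivative flat_exp (n + 2) t - real n * flat_exp (n + 1) t) (at t)"
      using DERIV_mult[OF e DERIV_power[OF i, of n]] 1
      by (cases n) (simp_all add: flat_exp_def algebra_simps)
    then show ?thesis
      by (rule has_field_derivative_transform_within_open[where S="{0<..}"]) (use 1 in \<open>auto simp: flat_exp_def\<close>)
  next
    case 2
    have "((\<lambda>t. 0) has_real_derivative flat_exp (n + 2) t - real n * flat_exp (n + 1) t) (at t)"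
      using 2 by (auto simp: flat_exp_def)
    then show ?thesis
      by (rule has_field_derivative_transform_within_open[where S="{..<0}"]) (use 2 in \<open>auto simp: flat_exp_def\<close>)
  next
    case 3
    have "((\<lambda>s. (flat_exp n s - flat_exp n 0) / (s - 0)) \<longlongrightarrow> 0) (at 0)"
    proof (rule Lim_null_comparison[where g="\<lambda>s. fact (n + 2) * \<bar>s\<bar>"])
      have "norm ((flat_exp n s - flat_exp n 0) / (s - 0)) \<le> fact (n + 2) * \<bar>s\<bar>" if "s \<noteq> 0" for s
        using flat_exp_bound[of n s] that 
        by (simp add: flat_exp_def[of n 0] abs_divide pos_divide_le_eq power2_eq_square mult.assoc flip: abs_mult)
      then show "\<forall>\<^sub>F s in at 0. norm ((flat_exp n s - flat_exp n 0) / (s - 0)) \<le> fact (n + 2) * \<bar>s\<bar>"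
        by (auto simp: eventually_at intro: exI[of _ 1])
      show "((\<lambda>s::real. fact (n + 2) * \<bar>s\<bar>) \<longlongrightarrow> 0) (at 0)"
        by (auto intro!: tendsto_eq_intros)
    qed
    then show ?thesis using 3 by (simp add: has_field_derivative_iff flat_exp_def)
  qed
qed

text \<open>Differentiation leads to the members \<open>n + 1\<close> and \<open>n + 2\<close> of
  the family, which is why the powers of \<open>1/t\<close> were included and \<open>n\<close>
  varies in the induction.\<close>

lemma Ck_on_flat_exp: "Ck_on k (flat_exp n) UNIV"
proof (induction k arbitrary: n)
  case 0
  then show ?case using DERIV_isCont[OF flat_exp_deriv] by (simp add: continuous_at_imp_continuous_on)
next
  case (Suc k)
  show ?case
  proof (rule Ck_on_SucI[OF open_UNIV])
    show "(flat_exp n has_derivative (\<lambda>v. v * (flat_exp (n + 2) t + - real n * flat_exp (n + 1) t))) (at t)" for t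
      using flat_exp_deriv[of n t] by (simp add: has_field_derivative_def mult_commute_abs)
    show "Ck_on k (\<lambda>t. v * (flat_exp (n + 2) t + - real n * flat_exp (n + 1) t)) UNIV" for v
      by (intro Ck_on_mult Ck_on_add Ck_on_const Suc open_UNIV)
  qed
qed

text \<open>\<open>flat_exp 0\<close> is applied to r^2 - |x - a|^2, positive exactly inside the
  ball. Writing this argument as a polynomial in the coordinates reduces smoothness to sums and
  products.\<close>

lemma (in orthonormal_basis) bump_exists:
  assumes "r > 0"
  shows "\<exists>b::'e \<Rightarrow> real. smooth_on b UNIV \<and> b a \<noteq> 0 \<and> (\<forall>x. x \<notin> cball a r \<longrightarrow> b x = 0)"
proof (intro exI conjI allI impI)
  define q where "q x = r\<^sup>2 + - 1 * (\<Sum>d\<in>D. ((x + - a) \<bullet> d) * ((x + - a) \<bullet> d))" for x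
  have q: "q x = r\<^sup>2 - (dist a x)\<^sup>2" for x
    using inner_rep[of "x - a" "x - a"]
    by (simp add: q_def dist_norm norm_minus_commute[of a] power2_norm_eq_inner)
  have lin: "Ck_on k (\<lambda>x. (x + - a) \<bullet> d) UNIV" for k d
    by (rule Ck_on_bounded_linear[OF open_UNIV bounded_linear_inner_left
          Ck_on_add[OF open_UNIV Ck_on_linear[OF open_UNIV bounded_linear_ident] Ck_on_const]])
  have "Ck_on k q UNIV" for k
    unfolding q_def by (intro Ck_on_add Ck_on_const Ck_on_mult Ck_on_sum lin open_UNIV)
  then show "smooth_on (\<lambda>x. flat_exp 0 (q x)) UNIV" unfolding smooth_on_def
    by (intro allI orthonormal_basis.Ck_on_compose[OF orthonormal_basis_real open_UNIV open_UNIV _ Ck_on_flat_exp]) auto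
  show "flat_exp 0 (q a) \<noteq> 0" using assms by (simp add: q flat_exp_def)
  show "flat_exp 0 (q x) = 0" if "x \<notin> cball a r" for x
    using that assms by (simp add: q flat_exp_def not_less power_mono)
qed

section \<open>Smooth functions, vector fields and local frames\<close>

lemma smooth_functionsI:
  assumes "\<And>U \<phi>. (U, \<phi>) \<in> A \<Longrightarrow> smooth_on (f \<circ> inv_into U \<phi>) (\<phi> ` U)"
  shows "f \<in> smooth_functions A"
  using assms by (auto simp: smooth_functions_def)

lemma smooth_functionsD:
  assumes "f \<in> smooth_functions A" "(U, \<phi>) \<in> A"
  shows "smooth_on (f \<circ> inv_into U \<phi>) (\<phi> ` U)"
  using assms by (auto simp: smooth_functions_def)

locale smooth_manifold =
  fixes A :: "('m::{t2_space,second_countable_topology}, 'e::real_inner) atlas"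
  assumes atlas: "smooth_atlas A"
begin

abbreviation "C \<equiv> smooth_functions A"
abbreviation "T \<equiv> tangent_space A"
abbreviation "V \<equiv> vector_fields A"

lemma chart_open: "(U, \<phi>) \<in> A \<Longrightarrow> open U" "(U, \<phi>) \<in> A \<Longrightarrow> open (\<phi> ` U)"
  and chart_homeo: "(U, \<phi>) \<in> A \<Longrightarrow> homeomorphism U (\<phi> ` U) \<phi> (inv_into U \<phi>)"
  and chart_trans: "(U, \<phi>) \<in> A \<Longrightarrow> (V', \<psi>) \<in> A \<Longrightarrow> smooth_on (\<psi> \<circ> inv_into U \<phi>) (\<phi> ` (U \<inter> V'))"
  and chart_cover: "\<exists>U \<phi>. (U, \<phi>) \<in> A \<and> p \<in> U"
proof -
  have cov: "(\<Union>(U, \<phi>)\<in>A. U) = UNIV"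
    and ch: "\<forall>(U, \<phi>)\<in>A. open U \<and> open (\<phi> ` U) \<and> homeomorphism U (\<phi> ` U) \<phi> (inv_into U \<phi>)"
    and tr: "\<forall>(U, \<phi>)\<in>A. \<forall>(V, \<psi>)\<in>A. smooth_on (\<psi> \<circ> inv_into U \<phi>) (\<phi> ` (U \<inter> V))"
    using atlas unfolding smooth_atlas_def by blast+
  from bspec[OF ch] show "(U, \<phi>) \<in> A \<Longrightarrow> open U" "(U, \<phi>) \<in> A \<Longrightarrow> open (\<phi> ` U)"
    "(U, \<phi>) \<in> A \<Longrightarrow> homeomorphism U (\<phi> ` U) \<phi> (inv_into U \<phi>)" by auto
  from bspec[OF tr] show "(U, \<phi>) \<in> A \<Longrightarrow> (V', \<psi>) \<in> A \<Longrightarrow> smooth_on (\<psi> \<circ> inv_into U \<phi>) (\<phi> ` (U \<inter> V'))"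
    by fastforce
  have "p \<in> (\<Union>(U, \<phi>)\<in>A. U)" unfolding cov by simp
  then show "\<exists>U \<phi>. (U, \<phi>) \<in> A \<and> p \<in> U" by auto
qed

lemma basis_exists: "\<exists>D::'e set. orthonormal_basis D"
proof -
  have "\<exists>B::'e set. finite B \<and> span B = UNIV"
    using atlas unfolding smooth_atlas_def by (rule conjunct1)
  then show ?thesis using orthonormal_basis_exists by (elim exE conjE)
qed

lemma sf_const: "(\<lambda>q. c) \<in> C"
  by (rule smooth_functionsI) (simp only: smooth_on_def o_def Ck_on_const simp_thms)

lemma sf_add: "f \<in> C \<Longrightarrow> g \<in> C \<Longrightarrow> (\<lambda>q. f q + g q) \<in> C"
proof (rule smooth_functionsI)
  fix U \<phi> assume f: "f \<in> C" "g \<in> C" and chart: "(U, \<phi>) \<in> A"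
  show "smooth_on ((\<lambda>q. f q + g q) \<circ> inv_into U \<phi>) (\<phi> ` U)"
    unfolding smooth_on_def o_def
    by (intro allI Ck_on_add chart_open(2)[OF chart])
      (use smooth_functionsD[OF f(1) chart] smooth_functionsD[OF f(2) chart] in
        \<open>simp_all add: smooth_on_def o_def del: Ck_on.simps\<close>)
qed

lemma sf_mult: "f \<in> C \<Longrightarrow> g \<in> C \<Longrightarrow> (\<lambda>q. f q * g q) \<in> C"
proof (rule smooth_functionsI)
  fix U \<phi> assume f: "f \<in> C" "g \<in> C" and chart: "(U, \<phi>) \<in> A"
  show "smooth_on ((\<lambda>q. f q * g q) \<circ> inv_into U \<phi>) (\<phi> ` U)"
    unfolding smooth_on_def o_def
    by (intro allI Ck_on_mult chart_open(2)[OF chart])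
      (use smooth_functionsD[OF f(1) chart] smooth_functionsD[OF f(2) chart] in
        \<open>simp_all add: smooth_on_def o_def del: Ck_on.simps\<close>)
qed

lemma sf_sum: "(\<And>i. i \<in> I \<Longrightarrow> f i \<in> C) \<Longrightarrow> (\<lambda>q. \<Sum>i\<in>I. f i q) \<in> C"
  by (induction I rule: infinite_finite_induct) (auto intro: sf_const sf_add)

lemma tv_nonsmooth: "v \<in> T p \<Longrightarrow> f \<notin> C \<Longrightarrow> v f = 0"
  and tv_add: "v \<in> T p \<Longrightarrow> f \<in> C \<Longrightarrow> g \<in> C \<Longrightarrow> v (\<lambda>q. f q + g q) = v f + v g"
  and tv_cmult: "v \<in> T p \<Longrightarrow> f \<in> C \<Longrightarrow> v (\<lambda>q. c * f q) = c * v f"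
  and tv_mult: "v \<in> T p \<Longrightarrow> f \<in> C \<Longrightarrow> g \<in> C \<Longrightarrow> v (\<lambda>q. f q * g q) = v f * g p + f p * v g"
  unfolding tangent_space_def by blast+

lemma tv_zero: "v \<in> T p \<Longrightarrow> v (\<lambda>q. 0) = 0"
  using tv_cmult[of v p "\<lambda>q. 0" 0] sf_const by simp

text \<open>The Leibniz rule for \<open>1 * 1\<close> gives v(1) = 2 v(1).\<close>

lemma tv_const: "v \<in> T p \<Longrightarrow> v (\<lambda>q. c) = 0"
  using tv_cmult[of v p "\<lambda>q. 1" c] tv_mult[of v p "\<lambda>q. 1" "\<lambda>q. 1"] sf_const by simp

lemma tv_sum: "v \<in> T p \<Longrightarrow> (\<And>i. i \<in> I \<Longrightarrow> f i \<in> C) \<Longrightarrow> v (\<lambda>q. \<Sum>i\<in>I. f i q) = (\<Sum>i\<in>I. v (f i))"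
proof (induction I rule: infinite_finite_induct)
  case (insert i I)
  then show ?case using tv_add[of v p "f i" "\<lambda>q. \<Sum>i\<in>I. f i q"] sf_sum[of I f] by simp
qed (auto simp: tv_zero)

lemma tangent_spaceI:
  assumes "\<And>f. f \<notin> C \<Longrightarrow> v f = 0"
    and "\<And>f g. f \<in> C \<Longrightarrow> g \<in> C \<Longrightarrow> v (\<lambda>q. f q + g q) = v f + v g"
    and "\<And>f c. f \<in> C \<Longrightarrow> v (\<lambda>q. c * f q) = c * v f"
    and "\<And>f g. f \<in> C \<Longrightarrow> g \<in> C \<Longrightarrow> v (\<lambda>q. f q * g q) = v f * g p + f p * v g"
  shows "v \<in> T p"
  using assms unfolding tangent_space_def by blast

lemma vf_tangent: "X \<in> V \<Longrightarrow> X p \<in> T p"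
  and vf_smooth: "X \<in> V \<Longrightarrow> f \<in> C \<Longrightarrow> (\<lambda>p. X p f) \<in> C"
  unfolding vector_fields_def by blast+

lemma vector_fieldsI:
  "(\<And>p. X p \<in> T p) \<Longrightarrow> (\<And>f. f \<in> C \<Longrightarrow> (\<lambda>p. X p f) \<in> C) \<Longrightarrow> X \<in> V"
  unfolding vector_fields_def by blast

section \<open>Functions and fields supported in a chart\<close>

lemma chart_image_open:
  assumes "(U, \<phi>) \<in> A" "open W"
  shows "open (\<phi> ` (U \<inter> W))"
proof -
  have "continuous_on (\<phi> ` U) (inv_into U \<phi>)"
    using chart_homeo[OF assms(1)] by (simp add: homeomorphism_def)
  then have "open (inv_into U \<phi> -` W \<inter> \<phi> ` U)"
    using continuous_on_open_vimage[OF chart_open(2)[OF assms(1)]] assms(2) by blast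
  moreover have "inv_into U \<phi> -` W \<inter> \<phi> ` U = \<phi> ` (U \<inter> W)"
    using chart_homeo[OF assms(1)] by (auto simp: homeomorphism_def image_iff)
  ultimately show ?thesis by simp
qed

definition chart_lift :: "'m set \<Rightarrow> ('m \<Rightarrow> 'e) \<Rightarrow> ('e \<Rightarrow> real) \<Rightarrow> 'm \<Rightarrow> real" where
  "chart_lift U \<phi> u q = (if q \<in> U then u (\<phi> q) else 0)"

text \<open>The Hausdorff property enters here: \<open>K\<close> is the continuous image of a
  compact ball, hence closed. Any other chart domain is then covered by the open sets
  \<open>W\<close>, where the lift is \<open>u\<close> after a transition map, and
  \<open>- K\<close>, where it is zero. The margin \<open>r < R\<close> puts \<open>K\<close> inside
  \<open>W\<close>.\<close>

lemma chart_lift_smooth: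
  assumes chart: "(U, \<phi>) \<in> A" and ball: "ball a R \<subseteq> \<phi> ` U" and "r < R"
    and u: "smooth_on u (ball a R)" and supp: "\<And>x. x \<notin> cball a r \<Longrightarrow> u x = 0"
  shows "chart_lift U \<phi> u \<in> C"
proof (rule smooth_functionsI)
  fix V' \<psi> assume chart': "(V', \<psi>) \<in> A"
  obtain D :: "'e set" where D: "orthonormal_basis D" using basis_exists by blast
  let ?F = "chart_lift U \<phi> u \<circ> inv_into V' \<psi>"
  define K where "K = inv_into U \<phi> ` cball a r"
  define W where "W = \<phi> -` ball a R \<inter> U"
  have cont: "continuous_on U \<phi>" "continuous_on (\<phi> ` U) (inv_into U \<phi>)"
    and inv: "\<And>q. q \<in> U \<Longrightarrow> inv_into U \<phi> (\<phi> q) = q"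
    using chart_homeo[OF chart] by (auto simp: homeomorphism_def)
  have inv': "\<And>q. q \<in> V' \<Longrightarrow> inv_into V' \<psi> (\<psi> q) = q"
    using chart_homeo[OF chart'] by (auto simp: homeomorphism_def)
  have sub: "cball a r \<subseteq> ball a R" using \<open>r < R\<close> by auto
  have "compact K" unfolding K_def
    by (rule compact_continuous_image[OF continuous_on_subset[OF cont(2)] orthonormal_basis.compact_cball_D[OF D]])
      (use sub ball in auto)
  then have "open (- K)" by (simp add: compact_imp_closed open_Compl)
  have "open W" using cont(1) chart_open(1)[OF chart] unfolding W_def
    by (simp add: continuous_on_open_vimage)
  have op: "open (\<psi> ` (V' \<inter> W))" "open (\<psi> ` (V' \<inter> - K))"
    using chart_image_open[OF chart'] \<open>open W\<close> \<open>open (- K)\<close> by auto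
  have notK: "chart_lift U \<phi> u q = 0" if "q \<notin> K" for q
  proof (cases "q \<in> U")
    case True
    have "\<phi> q \<notin> cball a r" using that inv[OF True] unfolding K_def by (metis imageI)
    then show ?thesis by (simp add: chart_lift_def supp)
  qed (simp add: chart_lift_def)
  have eqV: "\<psi> ` V' = \<psi> ` (V' \<inter> W) \<union> \<psi> ` (V' \<inter> - K)"
  proof -
    have "q \<in> W" if "q \<in> K" for q
    proof -
      obtain x where x: "x \<in> cball a r" "q = inv_into U \<phi> x" using \<open>q \<in> K\<close> unfolding K_def by blast
      then have "x \<in> \<phi> ` U" "x \<in> ball a R" using sub ball by auto
      then show ?thesis using x by (simp add: W_def f_inv_into_f inv_into_into)
    qed
    then show ?thesis by blast
  qed
  have "Ck_on k ?F (\<psi> ` (V' \<inter> W) \<union> \<psi> ` (V' \<inter> - K))" for k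
  proof (rule Ck_on_Un[OF op])
    have "Ck_on k (\<phi> \<circ> inv_into V' \<psi>) (\<psi> ` (V' \<inter> W))"
      by (rule Ck_on_subset[of k _ "\<psi> ` (V' \<inter> U)"])
        (use chart_trans[OF chart' chart] in \<open>auto simp: smooth_on_def W_def simp del: Ck_on.simps\<close>)
    note tr = this
    have "Ck_on k (\<lambda>x. u ((\<phi> \<circ> inv_into V' \<psi>) x)) (\<psi> ` (V' \<inter> W))"
      by (rule orthonormal_basis.Ck_on_compose[OF D op(1) open_ball _ u[unfolded smooth_on_def, rule_format] tr])
        (use inv' in \<open>auto simp: W_def\<close>)
    then show "Ck_on k ?F (\<psi> ` (V' \<inter> W))"
      by (rule Ck_on_cong[OF op(1), rotated]) (use inv' in \<open>auto simp: chart_lift_def W_def\<close>)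
    show "Ck_on k ?F (\<psi> ` (V' \<inter> - K))"
      by (rule Ck_on_cong[OF op(2) _ Ck_on_const[of k 0]]) (use inv' notK in auto)
  qed
  then show "smooth_on ?F (\<psi> ` V')" unfolding smooth_on_def eqV by blast
qed

text \<open>The coordinate field in direction \<open>d\<close>, cut off by \<open>u\<close> and
  extended by zero. The value 0 on non-smooth \<open>f\<close> follows the convention of
  \<open>tangent_space\<close>.\<close>

definition chart_field :: "'m set \<Rightarrow> ('m \<Rightarrow> 'e) \<Rightarrow> ('e \<Rightarrow> real) \<Rightarrow> 'e \<Rightarrow> 'm \<Rightarrow> 'm tvec" where
  "chart_field U \<phi> u d q f = (if f \<in> C
     then chart_lift U \<phi> (\<lambda>x. u x * frechet_derivative (f \<circ> inv_into U \<phi>) (at x) d) q else 0)"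

lemma chart_derivative:
  assumes "(U, \<phi>) \<in> A" "f \<in> C" "x \<in> \<phi> ` U"
  shows "((f \<circ> inv_into U \<phi>) has_derivative frechet_derivative (f \<circ> inv_into U \<phi>) (at x)) (at x)"
  by (rule Ck_on_Suc_E(1)[OF _ assms(3)])
    (use smooth_functionsD[OF assms(2,1)] in \<open>auto simp: smooth_on_def simp del: Ck_on.simps\<close>)

lemma chart_field_vf:
  assumes chart: "(U, \<phi>) \<in> A" and ball: "ball a R \<subseteq> \<phi> ` U" and "r < R"
    and u: "smooth_on u (ball a R)" and supp: "\<And>x. x \<notin> cball a r \<Longrightarrow> u x = 0"
  shows "chart_field U \<phi> u d \<in> V"
proof (rule vector_fieldsI)
  note fd = frechet_derivative_at[symmetric]
  note der = chart_derivative[OF chart _ imageI]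
  have inv: "\<And>q. q \<in> U \<Longrightarrow> inv_into U \<phi> (\<phi> q) = q"
    using chart_homeo[OF chart] by (auto simp: homeomorphism_def)
  fix q
  show "chart_field U \<phi> u d q \<in> T q"
  proof (rule tangent_spaceI)
    fix f g c assume f: "f \<in> C"
    have "frechet_derivative ((\<lambda>q. c * f q) \<circ> inv_into U \<phi>) (at (\<phi> q)) d
        = c * frechet_derivative (f \<circ> inv_into U \<phi>) (at (\<phi> q)) d" if "q \<in> U"
      using fd[OF has_derivative_mult_right[OF der[OF f that], of c]] by (simp add: o_def)
    then show "chart_field U \<phi> u d q (\<lambda>q. c * f q) = c * chart_field U \<phi> u d q f"
      using f sf_mult[OF sf_const[of c] f] by (auto simp: chart_field_def chart_lift_def)
    assume g: "g \<in> C"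
    have "frechet_derivative ((\<lambda>q. f q + g q) \<circ> inv_into U \<phi>) (at (\<phi> q)) d
        = frechet_derivative (f \<circ> inv_into U \<phi>) (at (\<phi> q)) d + frechet_derivative (g \<circ> inv_into U \<phi>) (at (\<phi> q)) d" if "q \<in> U"
      using fd[OF has_derivative_add[OF der[OF f that] der[OF g that]]] by (simp add: o_def)
    then show "chart_field U \<phi> u d q (\<lambda>q. f q + g q) = chart_field U \<phi> u d q f + chart_field U \<phi> u d q g"
      using f g sf_add[OF f g] by (auto simp: chart_field_def chart_lift_def algebra_simps)
    have "frechet_derivative ((\<lambda>q. f q * g q) \<circ> inv_into U \<phi>) (at (\<phi> q)) d
        = f q * frechet_derivative (g \<circ> inv_into U \<phi>) (at (\<phi> q)) d + frechet_derivative (f \<circ> inv_into U \<phi>) (at (\<phi> q)) d * g q" if "q \<in> U"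
      using fd[OF has_derivative_mult[OF der[OF f that] der[OF g that]]] inv[OF that] by (simp add: o_def)
    then show "chart_field U \<phi> u d q (\<lambda>q. f q * g q) = chart_field U \<phi> u d q f * g q + f q * chart_field U \<phi> u d q g"
      using f g sf_mult[OF f g] by (auto simp: chart_field_def chart_lift_def algebra_simps)
  qed (simp add: chart_field_def)
  fix f assume f: "f \<in> C"
  have sm: "Ck_on k (\<lambda>x. frechet_derivative (f \<circ> inv_into U \<phi>) (at x) d) (ball a R)" for k
    by (rule Ck_on_subset[OF Ck_on_Suc_E(2) ball])
      (use smooth_functionsD[OF f chart] in \<open>auto simp: smooth_on_def simp del: Ck_on.simps\<close>)
  have "chart_lift U \<phi> (\<lambda>x. u x * frechet_derivative (f \<circ> inv_into U \<phi>) (at x) d) \<in> C"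
    by (rule chart_lift_smooth[OF chart ball \<open>r < R\<close>])
      (use u sm supp in \<open>auto simp: smooth_on_def intro!: Ck_on_mult simp del: Ck_on.simps\<close>)
  then show "(\<lambda>q. chart_field U \<phi> u d q f) \<in> C" using f by (simp add: chart_field_def[abs_def])
qed

text \<open>The factor \<open>b\<close> plays the role of a cut-off function: Hadamard's lemma only holds on a ball, and
  \<open>b\<^sup>2\<close> times it is an identity between globally defined functions, to which a tangent vector applies.\<close>

lemma local_frame:
  "\<exists>\<eta>\<in>C. \<eta> p \<noteq> 0 \<and> (\<exists>(I :: ('e \<times> bool) set) g E. finite I \<and> (\<forall>i\<in>I. g i \<in> C \<and> E i \<in> V) \<and>
     (\<forall>q. \<forall>v\<in>T q. \<forall>f. \<eta> q * v f = (\<Sum>i\<in>I. v (g i) * E i q f)))"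
proof -
  obtain U \<phi> where chart: "(U, \<phi>) \<in> A" and p: "p \<in> U" using chart_cover by blast
  obtain D :: "'e set" where "orthonormal_basis D" using basis_exists by blast
  then interpret orthonormal_basis D .
  obtain R where R: "R > 0" "ball (\<phi> p) R \<subseteq> \<phi> ` U"
    using chart_open(2)[OF chart] p openE by blast
  have inv: "\<And>q. q \<in> U \<Longrightarrow> inv_into U \<phi> (\<phi> q) = q"
    using chart_homeo[OF chart] by (auto simp: homeomorphism_def)
  obtain b :: "'e \<Rightarrow> real" where b: "smooth_on b UNIV" "b (\<phi> p) \<noteq> 0" "\<And>x. x \<notin> cball (\<phi> p) (R/2) \<Longrightarrow> b x = 0"
    using bump_exists[of "R/2" "\<phi> p"] R by auto
  let ?B = "ball (\<phi> p) R"
  have bB: "smooth_on b ?B" using b(1) by (auto simp: smooth_on_def intro: Ck_on_subset simp del: Ck_on.simps)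
  have R2: "R/2 < R" using R by simp
  note lift = chart_lift_smooth[OF chart R(2) R2]
  have mult: "smooth_on (\<lambda>x. b x * h x) ?B" if "smooth_on h ?B" for h
    using bB that by (auto simp: smooth_on_def intro: Ck_on_mult simp del: Ck_on.simps)
  have coord: "smooth_on (\<lambda>x. x \<bullet> d) ?B" for d
    by (auto simp: smooth_on_def intro: Ck_on_linear bounded_linear_inner_left simp del: Ck_on.simps)
  let ?L = "chart_lift U \<phi>"
  have Lb: "?L b \<in> C" by (rule lift[OF bB b(3)])
  have Lbh: "?L (\<lambda>x. b x * h x) \<in> C" if "smooth_on h ?B" for h
    by (rule lift[OF mult[OF that]]) (simp add: b(3))
  note Lbx = Lbh[OF coord]
  \<comment> \<open>A coordinate x_d is not a global function, so v(x_d) has no meaning. But b^2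
    v(x_d) = b v(b x_d) - b x_d v(b) involves cut-off functions alone; the indices
    \<open>(d, True)\<close> and \<open>(d, False)\<close> carry the two terms on the right.\<close>
  define g where "g = (\<lambda>(d, c). if c then ?L (\<lambda>x. b x * (x \<bullet> d)) else ?L b)"
  define E where "E = (\<lambda>(d, c). if c then chart_field U \<phi> b d else chart_field U \<phi> (\<lambda>x. b x * - (x \<bullet> d)) d)"
  have Ci: "g i \<in> C \<and> E i \<in> V" for i
  proof -
    obtain d c where i: "i = (d, c)" by fastforce
    have neg: "smooth_on (\<lambda>x. - (x \<bullet> d)) ?B"
      unfolding smooth_on_def by (intro allI Ck_on_linear bounded_linear_minus bounded_linear_inner_left open_ball)
    have "chart_field U \<phi> b d \<in> V" by (rule chart_field_vf[OF chart R(2) R2 bB b(3)])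
    moreover have "chart_field U \<phi> (\<lambda>x. b x * - (x \<bullet> d)) d \<in> V"
      by (rule chart_field_vf[OF chart R(2) R2 mult[OF neg]]) (simp add: b(3))
    ultimately show ?thesis using Lb Lbx by (auto simp: i g_def E_def)
  qed
  have main: "(?L b q * ?L b q) * v f = (\<Sum>i\<in>D \<times> {True, False}. v (g i) * E i q f)" if v: "v \<in> T q" for q v f
  proof (cases "f \<in> C \<and> q \<in> U \<and> \<phi> q \<in> ?B")
    case False
    moreover have "b (\<phi> q) = 0" if "\<phi> q \<notin> ?B" using that R by (intro b(3)) auto
    ultimately have "E i q f = 0" for i
      by (cases i) (auto simp: E_def chart_field_def chart_lift_def)
    moreover have "(?L b q * ?L b q) * v f = 0"
      using False tv_nonsmooth[OF v] \<open>\<phi> q \<notin> ?B \<Longrightarrow> b (\<phi> q) = 0\<close> by (auto simp: chart_lift_def)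
    ultimately show ?thesis by simp
  next
    case True
    then have f: "f \<in> C" and q: "q \<in> U" and y: "\<phi> q \<in> ?B" by auto
    let ?f = "f \<circ> inv_into U \<phi>"
    have smf: "smooth_on ?f ?B"
      using smooth_functionsD[OF f chart] R(2) by (auto simp: smooth_on_def intro: Ck_on_subset simp del: Ck_on.simps)
    define h where "h d = segment_average 0 (\<phi> q) (\<lambda>x. frechet_derivative ?f (at x) d)" for d
    note h = hadamard[OF open_ball convex_ball y smf, folded h_def]
    let ?H = "\<lambda>d. ?L (\<lambda>x. b x * h d x)"
    let ?X = "\<lambda>d. ?L (\<lambda>x. b x * (x \<bullet> d))"
    let ?y = "\<lambda>d. \<phi> q \<bullet> d"
    have H: "?H d \<in> C" for d by (rule Lbh[OF h(1)])
    \<comment> \<open>Hadamard's formula at the base point \<open>\<phi> q\<close>, multiplied by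
      b^2: one factor \<open>b\<close> globalises the coordinate difference, the other the
      coefficient \<open>h d\<close>.\<close>
    have eq: "?L b q' * (?L b q' * f q') = f q * (?L b q' * ?L b q') + (\<Sum>d\<in>D. (?X d q' + - ?y d * ?L b q') * ?H d q')" for q'
    proof (cases "q' \<in> U \<and> \<phi> q' \<in> ?B")
      case False
      moreover have "b (\<phi> q') = 0" if "\<phi> q' \<notin> ?B" using that R by (intro b(3)) auto
      ultimately show ?thesis by (auto simp: chart_lift_def)
    next
      case True
      then have "f q' = f q + (\<Sum>d\<in>D. ((\<phi> q' - \<phi> q) \<bullet> d) * h d (\<phi> q'))"
        using h(3)[of "\<phi> q'"] inv q by simp
      moreover have "(\<Sum>d\<in>D. (?X d q' + - ?y d * ?L b q') * ?H d q')
          = b (\<phi> q') * b (\<phi> q') * (\<Sum>d\<in>D. ((\<phi> q' - \<phi> q) \<bullet> d) * h d (\<phi> q'))"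
        unfolding sum_distrib_left
        by (rule sum.cong) (use True in \<open>simp_all add: chart_lift_def algebra_simps\<close>)
      ultimately show ?thesis using True by (simp add: chart_lift_def algebra_simps)
    qed
    have lhs: "v (\<lambda>q'. ?L b q' * (?L b q' * f q')) = v (?L b) * (?L b q * f q) + ?L b q * (v (?L b) * f q + ?L b q * v f)"
      by (simp only: tv_mult[OF v Lb sf_mult[OF Lb f]] tv_mult[OF v Lb f])
    have Xy: "(\<lambda>q'. ?X d q' + - ?y d * ?L b q') \<in> C" for d
      by (rule sf_add[OF Lbx sf_mult[OF sf_const Lb]])
    have vXy: "v (\<lambda>q'. ?X d q' + - ?y d * ?L b q') = v (?X d) + - ?y d * v (?L b)" for d
      by (simp only: tv_add[OF v Lbx sf_mult[OF sf_const Lb], of d "- ?y d"] tv_cmult[OF v Lb, of "- ?y d"])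
    \<comment> \<open>The first factor vanishes at \<open>q\<close>, so the Leibniz rule leaves only
      its own derivative.\<close>
    have vt: "v (\<lambda>q'. (?X d q' + - ?y d * ?L b q') * ?H d q') = (v (?X d) + - ?y d * v (?L b)) * ?H d q" for d
      using tv_mult[OF v Xy H, of d d] vXy[of d] q by (simp add: chart_lift_def)
    have rhs: "v (\<lambda>q'. f q * (?L b q' * ?L b q') + (\<Sum>d\<in>D. (?X d q' + - ?y d * ?L b q') * ?H d q'))
      = f q * (v (?L b) * ?L b q + ?L b q * v (?L b)) + (\<Sum>d\<in>D. (v (?X d) + - ?y d * v (?L b)) * ?H d q)"
      by (simp only: tv_add[OF v sf_mult[OF sf_const[of "f q"] sf_mult[OF Lb Lb]] sf_sum[of D "\<lambda>d q'. (?X d q' + - ?y d * ?L b q') * ?H d q'", OF sf_mult[OF Xy H]]]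
        tv_cmult[OF v sf_mult[OF Lb Lb], of "f q"] tv_mult[OF v Lb Lb]
        tv_sum[OF v, of D "\<lambda>d q'. (?X d q' + - ?y d * ?L b q') * ?H d q'", OF sf_mult[OF Xy H]] vt)
    have "(?L b q * ?L b q) * v f = (\<Sum>d\<in>D. (v (?X d) + - ?y d * v (?L b)) * ?H d q)"
    proof -
      have "v (\<lambda>q'. ?L b q' * (?L b q' * f q')) = v (\<lambda>q'. f q * (?L b q' * ?L b q') + (\<Sum>d\<in>D. (?X d q' + - ?y d * ?L b q') * ?H d q'))"
        by (rule arg_cong[of _ _ v]) (rule ext, rule eq)
      moreover have "a * (l * F) + l * (a * F + l * w) = F * (a * l + l * a) + S \<Longrightarrow> l * l * w = S" for a l F w S :: real
        by (simp add: algebra_simps)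
      ultimately show ?thesis unfolding lhs rhs by blast
    qed
    also have "\<dots> = (\<Sum>d\<in>D. \<Sum>c\<in>{True, False}. v (g (d, c)) * E (d, c) q f)"
      by (intro sum.cong refl) (use f q h(2) in \<open>simp add: g_def E_def chart_field_def chart_lift_def algebra_simps\<close>)
    also have "\<dots> = (\<Sum>i\<in>D \<times> {True, False}. v (g i) * E i q f)"
      unfolding sum.cartesian_product by (rule sum.cong) auto
    finally show ?thesis .
  qed
  show ?thesis
  proof (intro bexI conjI exI)
    show "finite (D \<times> {True, False})" using finite_D by simp
    show "\<forall>q. \<forall>v\<in>T q. \<forall>f. (?L b q * ?L b q) * v f = (\<Sum>i\<in>D \<times> {True, False}. v (g i) * E i q f)"
      using main by blast
    show "\<forall>i\<in>D \<times> {True, False}. g i \<in> C \<and> E i \<in> V" using Ci by blast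
    show "?L b p * ?L b p \<noteq> 0" using b(2) p by (simp add: chart_lift_def)
    show "(\<lambda>q. ?L b q * ?L b q) \<in> C" by (rule sf_mult[OF Lb Lb])
  qed
qed

end

section \<open>The algebra of vector fields\<close>

text \<open>Unification produces eta-expanded functions, in which the simplifier would apply these rules
  and destroy the algebraic structure.\<close>

lemmas fun_apply = plus_fun_apply zero_fun_apply times_fun_apply one_fun_apply minus_apply uminus_apply
declare fun_apply [simp del]

text \<open>A field as an operator on functions. By \<open>field_eqI\<close> identities between
  fields may be checked on such operators, where they become identities in the ring of
  functions.\<close>

definition dd :: "('m \<Rightarrow> 'm tvec) \<Rightarrow> ('m \<Rightarrow> real) \<Rightarrow> 'm \<Rightarrow> real" where
  "dd X f = (\<lambda>p. X p f)"

definition smul :: "('m \<Rightarrow> real) \<Rightarrow> ('m \<Rightarrow> 'm tvec) \<Rightarrow> ('m \<Rightarrow> 'm tvec)" (infixr "\<star>" 75) where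
  "f \<star> X = (\<lambda>p h. f p * X p h)"

lemma dd_add_field: "dd (X + Y) f = dd X f + dd Y f"
  and dd_diff_field: "dd (X - Y) f = dd X f - dd Y f"
  and dd_minus_field: "dd (- X) f = - dd X f"
  and dd_zero_field [simp]: "dd 0 f = 0"
  and dd_smul: "dd (g \<star> X) f = g * dd X f"
  and dd_lie_bracket: "dd (lie_bracket X Y) f = dd X (dd Y f) - dd Y (dd X f)"
  by (auto simp: dd_def smul_def lie_bracket_def fun_eq_iff fun_apply)

lemma field_eqI: "(\<And>f. dd X f = dd Y f) \<Longrightarrow> X = Y"
  by (auto simp: dd_def fun_eq_iff)

lemma smul_one [simp]: "1 \<star> X = X"
  and smul_zero [simp]: "0 \<star> X = 0" "f \<star> (0 :: 'm \<Rightarrow> 'm tvec) = 0"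
  and smul_add: "f \<star> (X + Y) = f \<star> X + f \<star> Y"
  and smul_diff: "f \<star> (X - Y) = f \<star> X - f \<star> Y"
  and smul_minus: "f \<star> (- X) = - (f \<star> X)"
  and smul_minus_left: "(- f) \<star> X = - (f \<star> X)"
  by (auto simp: smul_def fun_eq_iff algebra_simps fun_apply)

context smooth_manifold begin

lemma C_intros: "(0::'m \<Rightarrow> real) \<in> C" "(1::'m \<Rightarrow> real) \<in> C"
  "f \<in> C \<Longrightarrow> g \<in> C \<Longrightarrow> f + g \<in> C" "f \<in> C \<Longrightarrow> g \<in> C \<Longrightarrow> f * g \<in> C"
  "f \<in> C \<Longrightarrow> - f \<in> C" "f \<in> C \<Longrightarrow> g \<in> C \<Longrightarrow> f - g \<in> C" "X \<in> V \<Longrightarrow> f \<in> C \<Longrightarrow> dd X f \<in> C"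
proof -
  show add: "f + g \<in> C" if "f \<in> C" "g \<in> C" for f g using sf_add[OF that] by (simp add: plus_fun_def)
  show "f * g \<in> C" if "f \<in> C" "g \<in> C" for f g using sf_mult[OF that] by (simp add: times_fun_def)
  show neg: "- f \<in> C" if "f \<in> C" for f using sf_mult[OF sf_const[of "-1"] that] by (simp add: fun_Compl_def)
  show "f - g \<in> C" if "f \<in> C" "g \<in> C" for f g using add[OF that(1) neg[OF that(2)]] by simp
  show "dd X f \<in> C" if "X \<in> V" "f \<in> C" using vf_smooth[OF that] by (simp add: dd_def)
qed (simp_all add: sf_const zero_fun_def one_fun_def)

lemma dd_zero: "X \<in> V \<Longrightarrow> dd X 0 = 0"
  using tv_zero[OF vf_tangent] by (simp add: dd_def fun_eq_iff fun_apply zero_fun_def)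

lemma dd_const: "X \<in> V \<Longrightarrow> dd X (\<lambda>q. c) = 0"
  using tv_const[OF vf_tangent] by (simp add: dd_def fun_eq_iff fun_apply)

lemma dd_add: "X \<in> V \<Longrightarrow> f \<in> C \<Longrightarrow> g \<in> C \<Longrightarrow> dd X (f + g) = dd X f + dd X g"
  using tv_add[OF vf_tangent] by (simp add: dd_def fun_eq_iff fun_apply plus_fun_def)

lemma dd_mult: "X \<in> V \<Longrightarrow> f \<in> C \<Longrightarrow> g \<in> C \<Longrightarrow> dd X (f * g) = dd X f * g + f * dd X g"
  using tv_mult[OF vf_tangent] by (simp add: dd_def fun_eq_iff fun_apply times_fun_def)

lemma dd_minus: "X \<in> V \<Longrightarrow> f \<in> C \<Longrightarrow> dd X (- f) = - dd X f"
  using tv_cmult[OF vf_tangent, of X f _ "-1"] by (simp add: dd_def fun_eq_iff fun_apply fun_Compl_def)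

lemma dd_diff: "X \<in> V \<Longrightarrow> f \<in> C \<Longrightarrow> g \<in> C \<Longrightarrow> dd X (f - g) = dd X f - dd X g"
  using dd_add[of X f "- g"] dd_minus[of X g] C_intros(5)[of g] by simp

lemma dd_nonsmooth: "X \<in> V \<Longrightarrow> f \<notin> C \<Longrightarrow> dd X f = 0"
  using tv_nonsmooth[OF vf_tangent] by (simp add: dd_def fun_eq_iff fun_apply)

lemma vf_eqI: "X \<in> V \<Longrightarrow> Y \<in> V \<Longrightarrow> (\<And>f. f \<in> C \<Longrightarrow> dd X f = dd Y f) \<Longrightarrow> X = Y"
  by (rule field_eqI) (metis dd_nonsmooth)

text \<open>Vanishing on constants stands in for homogeneity over the reals, which it yields through
  the Leibniz rule for a constant times \<open>f\<close>.\<close>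

lemma vfI:
  assumes "\<And>f. f \<notin> C \<Longrightarrow> dd X f = 0" "\<And>f. f \<in> C \<Longrightarrow> dd X f \<in> C"
    "\<And>f g. f \<in> C \<Longrightarrow> g \<in> C \<Longrightarrow> dd X (f + g) = dd X f + dd X g"
    "\<And>f g. f \<in> C \<Longrightarrow> g \<in> C \<Longrightarrow> dd X (f * g) = dd X f * g + f * dd X g"
    "\<And>c. dd X (\<lambda>q. c) = 0"
  shows "X \<in> V"
proof (rule vector_fieldsI)
  fix p
  show "X p \<in> T p"
  proof (rule tangent_spaceI)
    fix f g c assume f: "f \<in> C"
    show "X p (\<lambda>q. c * f q) = c * X p f"
      using assms(4)[OF sf_const f, of c] assms(5)[of c] by (simp add: dd_def fun_eq_iff fun_apply times_fun_def)
    assume g: "g \<in> C"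
    show "X p (\<lambda>q. f q + g q) = X p f + X p g"
      using assms(3)[OF f g] by (simp add: dd_def fun_eq_iff fun_apply plus_fun_def)
    show "X p (\<lambda>q. f q * g q) = X p f * g p + f p * X p g"
      using assms(4)[OF f g] by (simp add: dd_def fun_eq_iff fun_apply times_fun_def)
  qed (use assms(1) in \<open>simp add: dd_def fun_eq_iff fun_apply\<close>)
qed (use assms(2) in \<open>simp add: dd_def\<close>)

lemma V_zero: "0 \<in> V"
  by (rule vfI) (simp_all add: C_intros)

lemma V_add: "X \<in> V \<Longrightarrow> Y \<in> V \<Longrightarrow> X + Y \<in> V"
  by (rule vfI) (simp_all add: dd_add_field dd_nonsmooth dd_add dd_mult dd_const C_intros algebra_simps)

lemma V_smul: "f \<in> C \<Longrightarrow> X \<in> V \<Longrightarrow> f \<star> X \<in> V"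
  by (rule vfI) (simp_all add: dd_smul dd_nonsmooth dd_add dd_mult dd_const C_intros algebra_simps)

lemma V_minus: "X \<in> V \<Longrightarrow> - X \<in> V"
  using V_smul[of "- 1" X] by (simp add: C_intros smul_minus_left)

lemma V_diff: "X \<in> V \<Longrightarrow> Y \<in> V \<Longrightarrow> X - Y \<in> V"
  using V_add[of X "- Y"] V_minus[of Y] by simp

lemma V_lie_bracket: "X \<in> V \<Longrightarrow> Y \<in> V \<Longrightarrow> lie_bracket X Y \<in> V"
  by (rule vfI)
    (simp_all add: dd_lie_bracket dd_nonsmooth dd_zero dd_add dd_diff dd_mult dd_const C_intros algebra_simps)

lemmas V_intros = V_zero V_add V_smul V_minus V_diff V_lie_bracket

lemma lie_bracket_right:
  "X \<in> V \<Longrightarrow> Y \<in> V \<Longrightarrow> Z \<in> V \<Longrightarrow> f \<in> C \<Longrightarrow>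
    lie_bracket X (f \<star> Y + Z) = f \<star> lie_bracket X Y + dd X f \<star> Y + lie_bracket X Z"
  by (rule vf_eqI) (simp_all add: V_intros C_intros dd_lie_bracket dd_add_field dd_smul dd_add dd_mult algebra_simps)

lemma lie_bracket_antisym: "lie_bracket Y X = - lie_bracket X Y"
  by (rule field_eqI) (simp add: dd_lie_bracket dd_minus_field)

lemma lie_bracket_add_right: "X \<in> V \<Longrightarrow> Y \<in> V \<Longrightarrow> Z \<in> V \<Longrightarrow> lie_bracket X (Y + Z) = lie_bracket X Y + lie_bracket X Z"
  and lie_bracket_minus_right: "X \<in> V \<Longrightarrow> Y \<in> V \<Longrightarrow> lie_bracket X (- Y) = - lie_bracket X Y"
  and lie_bracket_diff_right: "X \<in> V \<Longrightarrow> Y \<in> V \<Longrightarrow> Z \<in> V \<Longrightarrow> lie_bracket X (Y - Z) = lie_bracket X Y - lie_bracket X Z"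
  and lie_bracket_zero_right: "X \<in> V \<Longrightarrow> lie_bracket X 0 = 0"
  by (rule vf_eqI; simp add: V_intros C_intros dd_lie_bracket dd_add_field dd_minus_field dd_diff_field
        dd_add dd_minus dd_diff dd_zero algebra_simps)+

lemma jacobi:
  "X \<in> V \<Longrightarrow> Y \<in> V \<Longrightarrow> Z \<in> V \<Longrightarrow>
    lie_bracket X (lie_bracket Y Z) = lie_bracket (lie_bracket X Y) Z + lie_bracket Y (lie_bracket X Z)"
  by (rule vf_eqI) (simp_all add: V_intros C_intros dd_lie_bracket dd_add_field dd_diff algebra_simps)

end

section \<open>Cochains on vector fields\<close>

type_synonym 'm cochain = "('m \<Rightarrow> 'm tvec) list \<Rightarrow> 'm \<Rightarrow> real"

definition contr :: "('m \<Rightarrow> 'm tvec) \<Rightarrow> 'm cochain \<Rightarrow> 'm cochain" where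
  "contr X F = (\<lambda>Xs. F (X # Xs))"

definition cmul :: "('m \<Rightarrow> real) \<Rightarrow> 'm cochain \<Rightarrow> 'm cochain" where
  "cmul f F = (\<lambda>Xs. f * F Xs)"

text \<open>The derivation of the tensor algebra determined by a vector field \<open>R\<close>, acting on functions, and
  a covariant differential operator \<open>B\<close> with symbol \<open>R\<close>, acting on vector fields. Lie derivatives are
  the case \<open>B = lie_bracket R\<close>, insertions of an endomorphism \<open>N\<close> the case \<open>R = 0\<close>, \<open>B = - N\<close>.\<close>

primrec cder :: "('m \<Rightarrow> 'm tvec) \<Rightarrow> (('m \<Rightarrow> 'm tvec) \<Rightarrow> ('m \<Rightarrow> 'm tvec)) \<Rightarrow> 'm cochain \<Rightarrow> 'm cochain" where
  "cder R B F [] = dd R (F [])"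
| "cder R B F (Y # Ys) = cder R B (contr Y F) Ys - F (B Y # Ys)"

text \<open>The Chevalley--Eilenberg differential of an anchor \<open>\<rho>\<close> and a bracket \<open>br\<close>, defined through
  Cartan's formula \<open>i\<^sub>X d = L\<^sub>X - d i\<^sub>X\<close>.\<close>

primrec dif :: "(('m \<Rightarrow> 'm tvec) \<Rightarrow> ('m \<Rightarrow> 'm tvec)) \<Rightarrow> (('m \<Rightarrow> 'm tvec) \<Rightarrow> ('m \<Rightarrow> 'm tvec) \<Rightarrow> ('m \<Rightarrow> 'm tvec))
    \<Rightarrow> 'm cochain \<Rightarrow> 'm cochain" where
  "dif \<rho> br F [] = 0"
| "dif \<rho> br F (X # Xs) = cder (\<rho> X) (br X) F Xs - dif \<rho> br (contr X F) Xs"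

lemma cochain_apply [simp]:
  "(F + G :: 'm cochain) Xs = F Xs + G Xs" "(F - G :: 'm cochain) Xs = F Xs - G Xs"
  "(- F :: 'm cochain) Xs = - F Xs" "(0 :: 'm cochain) Xs = 0"
  by (simp_all add: fun_apply)

lemma contr_apply [simp]: "contr X F Xs = F (X # Xs)"
  by (simp add: contr_def)

lemma cmul_apply [simp]: "cmul f F Xs = f * F Xs"
  by (simp add: cmul_def)

lemma contr_add [simp]: "contr X (F + G) = contr X F + contr X G"
  and contr_diff [simp]: "contr X (F - G) = contr X F - contr X G"
  and contr_minus [simp]: "contr X (- F) = - contr X F"
  and contr_zero [simp]: "contr X 0 = 0"
  and contr_cmul [simp]: "contr X (cmul f F) = cmul f (contr X F)"
  by (auto simp: fun_eq_iff fun_apply algebra_simps)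

text \<open>The defining recursion read as a commutation rule between operators; in this form it
  enters the inductions on the list of arguments.\<close>

lemma contr_cder: "contr Y (cder R B F) = cder R B (contr Y F) - contr (B Y) F"
  by (auto simp: fun_eq_iff fun_apply algebra_simps)

lemma contr_dif: "contr X (dif \<rho> br F) = cder (\<rho> X) (br X) F - dif \<rho> br (contr X F)"
  by (auto simp: fun_eq_iff fun_apply algebra_simps)

context smooth_manifold begin

section \<open>Tensorial cochains and the derivations acting on them\<close>

definition smoothc :: "'m cochain \<Rightarrow> bool" where
  "smoothc F \<longleftrightarrow> (\<forall>Xs. set Xs \<subseteq> V \<longrightarrow> F Xs \<in> C)"

text \<open>Alternation is asked for adjacent equal entries, the form in which an induction on the
  list delivers it; \<open>tensor_swap\<close> and \<open>tensor_repeat\<close> recover the rest.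
  One clause for \<open>f \<star> X + Y\<close> covers both additivity and homogeneity.\<close>

definition tensor :: "'m cochain \<Rightarrow> bool" where
  "tensor F \<longleftrightarrow> smoothc F \<and>
     (\<forall>us ws f X Y. set us \<subseteq> V \<longrightarrow> set ws \<subseteq> V \<longrightarrow> f \<in> C \<longrightarrow> X \<in> V \<longrightarrow> Y \<in> V \<longrightarrow>
        F (us @ (f \<star> X + Y) # ws) = f * F (us @ X # ws) + F (us @ Y # ws)) \<and>
     (\<forall>us ws X. set us \<subseteq> V \<longrightarrow> set ws \<subseteq> V \<longrightarrow> X \<in> V \<longrightarrow> F (us @ X # X # ws) = 0)"

lemma smoothcD: "smoothc F \<Longrightarrow> set Xs \<subseteq> V \<Longrightarrow> F Xs \<in> C"
  by (simp add: smoothc_def)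

lemma smoothcI: "(\<And>Xs. set Xs \<subseteq> V \<Longrightarrow> F Xs \<in> C) \<Longrightarrow> smoothc F"
  by (simp add: smoothc_def)

lemma smoothc_contr: "smoothc F \<Longrightarrow> X \<in> V \<Longrightarrow> smoothc (contr X F)"
  and smoothc_add: "smoothc F \<Longrightarrow> smoothc G \<Longrightarrow> smoothc (F + G)"
  and smoothc_diff: "smoothc F \<Longrightarrow> smoothc G \<Longrightarrow> smoothc (F - G)"
  and smoothc_minus: "smoothc F \<Longrightarrow> smoothc (- F)"
  and smoothc_cmul: "f \<in> C \<Longrightarrow> smoothc F \<Longrightarrow> smoothc (cmul f F)"
  by (auto simp: smoothc_def C_intros cochain_apply)

lemma tensor_smoothc: "tensor F \<Longrightarrow> smoothc F"
  and tensor_lin: "tensor F \<Longrightarrow> set us \<subseteq> V \<Longrightarrow> set ws \<subseteq> V \<Longrightarrow> f \<in> C \<Longrightarrow> X \<in> V \<Longrightarrow> Y \<in> V \<Longrightarrow>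
        F (us @ (f \<star> X + Y) # ws) = f * F (us @ X # ws) + F (us @ Y # ws)"
  and tensor_alt: "tensor F \<Longrightarrow> set us \<subseteq> V \<Longrightarrow> set ws \<subseteq> V \<Longrightarrow> X \<in> V \<Longrightarrow> F (us @ X # X # ws) = 0"
  unfolding tensor_def by blast+

lemma tensor_add: "tensor F \<Longrightarrow> set us \<subseteq> V \<Longrightarrow> set ws \<subseteq> V \<Longrightarrow> X \<in> V \<Longrightarrow> Y \<in> V \<Longrightarrow>
    F (us @ (X + Y) # ws) = F (us @ X # ws) + F (us @ Y # ws)"
  using tensor_lin[of F us ws 1 X Y] by (simp add: C_intros)

lemma tensor_zero: "tensor F \<Longrightarrow> set us \<subseteq> V \<Longrightarrow> set ws \<subseteq> V \<Longrightarrow> F (us @ 0 # ws) = 0"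
  using tensor_add[of F us ws 0 0] by (simp add: V_zero)

lemma tensor_smul: "tensor F \<Longrightarrow> set us \<subseteq> V \<Longrightarrow> set ws \<subseteq> V \<Longrightarrow> f \<in> C \<Longrightarrow> X \<in> V \<Longrightarrow>
    F (us @ (f \<star> X) # ws) = f * F (us @ X # ws)"
  using tensor_lin[of F us ws f X 0] tensor_zero[of F us ws] by (simp add: V_zero)

lemma tensor_minus: "tensor F \<Longrightarrow> set us \<subseteq> V \<Longrightarrow> set ws \<subseteq> V \<Longrightarrow> X \<in> V \<Longrightarrow>
    F (us @ (- X) # ws) = - F (us @ X # ws)"
  using tensor_smul[of F us ws "- 1" X] by (simp add: C_intros smul_minus_left)

lemma tensor_diff: "tensor F \<Longrightarrow> set us \<subseteq> V \<Longrightarrow> set ws \<subseteq> V \<Longrightarrow> X \<in> V \<Longrightarrow> Y \<in> V \<Longrightarrow>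
    F (us @ (X - Y) # ws) = F (us @ X # ws) - F (us @ Y # ws)"
  using tensor_add[of F us ws X "- Y"] tensor_minus[of F us ws Y] V_minus[of Y] by simp

lemma tensor_swap: "tensor F \<Longrightarrow> set us \<subseteq> V \<Longrightarrow> set ws \<subseteq> V \<Longrightarrow> X \<in> V \<Longrightarrow> Y \<in> V \<Longrightarrow>
    F (us @ X # Y # ws) = - F (us @ Y # X # ws)"
proof -
  assume a: "tensor F" "set us \<subseteq> V" "set ws \<subseteq> V" "X \<in> V" "Y \<in> V"
  have "F (us @ (X + Y) # (X + Y) # ws) = F (us @ X # Y # ws) + F (us @ Y # X # ws)"
    using a tensor_add[of F us "(X + Y) # ws" X Y] tensor_add[of F "us @ [X]" ws X Y]
      tensor_add[of F "us @ [Y]" ws X Y] tensor_alt[of F us ws X] tensor_alt[of F us ws Y]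
    by (simp add: V_add)
  moreover have "F (us @ (X + Y) # (X + Y) # ws) = 0"
    using a by (intro tensor_alt) (simp_all add: V_add)
  ultimately show ?thesis by (simp add: eq_neg_iff_add_eq_0)
qed

lemma tensorI:
  assumes "smoothc F"
    and "\<And>us ws f X Y. set us \<subseteq> V \<Longrightarrow> set ws \<subseteq> V \<Longrightarrow> f \<in> C \<Longrightarrow> X \<in> V \<Longrightarrow> Y \<in> V \<Longrightarrow>
        F (us @ (f \<star> X + Y) # ws) = f * F (us @ X # ws) + F (us @ Y # ws)"
    and "\<And>us ws X. set us \<subseteq> V \<Longrightarrow> set ws \<subseteq> V \<Longrightarrow> X \<in> V \<Longrightarrow> F (us @ X # X # ws) = 0"
  shows "tensor F"
  using assms by (auto simp: tensor_def)

lemma tensor_contr: "tensor F \<Longrightarrow> U \<in> V \<Longrightarrow> tensor (contr U F)"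
proof (rule tensorI)
  assume F: "tensor F" "U \<in> V"
  show "smoothc (contr U F)" using F by (simp add: smoothc_contr tensor_smoothc)
  fix us ws f X Y assume "set us \<subseteq> V" "set ws \<subseteq> V" "X \<in> V"
  then show "contr U F (us @ X # X # ws) = 0" using tensor_alt[of F "U # us" ws X] F by simp
next
  fix us ws f X Y assume F: "tensor F" "U \<in> V" and "set us \<subseteq> V" "set ws \<subseteq> V" "f \<in> C" "X \<in> V" "Y \<in> V"
  then show "contr U F (us @ (f \<star> X + Y) # ws) = f * contr U F (us @ X # ws) + contr U F (us @ Y # ws)"
    using tensor_lin[of F "U # us" ws f X Y] by simp
qed

lemma tensor_cong: "tensor F \<Longrightarrow> (\<And>Xs. set Xs \<subseteq> V \<Longrightarrow> G Xs = F Xs) \<Longrightarrow> tensor G"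
  by (rule tensorI)
    (auto simp: smoothcI smoothcD[OF tensor_smoothc] tensor_lin tensor_alt V_intros)

lemma cder_cong:
  assumes "\<And>Xs. set Xs \<subseteq> V \<Longrightarrow> F Xs = G Xs" "\<And>X. X \<in> V \<Longrightarrow> B X \<in> V" "set Xs \<subseteq> V"
  shows "cder R B F Xs = cder R B G Xs"
  using assms(1,3)
proof (induction Xs arbitrary: F G)
  case (Cons Y Ys)
  then have "cder R B (contr Y F) Ys = cder R B (contr Y G) Ys"
    by (intro Cons.IH) auto
  moreover have "F (B Y # Ys) = G (B Y # Ys)" using Cons.prems assms(2) by simp
  ultimately show ?case by simp
qed simp

lemma cder_smoothc:
  assumes "smoothc F" "R \<in> V" "\<And>X. X \<in> V \<Longrightarrow> B X \<in> V"
  shows "smoothc (cder R B F)"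
proof -
  have "set Xs \<subseteq> V \<Longrightarrow> smoothc F \<Longrightarrow> cder R B F Xs \<in> C" for Xs F
    by (induction Xs arbitrary: F) (auto simp: assms smoothcD C_intros smoothc_contr)
  then show ?thesis using assms(1) by (auto intro: smoothcI)
qed

lemma cder_add:
  assumes "R \<in> V" "\<And>X. X \<in> V \<Longrightarrow> B X \<in> V" "set Xs \<subseteq> V" "smoothc F" "smoothc G"
  shows "cder R B (F + G) Xs = cder R B F Xs + cder R B G Xs"
  using assms(3-) by (induction Xs arbitrary: F G) (auto simp: dd_add assms smoothcD smoothc_contr)

lemma cder_cmul:
  assumes "R \<in> V" "\<And>X. X \<in> V \<Longrightarrow> B X \<in> V" "set Xs \<subseteq> V" "f \<in> C" "smoothc F"
  shows "cder R B (cmul f F) Xs = dd R f * F Xs + f * cder R B F Xs"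
  using assms(3-) by (induction Xs arbitrary: F) (auto simp: dd_mult assms smoothcD smoothc_contr algebra_simps)

lemma cder_zero: "R \<in> V \<Longrightarrow> cder R B 0 Xs = 0"
  by (induction Xs) (simp_all add: dd_zero)

lemma cder_minus:
  assumes "R \<in> V" "\<And>X. X \<in> V \<Longrightarrow> B X \<in> V" "set Xs \<subseteq> V" "smoothc F"
  shows "cder R B (- F) Xs = - cder R B F Xs"
  using assms(3-) by (induction Xs arbitrary: F) (auto simp: dd_minus assms smoothcD smoothc_contr)

lemma cder_diff:
  assumes "R \<in> V" "\<And>X. X \<in> V \<Longrightarrow> B X \<in> V" "set Xs \<subseteq> V" "smoothc F" "smoothc G"
  shows "cder R B (F - G) Xs = cder R B F Xs - cder R B G Xs"
  using cder_add[OF assms(1-4) smoothc_minus[OF assms(5)]] cder_minus[OF assms(1-3,5)] by simp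

text \<open>For a tensorial cochain the derivation depends linearly, over smooth functions, on the
  pair of symbol and action on fields. Lie derivatives along \<open>f \<star> X + Y\<close> and
  along a deformed bracket are split by this rule.\<close>

lemma cder_param:
  assumes "tensor F" "f \<in> C" "\<And>X. X \<in> V \<Longrightarrow> B1 X \<in> V" "\<And>X. X \<in> V \<Longrightarrow> B2 X \<in> V" "set Xs \<subseteq> V"
    and "\<And>X. X \<in> V \<Longrightarrow> B X = f \<star> B1 X + B2 X"
  shows "cder (f \<star> R1 + R2) B F Xs = f * cder R1 B1 F Xs + cder R2 B2 F Xs"
  using assms(1,5)
proof (induction Xs arbitrary: F)
  case Nil
  then show ?case by (simp add: dd_add_field dd_smul)
next
  case (Cons Y Ys)
  then have "cder (f \<star> R1 + R2) B (contr Y F) Ys = f * cder R1 B1 (contr Y F) Ys + cder R2 B2 (contr Y F) Ys"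
    by (intro Cons.IH tensor_contr) auto
  then show ?case using Cons.prems tensor_lin[of F "[]" Ys f "B1 Y" "B2 Y"]
    by (simp add: assms algebra_simps)
qed

text \<open>Derivations of the tensor algebra form a Lie algebra: the commutator has symbol
  \<open>lie_bracket R S\<close> and acts on fields by the commutator \<open>K\<close>.\<close>

lemma cder_commute:
  assumes "tensor F" "R \<in> V" "S \<in> V" "set Xs \<subseteq> V"
    and B: "\<And>X. X \<in> V \<Longrightarrow> B X \<in> V" and E: "\<And>X. X \<in> V \<Longrightarrow> E X \<in> V"
    and K: "\<And>X. X \<in> V \<Longrightarrow> K X = B (E X) - E (B X)"
  shows "cder R B (cder S E F) Xs - cder S E (cder R B F) Xs = cder (lie_bracket R S) K F Xs"
  using assms(1,4)
proof (induction Xs arbitrary: F)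
  case Nil
  then show ?case by (simp add: dd_lie_bracket)
next
  case (Cons Y Ys)
  have Y: "Y \<in> V" "set Ys \<subseteq> V" using Cons.prems by auto
  have sF: "smoothc F" by (rule tensor_smoothc[OF Cons.prems(1)])
  have s: "smoothc (contr Z F)" if "Z \<in> V" for Z using sF that by (rule smoothc_contr)
  have 1: "cder R B (contr Y (cder S E F)) Ys = cder R B (cder S E (contr Y F)) Ys - cder R B (contr (E Y) F) Ys"
    unfolding contr_cder by (rule cder_diff) (use assms(2,3) Y B E s cder_smoothc in auto)
  have 2: "cder S E (contr Y (cder R B F)) Ys = cder S E (cder R B (contr Y F)) Ys - cder S E (contr (B Y) F) Ys"
    unfolding contr_cder by (rule cder_diff) (use assms(2,3) Y B E s cder_smoothc in auto)
  have 3: "F (K Y # Ys) = F (B (E Y) # Ys) - F (E (B Y) # Ys)"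
    using tensor_diff[of F "[]" Ys "B (E Y)" "E (B Y)"] Cons.prems B E by (simp add: K)
  have IH: "cder R B (cder S E (contr Y F)) Ys - cder S E (cder R B (contr Y F)) Ys = cder (lie_bracket R S) K (contr Y F) Ys"
    by (intro Cons.IH tensor_contr Cons.prems(1) Y)
  show ?case using IH by (simp add: 1 2 3 algebra_simps)
qed

text \<open>Differentiating the coefficient in \<open>f * F (X # ws)\<close> produces a term with
  \<open>dd R f\<close>; the condition \<open>lin\<close> makes
  \<open>F (B (f \<star> X) # ws)\<close> contain the same term, and the two cancel.\<close>

lemma tensor_cder:
  assumes F: "tensor F" and R: "R \<in> V" and B: "\<And>X. X \<in> V \<Longrightarrow> B X \<in> V"
    and lin: "\<And>f X Y. f \<in> C \<Longrightarrow> X \<in> V \<Longrightarrow> Y \<in> V \<Longrightarrow> B (f \<star> X + Y) = f \<star> B X + dd R f \<star> X + B Y"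
  shows "tensor (cder R B F)"
proof (rule tensorI)
  show "smoothc (cder R B F)" by (rule cder_smoothc[OF tensor_smoothc[OF F] R B])
  fix us ws X assume us: "set us \<subseteq> V" and ws: "set ws \<subseteq> V" and X: "X \<in> V"
  show "cder R B F (us @ X # X # ws) = 0"
    using us F
  proof (induction us arbitrary: F)
    case Nil
    have "contr X (contr X F) Zs = 0" if "set Zs \<subseteq> V" for Zs
      using tensor_alt[OF Nil(2), of "[]" Zs X] that X by simp
    then have "cder R B (contr X (contr X F)) ws = cder R B 0 ws"
      by (intro cder_cong B ws) auto
    also have "\<dots> = 0" by (rule cder_zero[OF R])
    \<comment> \<open>What remains is \<open>F (X # B X # ws)\<close> and
      \<open>F (B X # X # ws)\<close>, which cancel by antisymmetry.\<close>
    finally show ?case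
      using tensor_swap[OF Nil(2), of "[]" ws "B X" X] ws X B by simp
  next
    case (Cons U us)
    then have U: "U \<in> V" "set us \<subseteq> V" by auto
    have "F (B U # us @ X # X # ws) = 0"
      using tensor_alt[OF Cons.prems(2), of "B U # us" ws X] Cons.prems ws X B by simp
    moreover have "cder R B (contr U F) (us @ X # X # ws) = 0"
      by (rule Cons.IH[OF U(2) tensor_contr[OF Cons.prems(2) U(1)]])
    ultimately show ?case by simp
  qed
next
  fix us ws f X Y assume us: "set us \<subseteq> V" and ws: "set ws \<subseteq> V" and f: "f \<in> C" and XY: "X \<in> V" "Y \<in> V"
  show "cder R B F (us @ (f \<star> X + Y) # ws) = f * cder R B F (us @ X # ws) + cder R B F (us @ Y # ws)"
    using us F
  proof (induction us arbitrary: F)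
    case Nil
    note F = Nil(2) and sF = tensor_smoothc[OF Nil(2)]
    have "cder R B (contr (f \<star> X + Y) F) ws = cder R B (cmul f (contr X F) + contr Y F) ws"
      using tensor_lin[OF F, of "[]" _ f X Y] f XY by (intro cder_cong B ws) auto
    also have "\<dots> = dd R f * F (X # ws) + f * cder R B (contr X F) ws + cder R B (contr Y F) ws"
      using cder_add[OF R B ws smoothc_cmul[OF f smoothc_contr[OF sF XY(1)]] smoothc_contr[OF sF XY(2)]]
        cder_cmul[OF R B ws f smoothc_contr[OF sF XY(1)]] by simp
    finally have 1: "cder R B (contr (f \<star> X + Y) F) ws = dd R f * F (X # ws) + f * cder R B (contr X F) ws + cder R B (contr Y F) ws" .
    have "F ((f \<star> B X + (dd R f \<star> X + B Y)) # ws) = f * F (B X # ws) + (dd R f * F (X # ws) + F (B Y # ws))"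
      using tensor_lin[OF F, of "[]" ws f "B X" "dd R f \<star> X + B Y"] tensor_lin[OF F, of "[]" ws "dd R f" X "B Y"]
        f XY B ws R by (simp add: V_intros C_intros)
    then show ?case using 1 lin[OF f XY] by (simp add: add.assoc algebra_simps)
  next
    case (Cons U us)
    then have U: "U \<in> V" "set us \<subseteq> V" by auto
    have "F (B U # us @ (f \<star> X + Y) # ws) = f * F (B U # us @ X # ws) + F (B U # us @ Y # ws)"
      using tensor_lin[OF Cons.prems(2), of "B U # us" ws f X Y] Cons.prems ws f XY B by simp
    moreover have "cder R B (contr U F) (us @ (f \<star> X + Y) # ws)
        = f * cder R B (contr U F) (us @ X # ws) + cder R B (contr U F) (us @ Y # ws)"
      by (rule Cons.IH[OF U(2) tensor_contr[OF Cons.prems(2) U(1)]])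
    ultimately show ?case by (simp add: algebra_simps)
  qed
qed

end

section \<open>Lie algebroid structures on the tangent bundle\<close>

text \<open>The wedge product characterised by contraction being an antiderivation. This recursion
  matches those of \<open>cder\<close> and \<open>dif\<close>, and \<open>ev_wedge\<close>
  identifies it with the sum over shuffles.\<close>

primrec wdg :: "'m cochain \<Rightarrow> 'm cochain \<Rightarrow> 'm cochain" where
  "wdg F G [] = F [] * G []"
| "wdg F G (X # Xs) = wdg (contr X F) G Xs + wdg (\<lambda>Zs. (-1) ^ length Zs * F Zs) (contr X G) Xs"

text \<open>The grading involution. Cochains mix all degrees, so the sign is read off the length of
  the list.\<close>

definition bar :: "'m cochain \<Rightarrow> 'm cochain" where
  "bar F = (\<lambda>Xs. (-1) ^ length Xs * F Xs)"

lemma bar_apply: "bar F Xs = (-1) ^ length Xs * F Xs"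
  by (simp add: bar_def)

lemma wdg_Cons: "wdg F G (X # Xs) = wdg (contr X F) G Xs + wdg (bar F) (contr X G) Xs"
  by (simp add: bar_def)

lemmas [simp del] = wdg.simps(2)

lemma contr_bar: "contr X (bar F) = - bar (contr X F)"
  and bar_diff: "bar (F - G) = bar F - bar G"
  and bar_minus: "bar (- F) = - bar F"
  and bar_bar: "bar (bar F) = F"
  by (rule ext; simp add: bar_apply algebra_simps flip: power_mult_distrib)+

lemma wdg_diff_left: "wdg (F - F') G Xs = wdg F G Xs - wdg F' G Xs"
proof (induction Xs arbitrary: F F' G)
  case (Cons X Xs)
  have "wdg (contr X F - contr X F') G Xs = wdg (contr X F) G Xs - wdg (contr X F') G Xs"
    "wdg (bar F - bar F') (contr X G) Xs = wdg (bar F) (contr X G) Xs - wdg (bar F') (contr X G) Xs"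
    by (rule Cons.IH)+
  then show "wdg (F - F') G (X # Xs) = wdg F G (X # Xs) - wdg F' G (X # Xs)"
    by (simp add: wdg_Cons bar_diff)
qed (simp add: algebra_simps)

lemma wdg_diff_right: "wdg F (G - G') Xs = wdg F G Xs - wdg F G' Xs"
proof (induction Xs arbitrary: F G G')
  case (Cons X Xs)
  have "wdg (contr X F) (G - G') Xs = wdg (contr X F) G Xs - wdg (contr X F) G' Xs"
    "wdg (bar F) (contr X G - contr X G') Xs = wdg (bar F) (contr X G) Xs - wdg (bar F) (contr X G') Xs"
    by (rule Cons.IH)+
  then show "wdg F (G - G') (X # Xs) = wdg F G (X # Xs) - wdg F G' (X # Xs)"
    by (simp add: wdg_Cons)
qed (simp add: algebra_simps)

lemma wdg_zero_left: "wdg 0 G Xs = 0"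
  using wdg_diff_left[of 0 0 G Xs] by simp

lemma wdg_minus_left: "wdg (- F) G Xs = - wdg F G Xs"
  using wdg_diff_left[of 0 F G Xs] by (simp add: wdg_zero_left)

context smooth_manifold begin

lemma bar_smoothc: "smoothc F \<Longrightarrow> smoothc (bar F)"
proof (rule smoothcI)
  fix Xs :: "('m \<Rightarrow> 'm tvec) list" assume "smoothc F" "set Xs \<subseteq> V"
  moreover have "(-1) ^ n * f \<in> C" if "f \<in> C" for n f
    using that by (induction n) (simp_all add: C_intros)
  ultimately show "bar F Xs \<in> C" by (simp add: bar_apply smoothcD)
qed

lemma wdg_cong:
  assumes "\<And>Xs. set Xs \<subseteq> V \<Longrightarrow> F Xs = F' Xs" "\<And>Xs. set Xs \<subseteq> V \<Longrightarrow> G Xs = G' Xs" "set Xs \<subseteq> V"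
  shows "wdg F G Xs = wdg F' G' Xs"
  using assms
proof (induction Xs arbitrary: F F' G G')
  case (Cons Y Ys)
  have "wdg (contr Y F) G Ys = wdg (contr Y F') G' Ys"
    by (rule Cons.IH) (use Cons.prems in auto)
  moreover have "wdg (bar F) (contr Y G) Ys = wdg (bar F') (contr Y G') Ys"
    by (rule Cons.IH) (use Cons.prems in \<open>auto simp: bar_apply\<close>)
  ultimately show ?case by (simp add: wdg_Cons)
qed simp

lemma wdg_smoothc: "smoothc F \<Longrightarrow> smoothc G \<Longrightarrow> smoothc (wdg F G)"
proof (rule smoothcI)
  fix Xs :: "('m \<Rightarrow> 'm tvec) list" assume "smoothc F" "smoothc G" "set Xs \<subseteq> V"
  then show "wdg F G Xs \<in> C"
  proof (induction Xs arbitrary: F G)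
    case Nil
    then show ?case by (simp add: C_intros smoothcD)
  next
    case (Cons Y Ys)
    then have "wdg (contr Y F) G Ys \<in> C" "wdg (bar F) (contr Y G) Ys \<in> C"
      by (auto intro!: Cons.IH smoothc_contr bar_smoothc)
    then show ?case by (simp add: wdg_Cons C_intros)
  qed
qed

lemma cder_bar:
  assumes "R \<in> V" "\<And>X. X \<in> V \<Longrightarrow> B X \<in> V" "smoothc F" "set Xs \<subseteq> V"
  shows "cder R B (bar F) Xs = bar (cder R B F) Xs"
  using assms(3,4)
proof (induction Xs arbitrary: F)
  case Nil
  then show ?case by (simp add: bar_apply)
next
  case (Cons Y Ys)
  then have Y: "Y \<in> V" "set Ys \<subseteq> V" by auto
  have s: "smoothc (contr Y F)" using Cons.prems(1) Y(1) by (rule smoothc_contr)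
  have 1: "cder R B (- bar (contr Y F)) Ys = - cder R B (bar (contr Y F)) Ys"
    by (rule cder_minus[OF assms(1,2) Y(2) bar_smoothc[OF s]])
  have 2: "cder R B (bar (contr Y F)) Ys = bar (cder R B (contr Y F)) Ys"
    by (rule Cons.IH[OF s Y(2)])
  show "cder R B (bar F) (Y # Ys) = bar (cder R B F) (Y # Ys)"
    by (simp only: cder.simps contr_bar 1 2) (simp add: bar_apply algebra_simps)
qed

lemma cder_wdg:
  assumes "R \<in> V" "\<And>X. X \<in> V \<Longrightarrow> B X \<in> V" "smoothc F" "smoothc G" "set Xs \<subseteq> V"
  shows "cder R B (wdg F G) Xs = wdg (cder R B F) G Xs + wdg F (cder R B G) Xs"
  using assms(3-)
proof (induction Xs arbitrary: F G)
  case Nil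
  then show ?case using assms(1) by (simp add: dd_mult smoothcD algebra_simps)
next
  case (Cons Y Ys)
  then have Y: "Y \<in> V" "set Ys \<subseteq> V" by auto
  note sF = Cons.prems(1) and sG = Cons.prems(2)
  have s: "smoothc (contr Y F)" "smoothc (contr Y G)" using sF sG Y(1) by (auto intro: smoothc_contr)
  have c: "contr Z (wdg F G) = wdg (contr Z F) G + wdg (bar F) (contr Z G)" for Z
    by (rule ext) (simp add: wdg_Cons)
  have 1: "cder R B (contr Y (wdg F G)) Ys = wdg (cder R B (contr Y F)) G Ys + wdg (contr Y F) (cder R B G) Ys
      + (wdg (cder R B (bar F)) (contr Y G) Ys + wdg (bar F) (cder R B (contr Y G)) Ys)"
    unfolding c
    by (simp only: cder_add[OF assms(1,2) Y(2) wdg_smoothc[OF s(1) sG] wdg_smoothc[OF bar_smoothc[OF sF] s(2)]]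
        Cons.IH[OF s(1) sG Y(2)] Cons.IH[OF bar_smoothc[OF sF] s(2) Y(2)])
  have 2: "wdg (cder R B (bar F)) (contr Y G) Ys = wdg (bar (cder R B F)) (contr Y G) Ys"
    by (rule wdg_cong) (use cder_bar[OF assms(1,2) sF] Y in auto)
  show "cder R B (wdg F G) (Y # Ys) = wdg (cder R B F) G (Y # Ys) + wdg F (cder R B G) (Y # Ys)"
    by (simp add: 1 2 wdg_Cons contr_cder wdg_diff_left wdg_diff_right)
qed

end

text \<open>A Lie algebroid structure on the bundle TM in terms of global sections. The rule for the
  first slot follows from \<open>br_lin\<close> by antisymmetry; when the anchor is zero, the
  bracket is tensorial.\<close>

locale algebroid = smooth_manifold A
  for A :: "('m::{t2_space,second_countable_topology}, 'e::real_inner) atlas" +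
  fixes \<rho> :: "('m \<Rightarrow> 'm tvec) \<Rightarrow> ('m \<Rightarrow> 'm tvec)"
    and br :: "('m \<Rightarrow> 'm tvec) \<Rightarrow> ('m \<Rightarrow> 'm tvec) \<Rightarrow> ('m \<Rightarrow> 'm tvec)"
  assumes anchor_V: "X \<in> V \<Longrightarrow> \<rho> X \<in> V"
    and br_V: "X \<in> V \<Longrightarrow> Y \<in> V \<Longrightarrow> br X Y \<in> V"
    and anchor_lin: "f \<in> C \<Longrightarrow> X \<in> V \<Longrightarrow> Y \<in> V \<Longrightarrow> \<rho> (f \<star> X + Y) = f \<star> \<rho> X + \<rho> Y"
    and br_lin: "X \<in> V \<Longrightarrow> f \<in> C \<Longrightarrow> Y \<in> V \<Longrightarrow> Z \<in> V \<Longrightarrow>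
      br X (f \<star> Y + Z) = f \<star> br X Y + dd (\<rho> X) f \<star> Y + br X Z"
    and br_antisym: "X \<in> V \<Longrightarrow> Y \<in> V \<Longrightarrow> br Y X = - br X Y"
    and anchor_br: "X \<in> V \<Longrightarrow> Y \<in> V \<Longrightarrow> \<rho> (br X Y) = lie_bracket (\<rho> X) (\<rho> Y)"
    and br_jacobi: "X \<in> V \<Longrightarrow> Y \<in> V \<Longrightarrow> Z \<in> V \<Longrightarrow> br X (br Y Z) = br (br X Y) Z + br Y (br X Z)"
begin

abbreviation "L X \<equiv> cder (\<rho> X) (br X)"
abbreviation "d \<equiv> dif \<rho> br"

lemma br_self: "X \<in> V \<Longrightarrow> br X X = 0"
proof (intro ext)
  fix p h assume "X \<in> V"
  from br_antisym[OF this this, THEN fun_cong, THEN fun_cong, of p h]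
  show "br X X p h = 0 p h" by (simp only: fun_apply)
qed

lemma L_smoothc: "smoothc F \<Longrightarrow> X \<in> V \<Longrightarrow> smoothc (L X F)"
  by (intro cder_smoothc anchor_V br_V)

lemma L_tensor: "tensor F \<Longrightarrow> X \<in> V \<Longrightarrow> tensor (L X F)"
  by (intro tensor_cder anchor_V br_V br_lin)

lemma dif_cong:
  assumes "\<And>Xs. set Xs \<subseteq> V \<Longrightarrow> F Xs = G Xs" "set Xs \<subseteq> V"
  shows "d F Xs = d G Xs"
  using assms
proof (induction Xs arbitrary: F G)
  case (Cons Y Ys)
  then have "d (contr Y F) Ys = d (contr Y G) Ys"
    by (intro Cons.IH) auto
  moreover have "L Y F Ys = L Y G Ys" by (rule cder_cong) (use Cons.prems br_V in auto)
  ultimately show "d F (Y # Ys) = d G (Y # Ys)" by simp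
qed simp

lemma dif_smoothc: "smoothc F \<Longrightarrow> smoothc (d F)"
proof (rule smoothcI)
  fix Xs :: "('m \<Rightarrow> 'm tvec) list" assume "smoothc F" "set Xs \<subseteq> V"
  then show "d F Xs \<in> C"
  proof (induction Xs arbitrary: F)
    case (Cons Y Ys)
    then have "L Y F Ys \<in> C" "d (contr Y F) Ys \<in> C"
      using smoothcD[OF L_smoothc[OF Cons.prems(1)]] by (auto intro!: Cons.IH smoothc_contr)
    then show ?case by (simp add: C_intros)
  qed (simp add: C_intros)
qed

lemma dif_add:
  assumes "smoothc F" "smoothc G" "set Xs \<subseteq> V"
  shows "d (F + G) Xs = d F Xs + d G Xs"
  using assms
proof (induction Xs arbitrary: F G)
  case (Cons Y Ys)
  then have Y: "Y \<in> V" "set Ys \<subseteq> V" by auto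
  have "d (contr Y F + contr Y G) Ys = d (contr Y F) Ys + d (contr Y G) Ys"
    by (intro Cons.IH smoothc_contr Cons.prems(1,2) Y)
  moreover have "L Y (F + G) Ys = L Y F Ys + L Y G Ys"
    by (intro cder_add anchor_V br_V Y Cons.prems(1,2))
  ultimately show "d (F + G) (Y # Ys) = d F (Y # Ys) + d G (Y # Ys)" by simp
qed simp

lemma dif_minus:
  assumes "smoothc F" "set Xs \<subseteq> V"
  shows "d (- F) Xs = - d F Xs"
  using assms
proof (induction Xs arbitrary: F)
  case (Cons Y Ys)
  then have Y: "Y \<in> V" "set Ys \<subseteq> V" by auto
  have "d (- contr Y F) Ys = - d (contr Y F) Ys"
    by (intro Cons.IH smoothc_contr Cons.prems(1) Y)
  moreover have "L Y (- F) Ys = - L Y F Ys"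
    by (intro cder_minus anchor_V br_V Y Cons.prems(1))
  ultimately show "d (- F) (Y # Ys) = - d F (Y # Ys)" by simp
qed simp

lemma dif_diff:
  assumes "smoothc F" "smoothc G" "set Xs \<subseteq> V"
  shows "d (F - G) Xs = d F Xs - d G Xs"
  using dif_add[OF assms(1) smoothc_minus[OF assms(2)] assms(3)] dif_minus[OF assms(2,3)] by simp

lemma dif_cmul_const:
  assumes "smoothc F" "set Xs \<subseteq> V"
  shows "d (cmul (\<lambda>_. c) F) Xs = (\<lambda>_. c) * d F Xs"
  using assms
proof (induction Xs arbitrary: F)
  case (Cons Y Ys)
  then have Y: "Y \<in> V" "set Ys \<subseteq> V" by auto
  have "d (cmul (\<lambda>_. c) (contr Y F)) Ys = (\<lambda>_. c) * d (contr Y F) Ys"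
    by (intro Cons.IH smoothc_contr Cons.prems(1) Y)
  moreover have "L Y (cmul (\<lambda>_. c) F) Ys = (\<lambda>_. c) * L Y F Ys"
    using cder_cmul[OF anchor_V[OF Y(1)] br_V[OF Y(1)] Y(2) sf_const[of c] Cons.prems(1)] dd_const[OF anchor_V[OF Y(1)], of c]
    by simp
  ultimately show "d (cmul (\<lambda>_. c) F) (Y # Ys) = (\<lambda>_. c) * d F (Y # Ys)" by (simp add: algebra_simps)
qed simp

lemma dif_zero: "d 0 Xs = 0"
  if "set Xs \<subseteq> V"
  using dif_minus[of 0 Xs] dif_add[of 0 0 Xs] that by (simp add: smoothc_def C_intros)

text \<open>Contracting with \<open>Y\<close> reduces the claim to [L_X, L_Y] = L_[X,Y]. In that
  identity the Jacobi identity matches the actions on fields, and \<open>anchor_br\<close> matches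
  the symbols.\<close>

lemma dif_L_commute:
  assumes "tensor F" "X \<in> V" "set Xs \<subseteq> V"
  shows "d (L X F) Xs = L X (d F) Xs"
  using assms(1,3)
proof (induction Xs arbitrary: F)
  case Nil
  then show ?case using dd_zero[OF anchor_V[OF assms(2)]] by simp
next
  case (Cons Y Ys)
  then have Y: "Y \<in> V" "set Ys \<subseteq> V" by auto
  note F = Cons.prems(1) and X = assms(2)
  have sF: "smoothc F" by (rule tensor_smoothc[OF F])
  have c: "smoothc (contr Z F)" if "Z \<in> V" for Z using sF that by (rule smoothc_contr)
  have 1: "d (contr Y (L X F)) Ys = d (L X (contr Y F)) Ys - d (contr (br X Y) F) Ys"
    unfolding contr_cder by (intro dif_diff L_smoothc c X Y br_V)
  have 2: "L X (contr Y (d F)) Ys = L X (L Y F) Ys - L X (d (contr Y F)) Ys"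
    unfolding contr_dif by (intro cder_diff anchor_V br_V L_smoothc dif_smoothc c X Y sF)
  have 3: "L X (L Y F) Ys - L Y (L X F) Ys = cder (lie_bracket (\<rho> X) (\<rho> Y)) (br (br X Y)) F Ys"
    by (intro cder_commute F anchor_V br_V X Y) (use br_jacobi[OF X Y(1)] in simp_all)
  have 4: "d (L X (contr Y F)) Ys = L X (d (contr Y F)) Ys"
    by (intro Cons.IH tensor_contr F Y)
  show "d (L X F) (Y # Ys) = L X (d F) (Y # Ys)"
    using 3 by (simp add: 1 2 4 anchor_br[OF X Y(1), symmetric] algebra_simps)
qed

text \<open>Applying Cartan's formula twice turns i_Y d d into L_Y d - d L_Y + d d i_Y. The first
  two terms cancel by \<open>dif_L_commute\<close>, and the third falls under the induction
  hypothesis.\<close>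

lemma dif_dif:
  assumes "tensor F" "set Xs \<subseteq> V"
  shows "d (d F) Xs = 0"
  using assms
proof (induction Xs arbitrary: F)
  case (Cons Y Ys)
  then have Y: "Y \<in> V" "set Ys \<subseteq> V" by auto
  note sF = tensor_smoothc[OF Cons.prems(1)]
  have "d (contr Y (d F)) Ys = d (L Y F) Ys - d (d (contr Y F)) Ys"
    unfolding contr_dif by (intro dif_diff L_smoothc dif_smoothc smoothc_contr sF Y)
  moreover have "d (d (contr Y F)) Ys = 0" by (intro Cons.IH tensor_contr Cons.prems(1) Y)
  ultimately show "d (d F) (Y # Ys) = 0" using dif_L_commute[OF Cons.prems(1) Y] by simp
qed simp

lemma dif_alt:
  assumes "tensor F" "set us \<subseteq> V" "set ws \<subseteq> V" "X \<in> V"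
  shows "d F (us @ X # X # ws) = 0"
  using assms(1,2)
proof (induction us arbitrary: F)
  case Nil
  \<comment> \<open>Expanding twice, the terms with \<open>L X (contr X F)\<close> cancel; those
    left contain \<open>contr X (contr X F)\<close> and \<open>br X X\<close>, and both are
    zero.\<close>
  have "d (contr X (contr X F)) ws = d 0 ws"
    using tensor_alt[OF Nil(1), of "[]" _ X] assms(3,4) by (intro dif_cong) auto
  moreover have "F (0 # ws) = 0" using tensor_zero[OF Nil(1), of "[]" ws] assms(3) by simp
  ultimately show ?case using assms(3,4) by (simp add: dif_zero br_self)
next
  case (Cons U us)
  then have U: "U \<in> V" "set us \<subseteq> V" by auto
  have "d (contr U F) (us @ X # X # ws) = 0"
    by (rule Cons.IH[OF tensor_contr[OF Cons.prems(1) U(1)] U(2)])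
  moreover have "L U F (us @ X # X # ws) = 0"
    by (rule tensor_alt[OF L_tensor[OF Cons.prems(1) U(1)] U(2) assms(3,4)])
  ultimately show ?case by simp
qed

text \<open>The two terms containing derivatives of \<open>f\<close> below cancel in \<open>L\<^sub>X - d i\<^sub>X\<close>: this is why \<open>d\<close>
  preserves tensoriality.\<close>

lemma L_smul:
  assumes F: "tensor F" and f: "f \<in> C" and XY: "X \<in> V" "Y \<in> V" and Zs: "set Zs \<subseteq> V"
  shows "L (f \<star> X + Y) F Zs = f * L X F Zs + L Y F Zs - cder 0 (\<lambda>Z. dd (\<rho> Z) f \<star> X) F Zs"
proof -
  let ?B = "\<lambda>Z. dd (\<rho> Z) f \<star> X"
  have B: "?B Z \<in> V" if "Z \<in> V" for Z using that f XY by (intro V_smul C_intros anchor_V)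
  let ?B2 = "\<lambda>Z. (-1) \<star> ?B Z + br Y Z"
  have B2: "?B2 Z \<in> V" if "Z \<in> V" for Z
    by (intro V_add V_smul C_intros B br_V XY that)
  have "br (f \<star> X + Y) Z = f \<star> br X Z + ?B2 Z" if Z: "Z \<in> V" for Z
  proof -
    have "br (f \<star> X + Y) Z = - br Z (f \<star> X + Y)"
      by (intro br_antisym Z V_add V_smul f XY)
    also have "\<dots> = f \<star> - br Z X - ?B Z + - br Z Y"
      by (simp only: br_lin[OF Z f XY] smul_minus minus_add_distrib diff_conv_add_uminus)
    also have "\<dots> = f \<star> br X Z - ?B Z + br Y Z"
      by (simp only: br_antisym[OF XY(1) Z] br_antisym[OF XY(2) Z] minus_minus)
    finally show ?thesis by (simp add: smul_minus_left)
  qed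
  then have "cder (f \<star> \<rho> X + \<rho> Y) (br (f \<star> X + Y)) F Zs = f * L X F Zs + cder (\<rho> Y) ?B2 F Zs"
    by (intro cder_param F f Zs br_V XY B2)
  moreover have "cder ((-1) \<star> 0 + \<rho> Y) ?B2 F Zs = (-1) * cder 0 ?B F Zs + L Y F Zs"
    by (intro cder_param F Zs br_V XY B C_intros refl)
  ultimately show ?thesis by (simp add: anchor_lin[OF f XY])
qed

text \<open>This is d(f i_X F) = f d(i_X F) + df \<and> i_X F: the term with \<open>cder 0\<close>
  is minus the wedge product of df and i_X F, the same correction that appears in
  \<open>L_smul\<close>.\<close>

lemma dif_cmul_contr:
  assumes F: "tensor F" and f: "f \<in> C" and X: "X \<in> V" and Zs: "set Zs \<subseteq> V"
  shows "d (cmul f (contr X F)) Zs = f * d (contr X F) Zs - cder 0 (\<lambda>Z. dd (\<rho> Z) f \<star> X) F Zs"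
  using F Zs
proof (induction Zs arbitrary: F)
  case (Cons Y Ys)
  then have Y: "Y \<in> V" "set Ys \<subseteq> V" by auto
  note F = Cons.prems(1) and sF = tensor_smoothc[OF Cons.prems(1)]
  have sc: "smoothc (contr X F)" "smoothc (contr X (contr Y F))" "smoothc (contr Y F)"
    by (intro smoothc_contr sF X Y)+
  have sw: "contr Y (contr X F) Zs = (- contr X (contr Y F)) Zs" if "set Zs \<subseteq> V" for Zs
    using tensor_swap[OF F, of "[]" Zs Y X] that X Y by simp
  have 1: "L Y (cmul f (contr X F)) Ys = dd (\<rho> Y) f * F (X # Ys) + f * L Y (contr X F) Ys"
    using cder_cmul[OF anchor_V[OF Y(1)] br_V[OF Y(1)] Y(2) f sc(1)] by simp
  have "d (cmul f (contr Y (contr X F))) Ys = d (- cmul f (contr X (contr Y F))) Ys"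
    using sw by (intro dif_cong Y) simp
  also have "\<dots> = - d (cmul f (contr X (contr Y F))) Ys"
    by (intro dif_minus smoothc_cmul f sc Y)
  also have "\<dots> = - (f * d (contr X (contr Y F)) Ys - cder 0 (\<lambda>Z. dd (\<rho> Z) f \<star> X) (contr Y F) Ys)"
    using Cons.IH[of "contr Y F", OF tensor_contr[OF F Y(1)] Y(2)] by (rule arg_cong[where f=uminus])
  finally have 2: "d (cmul f (contr Y (contr X F))) Ys
    = - (f * d (contr X (contr Y F)) Ys - cder 0 (\<lambda>Z. dd (\<rho> Z) f \<star> X) (contr Y F) Ys)" .
  have "d (contr Y (contr X F)) Ys = d (- contr X (contr Y F)) Ys"
    using sw by (intro dif_cong Y)
  also have "\<dots> = - d (contr X (contr Y F)) Ys" by (intro dif_minus sc Y)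
  finally have 3: "d (contr Y (contr X F)) Ys = - d (contr X (contr Y F)) Ys" .
  have 4: "F ((dd (\<rho> Y) f \<star> X) # Ys) = dd (\<rho> Y) f * F (X # Ys)"
    using tensor_smul[OF F, of "[]" Ys "dd (\<rho> Y) f" X] Y X f by (simp add: C_intros anchor_V)
  show "d (cmul f (contr X F)) (Y # Ys)
      = f * d (contr X F) (Y # Ys) - cder 0 (\<lambda>Z. dd (\<rho> Z) f \<star> X) F (Y # Ys)"
    by (simp only: dif.simps cder.simps contr_cmul 1 2 3 4) (simp add: algebra_simps)
qed simp

lemma dif_lin:
  assumes "tensor F" "set us \<subseteq> V" and ws: "set ws \<subseteq> V" and f: "f \<in> C" and XY: "X \<in> V" "Y \<in> V"
  shows "d F (us @ (f \<star> X + Y) # ws) = f * d F (us @ X # ws) + d F (us @ Y # ws)"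
  using assms(1,2)
proof (induction us arbitrary: F)
  case Nil
  note F = Nil(1) and sF = tensor_smoothc[OF Nil(1)]
  have s: "smoothc (contr X F)" "smoothc (contr Y F)" by (intro smoothc_contr sF XY)+
  have "d (contr (f \<star> X + Y) F) ws = d (cmul f (contr X F) + contr Y F) ws"
    using tensor_lin[OF F, of "[]" _ f X Y] f XY by (intro dif_cong ws) simp
  also have "\<dots> = d (cmul f (contr X F)) ws + d (contr Y F) ws"
    by (intro dif_add smoothc_cmul f s ws)
  finally have 1: "d (contr (f \<star> X + Y) F) ws = d (cmul f (contr X F)) ws + d (contr Y F) ws" .
  show "d F ([] @ (f \<star> X + Y) # ws) = f * d F ([] @ X # ws) + d F ([] @ Y # ws)"
    by (simp only: append_Nil dif.simps 1 dif_cmul_contr[OF F f XY(1) ws] L_smul[OF F f XY ws])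
      (simp add: algebra_simps)
next
  case (Cons U us)
  then have U: "U \<in> V" "set us \<subseteq> V" by auto
  have "d (contr U F) (us @ (f \<star> X + Y) # ws) = f * d (contr U F) (us @ X # ws) + d (contr U F) (us @ Y # ws)"
    by (rule Cons.IH[OF tensor_contr[OF Cons.prems(1) U(1)] U(2)])
  moreover have "L U F (us @ (f \<star> X + Y) # ws) = f * L U F (us @ X # ws) + L U F (us @ Y # ws)"
    by (rule tensor_lin[OF L_tensor[OF Cons.prems(1) U(1)] U(2) ws f XY])
  ultimately show ?case by (simp add: algebra_simps)
qed

lemma dif_tensor: "tensor F \<Longrightarrow> tensor (d F)"
  by (rule tensorI[OF dif_smoothc[OF tensor_smoothc] dif_lin dif_alt])

text \<open>The operator \<open>d\<close> raises the degree by one, so it anticommutes with the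
  grading involution; this is the source of the sign in the graded Leibniz rule.\<close>

lemma dif_bar:
  assumes "smoothc F" "set Xs \<subseteq> V"
  shows "d (bar F) Xs = - bar (d F) Xs"
  using assms
proof (induction Xs arbitrary: F)
  case Nil
  then show ?case by (simp add: bar_apply)
next
  case (Cons Y Ys)
  then have Y: "Y \<in> V" "set Ys \<subseteq> V" by auto
  have s: "smoothc (contr Y F)" using Cons.prems(1) Y(1) by (rule smoothc_contr)
  have 1: "d (- bar (contr Y F)) Ys = - d (bar (contr Y F)) Ys"
    by (rule dif_minus[OF bar_smoothc[OF s] Y(2)])
  have 2: "L Y (bar F) Ys = bar (L Y F) Ys"
    by (intro cder_bar anchor_V br_V Y Cons.prems(1))
  have 3: "d (bar (contr Y F)) Ys = - bar (d (contr Y F)) Ys"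
    by (rule Cons.IH[OF s Y(2)])
  show "d (bar F) (Y # Ys) = - bar (d F) (Y # Ys)"
    by (simp only: dif.simps contr_bar 1 2 3) (simp add: bar_apply algebra_simps)
qed

lemma dif_wdg:
  assumes "smoothc F" "smoothc G" "set Xs \<subseteq> V"
  shows "d (wdg F G) Xs = wdg (d F) G Xs + wdg (bar F) (d G) Xs"
  using assms
proof (induction Xs arbitrary: F G)
  case Nil
  then show ?case by (simp add: bar_apply)
next
  case (Cons Y Ys)
  then have Y: "Y \<in> V" "set Ys \<subseteq> V" by auto
  note sF = Cons.prems(1) and sG = Cons.prems(2)
  have s: "smoothc (contr Y F)" "smoothc (contr Y G)" using sF sG Y(1) by (auto intro: smoothc_contr)
  have c: "contr Y (wdg F G) = wdg (contr Y F) G + wdg (bar F) (contr Y G)"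
    by (rule ext) (simp add: wdg_Cons)
  have 1: "d (contr Y (wdg F G)) Ys = wdg (d (contr Y F)) G Ys + wdg (bar (contr Y F)) (d G) Ys
      + (wdg (d (bar F)) (contr Y G) Ys + wdg F (d (contr Y G)) Ys)"
    unfolding c
    by (simp only: dif_add[OF wdg_smoothc[OF s(1) sG] wdg_smoothc[OF bar_smoothc[OF sF] s(2)] Y(2)]
        Cons.IH[OF s(1) sG Y(2)] Cons.IH[OF bar_smoothc[OF sF] s(2) Y(2)] bar_bar)
  have 2: "wdg (d (bar F)) (contr Y G) Ys = - wdg (bar (d F)) (contr Y G) Ys"
    unfolding wdg_minus_left[symmetric]
    by (rule wdg_cong) (use dif_bar[OF sF] Y in auto)
  have 3: "L Y (wdg F G) Ys = wdg (L Y F) G Ys + wdg F (L Y G) Ys"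
    by (intro cder_wdg anchor_V br_V Y sF sG)
  show "d (wdg F G) (Y # Ys) = wdg (d F) G (Y # Ys) + wdg (bar F) (d G) (Y # Ys)"
    by (simp add: 1 2 3 wdg_Cons contr_bar contr_dif bar_bar wdg_diff_left wdg_diff_right wdg_minus_left algebra_simps)
qed

lemma dif_degree:
  assumes "\<And>Zs. set Zs \<subseteq> V \<Longrightarrow> length Zs \<noteq> k \<Longrightarrow> F Zs = 0" "set Xs \<subseteq> V" "length Xs \<noteq> Suc k"
  shows "d F Xs = 0"
proof -
  have Lz: "cder R B F Zs = 0" if "R \<in> V" "\<And>X. X \<in> V \<Longrightarrow> B X \<in> V" "set Zs \<subseteq> V" "length Zs \<noteq> k"
    "\<And>Zs. set Zs \<subseteq> V \<Longrightarrow> length Zs \<noteq> k \<Longrightarrow> F Zs = 0" for R B Zs k F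
    using that(3-)
  proof (induction Zs arbitrary: F k)
    case Nil
    then show ?case using dd_zero[OF that(1)] by simp
  next
    case (Cons Y Ys)
    \<comment> \<open>For \<open>k = 0\<close> there is no degree \<open>k - 1\<close>, and
      \<open>contr Y F\<close> vanishes on all lists of fields; any number different from the length
      of \<open>Ys\<close> then serves as its degree.\<close>
    have "cder R B (contr Y F) Ys = 0"
      by (cases "k = 0"; rule Cons.IH[of "if k = 0 then Suc (length Ys) else k - 1"]) (use Cons.prems in auto)
    then show ?case using Cons.prems that(2) by simp
  qed
  show ?thesis
    using assms
  proof (induction Xs arbitrary: F k)
    case (Cons Y Ys)
    have "d (contr Y F) Ys = 0"
      by (cases "k = 0"; rule Cons.IH[of "if k = 0 then Suc (length Ys) else k - 1"]) (use Cons.prems in auto)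
    moreover have "L Y F Ys = 0"
      by (rule Lz[of _ _ _ k]) (use Cons.prems anchor_V br_V in auto)
    ultimately show ?case by simp
  qed simp
qed

end

section \<open>Sums over shuffles\<close>

text \<open>A permutation of the first n + 1 numbers amounts to the place \<open>j\<close> of the
  value 0 together with a permutation \<open>\<tau>\<close> of the rest. Since 0 is the index of the
  head of a list, removing it gives the recursion for shuffles.\<close>

definition insert_pos :: "nat \<Rightarrow> (nat \<Rightarrow> nat) \<Rightarrow> nat \<Rightarrow> nat" where
  "insert_pos j \<tau> i = (if i < j then Suc (\<tau> i) else if i = j then 0 else Suc (\<tau> (i - 1)))"

definition delete_pos :: "nat \<Rightarrow> (nat \<Rightarrow> nat) \<Rightarrow> nat \<Rightarrow> nat" where
  "delete_pos j \<sigma> i = (if i < j then \<sigma> i else \<sigma> (Suc i)) - 1"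

lemma delete_insert_pos: "delete_pos j (insert_pos j \<tau>) = \<tau>"
  by (auto simp: delete_pos_def insert_pos_def fun_eq_iff)

text \<open>Moving the value 0 one place further is composition with an adjacent transposition;
  bijectivity and the sign \<open>(-1) ^ j\<close> follow by induction on \<open>j\<close>.\<close>

lemma insert_pos_Suc: "insert_pos (Suc j) \<tau> = insert_pos j \<tau> \<circ> Transposition.transpose j (Suc j)"
  by (auto simp: insert_pos_def fun_eq_iff Transposition.transpose_def)

lemma insert_delete_pos:
  assumes "\<sigma> permutes S" "\<sigma> j = 0"
  shows "insert_pos j (delete_pos j \<sigma>) = \<sigma>"
proof
  fix i
  have "\<sigma> i \<noteq> 0" if "i \<noteq> j" using injD[OF permutes_inj[OF assms(1)], of i j] assms(2) that by auto
  then show "insert_pos j (delete_pos j \<sigma>) i = \<sigma> i"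
    using assms(2) by (auto simp: insert_pos_def delete_pos_def)
qed

lemma inj_on_imp_permutes:
  assumes "finite S" "inj_on p S" "p ` S \<subseteq> S" "\<And>x. x \<notin> S \<Longrightarrow> p x = x"
  shows "p permutes S"
proof (rule bij_imp_permutes)
  show "bij_betw p S S" using assms endo_inj_surj[OF assms(1,3,2)] by (simp add: bij_betw_def)
qed (use assms in auto)

lemma insert_pos_permutes:
  assumes "\<tau> permutes {..<n}" "j \<le> n"
  shows "insert_pos j \<tau> permutes {..<Suc n}"
  using assms(2)
proof (induction j)
  case 0
  show ?case
  proof (rule inj_on_imp_permutes)
    show "inj_on (insert_pos 0 \<tau>) {..<Suc n}"
    proof (rule inj_onI)
      fix x y assume "insert_pos 0 \<tau> x = insert_pos 0 \<tau> y"
      then show "x = y" using inj_eq[OF permutes_inj[OF assms(1)]]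
        by (cases x; cases y) (simp_all add: insert_pos_def)
    qed
    show "insert_pos 0 \<tau> ` {..<Suc n} \<subseteq> {..<Suc n}"
    proof (intro subsetI, elim imageE)
      fix y x assume "y = insert_pos 0 \<tau> x" "x \<in> {..<Suc n}"
      then show "y \<in> {..<Suc n}" using permutes_in_image[OF assms(1), of "x - 1"]
        by (cases x) (simp_all add: insert_pos_def)
    qed
    show "insert_pos 0 \<tau> x = x" if "x \<notin> {..<Suc n}" for x
      using permutes_not_in[OF assms(1), of "x - 1"] that by (auto simp: insert_pos_def)
  qed simp
next
  case (Suc j)
  then show ?case unfolding insert_pos_Suc
    by (intro permutes_compose[OF permutes_swap_id]) simp_all
qed

lemma delete_pos_permutes:
  assumes "\<sigma> permutes {..<Suc n}" "j \<le> n" "\<sigma> j = 0"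
  shows "delete_pos j \<sigma> permutes {..<n}"
proof (rule inj_on_imp_permutes)
  have inj: "x = y" if "\<sigma> x = \<sigma> y" for x y using injD[OF permutes_inj[OF assms(1)]] that by blast
  have nz: "\<sigma> i \<noteq> 0" if "i \<noteq> j" for i using inj[of i j] assms(3) that by auto
  have less: "\<sigma> i < Suc n" if "i < Suc n" for i using permutes_in_image[OF assms(1), of i] that by simp
  show "inj_on (delete_pos j \<sigma>) {..<n}"
  proof (rule inj_onI)
    fix x y assume e: "delete_pos j \<sigma> x = delete_pos j \<sigma> y"
    let ?f = "\<lambda>i. if i < j then i else Suc i"
    have "?f x \<noteq> j" "?f y \<noteq> j" by auto
    from nz[OF this(1)] nz[OF this(2)] e have "\<sigma> (?f x) = \<sigma> (?f y)"
      by (auto simp: delete_pos_def split: if_splits)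
    from inj[OF this] show "x = y" by (auto split: if_splits)
  qed
  show "delete_pos j \<sigma> ` {..<n} \<subseteq> {..<n}"
  proof
    fix y assume "y \<in> delete_pos j \<sigma> ` {..<n}"
    then obtain x where x: "x < n" "y = delete_pos j \<sigma> x" by auto
    show "y \<in> {..<n}"
      using less[of x] less[of "Suc x"] nz[of x] nz[of "Suc x"] x by (auto simp: delete_pos_def)
  qed
  show "delete_pos j \<sigma> x = x" if "x \<notin> {..<n}" for x
    using permutes_not_in[OF assms(1), of "Suc x"] that assms(2) by (auto simp: delete_pos_def)
qed simp

lemma sign_insert_pos:
  assumes "\<tau> permutes {..<n}"
  shows "sign (insert_pos j \<tau>) = (-1) ^ j * sign \<tau>"
proof (induction j)
  case 0
  have id0: "insert_pos 0 id = id" by (auto simp: insert_pos_def fun_eq_iff)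
  \<comment> \<open>Shifting by one sends transpositions to transpositions, so both signs flip
    together along a factorisation of \<tau>.\<close>
  have sw: "insert_pos 0 (Transposition.transpose a b \<circ> p) = Transposition.transpose (Suc a) (Suc b) \<circ> insert_pos 0 p" for a b p
    by (auto simp: insert_pos_def fun_eq_iff Transposition.transpose_def)
  have "sign (insert_pos 0 \<tau>) = sign \<tau> \<and> permutation (insert_pos 0 \<tau>)"
    using assms finite_lessThan[of n]
  proof (induction rule: permutes_induct)
    case id
    show ?case unfolding id0 by (simp add: sign_id)
  next
    case (swap a b p)
    have "permutation p" using swap.hyps by (auto simp: permutation_permutes)
    then have "sign (Transposition.transpose a b \<circ> p) = - sign p"
      "sign (Transposition.transpose (Suc a) (Suc b) \<circ> insert_pos 0 p) = - sign (insert_pos 0 p)"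
      using swap by (simp_all only: sign_compose[OF permutation_swap_id] sign_swap_id) auto
    then have "sign (insert_pos 0 (Transposition.transpose a b \<circ> p)) = sign (Transposition.transpose a b \<circ> p)"
      using swap.IH unfolding sw by metis
    then show ?case using swap.IH unfolding sw
      by (intro conjI permutation_compose permutation_swap_id) blast+
  qed
  then show ?case by simp
next
  case (Suc j)
  have perm: "permutation (insert_pos j \<tau>)" for j
  proof (induction j)
    case 0
    show ?case using insert_pos_permutes[OF assms, of 0] by (auto simp: permutation_permutes)
  next
    case (Suc j)
    then show ?case unfolding insert_pos_Suc by (intro permutation_compose permutation_swap_id)
  qed
  show ?case unfolding insert_pos_Suc sign_compose[OF perm permutation_swap_id] Suc
    by (simp add: sign_swap_id)
qed

text \<open>Wedge products and insertions differ only in what \<open>h\<close> does with the two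
  blocks of a shuffle, so one recursion serves both.\<close>

definition shuffle_sum :: "nat \<Rightarrow> nat \<Rightarrow> ('a list \<Rightarrow> 'a list \<Rightarrow> real) \<Rightarrow> 'a list \<Rightarrow> real" where
  "shuffle_sum k l h zs = (\<Sum>\<sigma>\<in>unshuffles k l. of_int (sign \<sigma>) *
     h (map (\<lambda>i. zs ! \<sigma> i) [0..<k]) (map (\<lambda>i. zs ! \<sigma> i) [k..<k + l]))"

lemma finite_unshuffles: "finite (unshuffles k l)"
  by (rule finite_subset[OF _ finite_permutations[of "{..<k + l}"]]) (auto simp: unshuffles_def)

lemma unshuffles_iff: "\<sigma> \<in> unshuffles k l \<longleftrightarrow> \<sigma> permutes {..<k + l} \<and>
    (\<forall>i j. i < j \<longrightarrow> j < k \<longrightarrow> \<sigma> i < \<sigma> j) \<and> (\<forall>i j. k \<le> i \<longrightarrow> i < j \<longrightarrow> j < k + l \<longrightarrow> \<sigma> i < \<sigma> j)"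
proof -
  have "strict_mono_on {..<k} \<sigma> \<longleftrightarrow> (\<forall>i j. i < j \<longrightarrow> j < k \<longrightarrow> \<sigma> i < \<sigma> j)"
    unfolding strict_mono_on_def by (meson lessThan_iff order.strict_trans)
  moreover have "strict_mono_on {k..<k + l} \<sigma> \<longleftrightarrow> (\<forall>i j. k \<le> i \<longrightarrow> i < j \<longrightarrow> j < k + l \<longrightarrow> \<sigma> i < \<sigma> j)"
    unfolding strict_mono_on_def by (meson atLeastLessThan_iff le_less_trans less_imp_le order.strict_trans)
  ultimately show ?thesis by (simp add: unshuffles_def)
qed

lemma unshufflesD:
  assumes "\<sigma> \<in> unshuffles k l"
  shows "\<sigma> permutes {..<k + l}" "i < j \<Longrightarrow> j < k \<Longrightarrow> \<sigma> i < \<sigma> j"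
    "k \<le> i \<Longrightarrow> i < j \<Longrightarrow> j < k + l \<Longrightarrow> \<sigma> i < \<sigma> j"
  using assms by (auto simp: unshuffles_iff)

lemma unshufflesI:
  assumes "\<sigma> permutes {..<k + l}" "\<And>i j. i < j \<Longrightarrow> j < k \<Longrightarrow> \<sigma> i < \<sigma> j"
    "\<And>i j. k \<le> i \<Longrightarrow> i < j \<Longrightarrow> j < k + l \<Longrightarrow> \<sigma> i < \<sigma> j"
  shows "\<sigma> \<in> unshuffles k l"
  using assms unfolding unshuffles_iff by blast

lemma unshuffles_insert_left:
  assumes "\<tau> \<in> unshuffles k l"
  shows "insert_pos 0 \<tau> \<in> unshuffles (Suc k) l"
proof -
  have 1: "insert_pos 0 \<tau> i < insert_pos 0 \<tau> j" if "i < j" "j < Suc k" for i j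
    using unshufflesD(2)[OF assms, of "i - 1" "j - 1"] that by (auto simp: insert_pos_def)
  have 2: "insert_pos 0 \<tau> i < insert_pos 0 \<tau> j" if "Suc k \<le> i" "i < j" "j < Suc k + l" for i j
    using unshufflesD(3)[OF assms, of "i - 1" "j - 1"] that by (auto simp: insert_pos_def)
  show ?thesis
    by (rule unshufflesI[where \<sigma>="insert_pos 0 \<tau>", OF _ 1 2]) (use insert_pos_permutes[OF unshufflesD(1)[OF assms], of 0] in simp_all)
qed

lemma unshuffles_insert_right:
  assumes "\<tau> \<in> unshuffles k l"
  shows "insert_pos k \<tau> \<in> unshuffles k (Suc l)"
proof -
  have 1: "insert_pos k \<tau> i < insert_pos k \<tau> j" if "i < j" "j < k" for i j
    using unshufflesD(2)[OF assms, of i j] that by (auto simp: insert_pos_def)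
  have 2: "insert_pos k \<tau> i < insert_pos k \<tau> j" if "k \<le> i" "i < j" "j < k + Suc l" for i j
    using unshufflesD(3)[OF assms, of "i - 1" "j - 1"] that by (auto simp: insert_pos_def)
  show ?thesis
    by (rule unshufflesI[where \<sigma>="insert_pos k \<tau>", OF _ 1 2]) (use insert_pos_permutes[OF unshufflesD(1)[OF assms], of k] in simp_all)
qed

lemma permutes_nonzero:
  assumes "\<sigma> permutes S" "\<sigma> j = (0::nat)" "i \<noteq> j"
  shows "0 < \<sigma> i"
  using injD[OF permutes_inj[OF assms(1)], of i j] assms(2,3) by (cases "\<sigma> i") auto

lemma unshuffles_delete_left:
  assumes "\<sigma> \<in> unshuffles (Suc k) l" "\<sigma> 0 = 0"
  shows "delete_pos 0 \<sigma> \<in> unshuffles k l"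
proof -
  have p: "\<sigma> permutes {..<Suc (k + l)}" using unshufflesD(1)[OF assms(1)] by simp
  have nz: "0 < \<sigma> (Suc i)" for i by (rule permutes_nonzero[OF p assms(2)]) simp
  have 1: "delete_pos 0 \<sigma> i < delete_pos 0 \<sigma> j" if "i < j" "j < k" for i j
    using unshufflesD(2)[OF assms(1), of "Suc i" "Suc j"] nz[of i] that by (simp add: delete_pos_def)
  have 2: "delete_pos 0 \<sigma> i < delete_pos 0 \<sigma> j" if "k \<le> i" "i < j" "j < k + l" for i j
    using unshufflesD(3)[OF assms(1), of "Suc i" "Suc j"] nz[of i] that by (simp add: delete_pos_def)
  show ?thesis
    by (rule unshufflesI[where \<sigma>="delete_pos 0 \<sigma>", OF _ 1 2]) (use delete_pos_permutes[OF p, of 0] assms(2) in simp_all)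
qed

lemma unshuffles_delete_right:
  assumes "\<sigma> \<in> unshuffles k (Suc l)" "\<sigma> k = 0"
  shows "delete_pos k \<sigma> \<in> unshuffles k l"
proof -
  have p: "\<sigma> permutes {..<Suc (k + l)}" using unshufflesD(1)[OF assms(1)] by simp
  note nz = permutes_nonzero[OF p assms(2)]
  have 1: "delete_pos k \<sigma> i < delete_pos k \<sigma> j" if "i < j" "j < k" for i j
    using unshufflesD(2)[OF assms(1), of i j] nz[of i] that by (simp add: delete_pos_def)
  have 2: "delete_pos k \<sigma> i < delete_pos k \<sigma> j" if "k \<le> i" "i < j" "j < k + l" for i j
    using unshufflesD(3)[OF assms(1), of "Suc i" "Suc j"] nz[of "Suc i"] that by (simp add: delete_pos_def)
  show ?thesis
    by (rule unshufflesI[where \<sigma>="delete_pos k \<sigma>", OF _ 1 2]) (use delete_pos_permutes[OF p, of k] assms(2) in simp_all)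
qed

text \<open>The least value can only stand first in the block that contains it, as each block is
  increasing.\<close>

lemma unshuffles_zero_cases:
  assumes "\<sigma> \<in> unshuffles k l" "0 < k + l"
  shows "(0 < k \<and> \<sigma> 0 = 0) \<or> (0 < l \<and> \<sigma> k = 0)"
proof -
  note p = unshufflesD(1)[OF assms(1)]
  obtain i where i: "\<sigma> i = 0" using surjD[OF permutes_surj[OF p], of 0] by auto
  have "i < k + l" using permutes_in_image[OF p, of i] i assms(2) by simp
  show ?thesis
  proof (cases "i < k")
    case True
    then have "\<not> 0 < i" using unshufflesD(2)[OF assms(1), of 0 i] i by auto
    then show ?thesis using True i by auto
  next
    case False
    have "\<not> k < i"
    proof
      assume "k < i"
      from unshufflesD(3)[OF assms(1) order_refl this \<open>i < k + l\<close>] i show False by simp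
    qed
    then have "i = k" using False by linarith
    then show ?thesis using i \<open>i < k + l\<close> by simp
  qed
qed

text \<open>The head of the list begins either the first block or the second; in the latter case it
  has passed the \<open>k\<close> entries of the first block, hence the sign
  \<open>(-1) ^ k\<close>.\<close>

lemma shuffle_sum_Cons:
  assumes "k + l = Suc (length zs)"
  shows "shuffle_sum k l h (z # zs) =
    (if 0 < k then shuffle_sum (k - 1) l (\<lambda>us ws. h (z # us) ws) zs else 0) +
    (if 0 < l then (-1) ^ k * shuffle_sum k (l - 1) (\<lambda>us ws. h us (z # ws)) zs else 0)"
proof -
  let ?g = "\<lambda>\<sigma>. of_int (sign \<sigma>) * h (map (\<lambda>i. (z # zs) ! \<sigma> i) [0..<k]) (map (\<lambda>i. (z # zs) ! \<sigma> i) [k..<k + l])"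
  define P where "P = {\<sigma> \<in> unshuffles k l. 0 < k \<and> \<sigma> 0 = 0}"
  define Q where "Q = {\<sigma> \<in> unshuffles k l. 0 < l \<and> \<sigma> k = 0}"
  have un: "unshuffles k l = P \<union> Q"
  proof (rule set_eqI)
    fix \<sigma>
    show "\<sigma> \<in> unshuffles k l \<longleftrightarrow> \<sigma> \<in> P \<union> Q"
      using unshuffles_zero_cases[of \<sigma> k l] assms unfolding P_def Q_def by auto
  qed
  have "P \<inter> Q = {}"
  proof -
    have "0 = k" if "\<sigma> \<in> unshuffles k l" "\<sigma> 0 = 0" "\<sigma> k = 0" for \<sigma>
      using injD[OF permutes_inj[OF unshufflesD(1)[OF that(1)]], of 0 k] that by simp
    then show ?thesis by (auto simp: P_def Q_def)
  qed
  then have "shuffle_sum k l h (z # zs) = sum ?g P + sum ?g Q"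
    unfolding shuffle_sum_def un using finite_unshuffles[of k l] by (intro sum.union_disjoint) (auto simp: un)
  moreover have "sum ?g P = (if 0 < k then shuffle_sum (k - 1) l (\<lambda>us ws. h (z # us) ws) zs else 0)"
  proof (cases k)
    case 0
    then show ?thesis by (simp add: P_def)
  next
    case (Suc k')
    have "sum ?g P = (\<Sum>\<tau>\<in>unshuffles k' l. of_int (sign \<tau>) *
      h (z # map (\<lambda>i. zs ! \<tau> i) [0..<k']) (map (\<lambda>i. zs ! \<tau> i) [k'..<k' + l]))"
    proof (rule sum.reindex_bij_witness[of _ "insert_pos 0" "delete_pos 0"])
      fix \<sigma> assume s: "\<sigma> \<in> P"
      then show "insert_pos 0 (delete_pos 0 \<sigma>) = \<sigma>"
        by (intro insert_delete_pos[of _ "{..<k + l}"]) (auto simp: P_def unshuffles_def)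
      show d: "delete_pos 0 \<sigma> \<in> unshuffles k' l" using s by (auto simp: P_def Suc unshuffles_delete_left)
      let ?t = "delete_pos 0 \<sigma>"
      have e: "\<sigma> = insert_pos 0 ?t" by (rule sym) fact
      have "sign \<sigma> = sign ?t"
        by (subst e) (use sign_insert_pos[of ?t "k' + l" 0] d in \<open>simp add: unshuffles_def\<close>)
      moreover have "map (\<lambda>i. (z # zs) ! \<sigma> i) [0..<k] = z # map (\<lambda>i. zs ! ?t i) [0..<k']"
        unfolding Suc by (subst e, subst upt_conv_Cons) (simp_all add: insert_pos_def map_Suc_upt[symmetric] del: upt_Suc map_Suc_upt)
      moreover have "map (\<lambda>i. (z # zs) ! \<sigma> i) [k..<k + l] = map (\<lambda>i. zs ! ?t i) [k'..<k' + l]"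
        unfolding Suc by (subst e) (simp add: insert_pos_def map_Suc_upt[symmetric] del: upt_Suc map_Suc_upt)
      ultimately show "of_int (sign ?t) * h (z # map (\<lambda>i. zs ! ?t i) [0..<k']) (map (\<lambda>i. zs ! ?t i) [k'..<k' + l]) = ?g \<sigma>"
        by simp
    next
      fix \<tau> assume t: "\<tau> \<in> unshuffles k' l"
      show "delete_pos 0 (insert_pos 0 \<tau>) = \<tau>" by (rule delete_insert_pos)
      show "insert_pos 0 \<tau> \<in> P" using unshuffles_insert_left[OF t] by (simp add: P_def Suc insert_pos_def)
    qed
    then show ?thesis by (simp add: Suc shuffle_sum_def)
  qed
  moreover have "sum ?g Q = (if 0 < l then (-1) ^ k * shuffle_sum k (l - 1) (\<lambda>us ws. h us (z # ws)) zs else 0)"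
  proof (cases l)
    case 0
    then show ?thesis by (simp add: Q_def)
  next
    case (Suc l')
    have "sum ?g Q = (\<Sum>\<tau>\<in>unshuffles k l'. (-1) ^ k * (of_int (sign \<tau>) *
      h (map (\<lambda>i. zs ! \<tau> i) [0..<k]) (z # map (\<lambda>i. zs ! \<tau> i) [k..<k + l'])))"
    proof (rule sum.reindex_bij_witness[of _ "insert_pos k" "delete_pos k"])
      fix \<sigma> assume s: "\<sigma> \<in> Q"
      then show "insert_pos k (delete_pos k \<sigma>) = \<sigma>"
        by (intro insert_delete_pos[of _ "{..<k + l}"]) (auto simp: Q_def unshuffles_def)
      show d: "delete_pos k \<sigma> \<in> unshuffles k l'" using s by (auto simp: Q_def Suc unshuffles_delete_right)
      let ?t = "delete_pos k \<sigma>"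
      have e: "\<sigma> = insert_pos k ?t" by (rule sym) fact
      have "sign \<sigma> = (-1) ^ k * sign ?t"
        by (subst e) (use sign_insert_pos[of ?t "k + l'" k] d in \<open>simp add: unshuffles_def\<close>)
      moreover have "map (\<lambda>i. (z # zs) ! \<sigma> i) [0..<k] = map (\<lambda>i. zs ! ?t i) [0..<k]"
        by (subst e) (simp add: insert_pos_def)
      moreover have "map (\<lambda>i. (z # zs) ! \<sigma> i) [k..<k + l] = z # map (\<lambda>i. zs ! ?t i) [k..<k + l']"
        unfolding Suc by (subst e, subst upt_conv_Cons) (simp_all add: insert_pos_def map_Suc_upt[symmetric] del: upt_Suc map_Suc_upt)
      ultimately show "(-1) ^ k * (of_int (sign ?t) * h (map (\<lambda>i. zs ! ?t i) [0..<k]) (z # map (\<lambda>i. zs ! ?t i) [k..<k + l'])) = ?g \<sigma>"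
        by (simp only: of_int_mult of_int_power of_int_minus of_int_1 mult.assoc)
    next
      fix \<tau> assume t: "\<tau> \<in> unshuffles k l'"
      show "delete_pos k (insert_pos k \<tau>) = \<tau>" by (rule delete_insert_pos)
      show "insert_pos k \<tau> \<in> Q" using unshuffles_insert_right[OF t] by (simp add: Q_def Suc insert_pos_def)
    qed
    then show ?thesis by (simp add: Suc shuffle_sum_def sum_distrib_left)
  qed
  ultimately show ?thesis by simp
qed

lemma shuffle_sum_0: "length zs = l \<Longrightarrow> shuffle_sum 0 l h zs = h [] zs"
proof (induction zs arbitrary: l h)
  case Nil
  have "unshuffles 0 0 = {id}" by (auto simp: unshuffles_def strict_mono_on_def)
  then show ?case using Nil by (simp add: shuffle_sum_def)
next
  case (Cons z zs)
  then show ?case using shuffle_sum_Cons[of 0 l zs h z] Cons.IH[of "l - 1"] by auto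
qed

lemma shuffle_sum_minus: "shuffle_sum k l (\<lambda>us ws. - h us ws) zs = - shuffle_sum k l h zs"
  by (simp add: shuffle_sum_def sum_negf)

definition full_shuffle_sum :: "('a list \<Rightarrow> 'a list \<Rightarrow> real) \<Rightarrow> 'a list \<Rightarrow> real" where
  "full_shuffle_sum h zs = (\<Sum>k\<le>length zs. shuffle_sum k (length zs - k) h zs)"

text \<open>With all splittings summed, the sign \<open>(-1) ^ k\<close> is no longer constant and
  has to be expressed by the length of the first block; it thereby becomes the grading involution
  \<open>bar\<close>.\<close>

lemma full_shuffle_sum_Cons:
  "full_shuffle_sum h (z # zs) = full_shuffle_sum (\<lambda>us ws. h (z # us) ws) zs
     + full_shuffle_sum (\<lambda>us ws. (-1) ^ length us * h us (z # ws)) zs"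
proof -
  let ?n = "length zs"
  have "full_shuffle_sum h (z # zs) =
      (\<Sum>k\<le>Suc ?n. if 0 < k then shuffle_sum (k - 1) (Suc ?n - k) (\<lambda>us ws. h (z # us) ws) zs else 0)
      + (\<Sum>k\<le>Suc ?n. if 0 < Suc ?n - k then (-1) ^ k * shuffle_sum k (Suc ?n - k - 1) (\<lambda>us ws. h us (z # ws)) zs else 0)"
    unfolding full_shuffle_sum_def sum.distrib[symmetric] list.size
    by (intro sum.cong) (simp_all add: shuffle_sum_Cons)
  also have "(\<Sum>k\<le>Suc ?n. if 0 < k then shuffle_sum (k - 1) (Suc ?n - k) (\<lambda>us ws. h (z # us) ws) zs else 0)
      = full_shuffle_sum (\<lambda>us ws. h (z # us) ws) zs"
    by (subst sum.atMost_Suc_shift) (simp add: full_shuffle_sum_def)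
  also have "(\<Sum>k\<le>Suc ?n. if 0 < Suc ?n - k then (-1) ^ k * shuffle_sum k (Suc ?n - k - 1) (\<lambda>us ws. h us (z # ws)) zs else 0)
      = full_shuffle_sum (\<lambda>us ws. (-1) ^ length us * h us (z # ws)) zs"
  proof -
    have "shuffle_sum k l (\<lambda>us ws. (-1) ^ length us * h us (z # ws)) zs
        = (-1) ^ k * shuffle_sum k l (\<lambda>us ws. h us (z # ws)) zs" for k l
      by (simp add: shuffle_sum_def sum_distrib_left mult.left_commute)
    then show ?thesis
      unfolding full_shuffle_sum_def sum.atMost_Suc by (auto simp: Suc_diff_le intro!: sum.cong)
  qed
  finally show ?thesis .
qed

section \<open>Differential forms as tensorial cochains\<close>

definition ev :: "'m form \<Rightarrow> 'm cochain" where
  "ev \<omega> Xs = (\<lambda>p. \<omega> p (map (\<lambda>X. X p) Xs))"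

lemma ev_apply: "ev \<omega> Xs p = \<omega> p (map (\<lambda>X. X p) Xs)"
  by (simp add: ev_def)

lemma alternating_multilinearD:
  assumes "alternating_multilinear S \<omega>"
  shows "\<not> set vs \<subseteq> S \<Longrightarrow> \<omega> vs = 0"
    and "v \<in> S \<Longrightarrow> w \<in> S \<Longrightarrow> set us \<subseteq> S \<Longrightarrow> set ws \<subseteq> S \<Longrightarrow>
      \<omega> (us @ (\<lambda>f. v f + w f) # ws) = \<omega> (us @ v # ws) + \<omega> (us @ w # ws)"
    and "v \<in> S \<Longrightarrow> set us \<subseteq> S \<Longrightarrow> set ws \<subseteq> S \<Longrightarrow> \<omega> (us @ (\<lambda>f. c * v f) # ws) = c * \<omega> (us @ v # ws)"
    and "set vs \<subseteq> S \<Longrightarrow> \<not> distinct vs \<Longrightarrow> \<omega> vs = 0"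
proof -
  note d = assms[unfolded alternating_multilinear_def]
  show "\<not> set vs \<subseteq> S \<Longrightarrow> \<omega> vs = 0" using d[THEN conjunct1] by (elim allE impE)
  show "v \<in> S \<Longrightarrow> w \<in> S \<Longrightarrow> set us \<subseteq> S \<Longrightarrow> set ws \<subseteq> S \<Longrightarrow>
      \<omega> (us @ (\<lambda>f. v f + w f) # ws) = \<omega> (us @ v # ws) + \<omega> (us @ w # ws)"
    using d[THEN conjunct2, THEN conjunct1] by simp
  show "v \<in> S \<Longrightarrow> set us \<subseteq> S \<Longrightarrow> set ws \<subseteq> S \<Longrightarrow> \<omega> (us @ (\<lambda>f. c * v f) # ws) = c * \<omega> (us @ v # ws)"
    using d[THEN conjunct2, THEN conjunct2, THEN conjunct1] by simp
  show "set vs \<subseteq> S \<Longrightarrow> \<not> distinct vs \<Longrightarrow> \<omega> vs = 0"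
    using d[THEN conjunct2, THEN conjunct2, THEN conjunct2] by simp
qed

context smooth_manifold begin

section \<open>Tensorial cochains are determined pointwise\<close>

lemma V_sum: "(\<And>i. i \<in> I \<Longrightarrow> E i \<in> V) \<Longrightarrow> (\<Sum>i\<in>I. E i) \<in> V"
  by (induction I rule: infinite_finite_induct) (simp_all add: V_zero V_add)

lemma sum_field_apply: "(\<Sum>i\<in>I. E i) p f = (\<Sum>i\<in>I. E i p f)" for E :: "'i \<Rightarrow> 'm \<Rightarrow> 'm tvec"
  by (induction I rule: infinite_finite_induct) (simp_all add: fun_apply)

text \<open>The frame identity of \<open>local_frame\<close> at \<open>p\<close>, used with the
  constants \<open>v (g i) / \<eta> p\<close> as coefficients of the global fields
  \<open>E i\<close>.\<close>

lemma extension_exists: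
  assumes "v \<in> T p"
  shows "\<exists>X. X \<in> V \<and> X p = v"
proof -
  from local_frame[of p] obtain \<eta> where \<eta>: "\<eta> \<in> C" "\<eta> p \<noteq> 0"
    and ex: "\<exists>(I :: ('e \<times> bool) set) g E. finite I \<and> (\<forall>i\<in>I. g i \<in> C \<and> E i \<in> V) \<and>
     (\<forall>q. \<forall>v\<in>T q. \<forall>f. \<eta> q * v f = (\<Sum>i\<in>I. v (g i) * E i q f))" by (elim bexE conjE)
  from ex obtain I :: "('e \<times> bool) set" and g E where I: "finite I" and gE': "\<forall>i\<in>I. g i \<in> C \<and> E i \<in> V"
    and rep': "\<forall>q. \<forall>v\<in>T q. \<forall>f. \<eta> q * v f = (\<Sum>i\<in>I. v (g i) * E i q f)" by (elim exE conjE)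
  have gE: "g i \<in> C" "E i \<in> V" if "i \<in> I" for i using gE' that by auto
  have rep: "\<eta> q * v f = (\<Sum>i\<in>I. v (g i) * E i q f)" if "v \<in> T q" for q v f using rep' that by blast
  define X where "X = (\<Sum>i\<in>I. (\<lambda>_. v (g i) / \<eta> p) \<star> E i)"
  have "X \<in> V" unfolding X_def by (intro V_sum V_smul sf_const gE)
  moreover have "X p f = v f" for f
  proof -
    have "X p f = (\<Sum>i\<in>I. v (g i) * E i p f) / \<eta> p"
      by (simp add: X_def sum_field_apply smul_def sum_divide_distrib)
    then show ?thesis using rep[OF assms, of f] \<eta>(2) by (metis nonzero_mult_div_cancel_left)
  qed
  ultimately show ?thesis by blast
qed

lemma extend_tvec:
  assumes "v \<in> T p"
  shows "extend_tvec A p v \<in> V" "extend_tvec A p v p = v"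
  using someI_ex[OF extension_exists[OF assms]] by (simp_all add: extend_tvec_def)

lemma extend_list:
  assumes "set vs \<subseteq> T p"
  shows "set (map (extend_tvec A p) vs) \<subseteq> V" "map (\<lambda>X. X p) (map (extend_tvec A p) vs) = vs"
  using assms by (auto simp: extend_tvec subset_iff intro!: map_idI)

lemma field_list_tangent: "set Xs \<subseteq> V \<Longrightarrow> set (map (\<lambda>X. X p) Xs) \<subseteq> T p"
  by (auto intro: vf_tangent)

lemma tangent_add: "v \<in> T p \<Longrightarrow> w \<in> T p \<Longrightarrow> (\<lambda>f. v f + w f) \<in> T p"
  using vf_tangent[OF V_add[OF extend_tvec(1) extend_tvec(1)], of v p w p p]
  by (simp add: extend_tvec plus_fun_def)

lemma tangent_scale: "v \<in> T p \<Longrightarrow> (\<lambda>f. c * v f) \<in> T p"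
  using vf_tangent[OF V_smul[OF sf_const extend_tvec(1)], of v p c p]
  by (simp add: extend_tvec smul_def)

lemma tangent_zero: "(\<lambda>f. 0) \<in> T p"
  using vf_tangent[OF V_zero, of p] by (simp add: zero_fun_def)

text \<open>The field \<open>\<eta> \<star> Z\<close> is a combination of frame fields whose
  coefficients \<open>dd Z (g i)\<close> vanish at \<open>p\<close>; linearity over smooth functions
  carries this over to \<open>F\<close>, and \<open>\<eta> p\<close> can be divided out.\<close>

lemma tensor_vanish:
  assumes F: "tensor F" and us: "set us \<subseteq> V" and ws: "set ws \<subseteq> V" and Z: "Z \<in> V" "\<And>f. Z p f = 0"
  shows "F (us @ Z # ws) p = 0"
proof -
  from local_frame[of p] obtain \<eta> where \<eta>: "\<eta> \<in> C" "\<eta> p \<noteq> 0"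
    and ex: "\<exists>(I :: ('e \<times> bool) set) g E. finite I \<and> (\<forall>i\<in>I. g i \<in> C \<and> E i \<in> V) \<and>
     (\<forall>q. \<forall>v\<in>T q. \<forall>f. \<eta> q * v f = (\<Sum>i\<in>I. v (g i) * E i q f))" by (elim bexE conjE)
  from ex obtain I :: "('e \<times> bool) set" and g E where I: "finite I" and gE': "\<forall>i\<in>I. g i \<in> C \<and> E i \<in> V"
    and rep': "\<forall>q. \<forall>v\<in>T q. \<forall>f. \<eta> q * v f = (\<Sum>i\<in>I. v (g i) * E i q f)" by (elim exE conjE)
  have gE: "g i \<in> C" "E i \<in> V" if "i \<in> I" for i using gE' that by auto
  have rep: "\<eta> q * v f = (\<Sum>i\<in>I. v (g i) * E i q f)" if "v \<in> T q" for q v f using rep' that by blast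
  have "\<eta> \<star> Z = (\<Sum>i\<in>I. dd Z (g i) \<star> E i)"
    by (intro ext) (simp add: sum_field_apply smul_def dd_def rep[OF vf_tangent[OF Z(1)]])
  moreover have "F (us @ (\<Sum>i\<in>J. dd Z (g i) \<star> E i) # ws) p = (\<Sum>i\<in>J. dd Z (g i) p * F (us @ E i # ws) p)"
    if "J \<subseteq> I" for J
    using finite_subset[OF that I] that
  proof (induction J)
    case empty
    show "F (us @ (\<Sum>i\<in>{}. dd Z (g i) \<star> E i) # ws) p = (\<Sum>i\<in>{}. dd Z (g i) p * F (us @ E i # ws) p)"
      by (simp only: sum.empty tensor_zero[OF F us ws] zero_fun_apply)
  next
    case (insert j J)
    have "(\<Sum>i\<in>J. dd Z (g i) \<star> E i) \<in> V"
      using insert.prems gE Z by (intro V_sum V_smul C_intros) auto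
    then have "F (us @ (dd Z (g j) \<star> E j + (\<Sum>i\<in>J. dd Z (g i) \<star> E i)) # ws)
        = dd Z (g j) * F (us @ E j # ws) + F (us @ (\<Sum>i\<in>J. dd Z (g i) \<star> E i) # ws)"
      using insert.prems gE Z by (intro tensor_lin F us ws C_intros) auto
    then have "F (us @ (dd Z (g j) \<star> E j + (\<Sum>i\<in>J. dd Z (g i) \<star> E i)) # ws) p
        = dd Z (g j) p * F (us @ E j # ws) p + (\<Sum>i\<in>J. dd Z (g i) p * F (us @ E i # ws) p)"
      using insert.IH insert.prems by (simp only: plus_fun_apply times_fun_apply) simp
    then show "F (us @ (\<Sum>i\<in>insert j J. dd Z (g i) \<star> E i) # ws) p
        = (\<Sum>i\<in>insert j J. dd Z (g i) p * F (us @ E i # ws) p)"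
      by (simp only: sum.insert[OF insert.hyps])
  qed
  moreover have "F (us @ (\<eta> \<star> Z) # ws) p = \<eta> p * F (us @ Z # ws) p"
    using tensor_smul[OF F us ws \<eta>(1) Z(1)] by (simp add: fun_apply)
  ultimately have "\<eta> p * F (us @ Z # ws) p = (\<Sum>i\<in>I. dd Z (g i) p * F (us @ E i # ws) p)" by simp
  then show ?thesis using \<eta>(2) Z(2) by (simp add: dd_def)
qed

text \<open>Entries are exchanged one at a time, each difference of fields being zero at
  \<open>p\<close>.\<close>

lemma tensor_local:
  assumes "tensor F" "set Xs \<subseteq> V" "set Ys \<subseteq> V" "map (\<lambda>X. X p) Xs = map (\<lambda>X. X p) Ys"
  shows "F Xs p = F Ys p"
  using assms
proof (induction Xs arbitrary: F Ys)
  case Nil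
  then show ?case by simp
next
  case (Cons X Xs)
  then obtain Y Ys' where Ys: "Ys = Y # Ys'" "X p = Y p" "map (\<lambda>X. X p) Xs = map (\<lambda>X. X p) Ys'" by (cases Ys) auto
  have XY: "X \<in> V" "Y \<in> V" "set Xs \<subseteq> V" "set Ys' \<subseteq> V" using Cons.prems Ys by auto
  have "contr X F Xs p = contr X F Ys' p"
    by (rule Cons.IH[OF tensor_contr[OF Cons.prems(1) XY(1)] XY(3,4) Ys(3)])
  moreover have "F ([] @ (X - Y) # Ys') p = 0"
    by (rule tensor_vanish[OF Cons.prems(1)]) (use XY Ys(2) in \<open>auto simp: V_diff fun_apply\<close>)
  then have "F (X # Ys') p = F (Y # Ys') p"
    using tensor_diff[OF Cons.prems(1), of "[]" Ys' X Y] XY by (simp add: fun_apply)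
  ultimately show "F (X # Xs) p = F Ys p" by (simp add: Ys(1))
qed

lemma tensor_repeat:
  assumes "tensor F" "set as \<subseteq> V" "set bs \<subseteq> V" "set cs \<subseteq> V" "X \<in> V"
  shows "F (as @ X # bs @ X # cs) = 0"
  using assms(2,3)
proof (induction bs arbitrary: as)
  case Nil
  then show ?case using tensor_alt[OF assms(1) _ assms(4,5)] by simp
next
  case (Cons B bs)
  then have "F (as @ X # B # bs @ X # cs) = - F (as @ B # X # bs @ X # cs)"
    using assms by (intro tensor_swap) auto
  moreover have "F ((as @ [B]) @ X # bs @ X # cs) = 0"
    using Cons.prems by (intro Cons.IH) auto
  ultimately show ?case by simp
qed

text \<open>The inverse of \<open>ev\<close> on tensorial cochains; by \<open>tensor_local\<close>
  the chosen extensions do not affect the value.\<close>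

definition form_of :: "'m cochain \<Rightarrow> 'm form" where
  "form_of F p vs = (if set vs \<subseteq> T p then F (map (extend_tvec A p) vs) p else 0)"

lemma ev_form_of: "tensor F \<Longrightarrow> set Xs \<subseteq> V \<Longrightarrow> ev (form_of F) Xs = F Xs"
proof (rule ext)
  fix p assume F: "tensor F" and Xs: "set Xs \<subseteq> V"
  note t = field_list_tangent[OF Xs, of p]
  have "F (map (extend_tvec A p) (map (\<lambda>X. X p) Xs)) p = F Xs p"
    by (rule tensor_local[OF F extend_list(1)[OF t] Xs extend_list(2)[OF t]])
  then show "ev (form_of F) Xs p = F Xs p" using t by (simp add: ev_apply form_of_def)
qed

lemma form_of_alternating:
  assumes F: "tensor F"
  shows "alternating_multilinear (T p) (form_of F p)"
  unfolding alternating_multilinear_def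
proof (intro conjI allI impI ballI)
  let ?e = "extend_tvec A p"
  fix vs :: "'m tvec list"
  show "\<not> set vs \<subseteq> T p \<Longrightarrow> form_of F p vs = 0" by (simp add: form_of_def)
  assume vs: "set vs \<subseteq> T p" and "\<not> distinct vs"
  then obtain as bs cs y where y: "vs = as @ [y] @ bs @ [y] @ cs" using not_distinct_decomp by blast
  have "F (map ?e as @ ?e y # map ?e bs @ ?e y # map ?e cs) = 0"
    using vs by (intro tensor_repeat[OF F]) (auto simp: y extend_tvec)
  then show "form_of F p vs = 0" by (simp add: form_of_def y fun_apply)
next
  let ?e = "extend_tvec A p"
  fix us ws v w assume v: "v \<in> T p" and w: "w \<in> T p" and us: "set us \<subseteq> T p" and ws: "set ws \<subseteq> T p"
  have V: "set (map ?e us) \<subseteq> V" "set (map ?e ws) \<subseteq> V" "?e v \<in> V" "?e w \<in> V"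
    using extend_list(1) us ws extend_tvec(1) v w by auto
  have "F (map ?e us @ ?e (\<lambda>f. v f + w f) # map ?e ws) p = F (map ?e us @ (?e v + ?e w) # map ?e ws) p"
    by (rule tensor_local[OF F])
      (use V v w in \<open>auto simp: extend_tvec tangent_add V_add fun_apply fun_eq_iff\<close>)
  also have "\<dots> = F (map ?e us @ ?e v # map ?e ws) p + F (map ?e us @ ?e w # map ?e ws) p"
    using tensor_add[OF F V] by (simp add: fun_apply)
  finally show "form_of F p (us @ (\<lambda>f. v f + w f) # ws) = form_of F p (us @ v # ws) + form_of F p (us @ w # ws)"
    using us ws v w by (simp add: form_of_def tangent_add)
next
  let ?e = "extend_tvec A p"
  fix us ws v c assume v: "v \<in> T p" and us: "set us \<subseteq> T p" and ws: "set ws \<subseteq> T p"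
  have V: "set (map ?e us) \<subseteq> V" "set (map ?e ws) \<subseteq> V" "?e v \<in> V"
    using extend_list(1) us ws extend_tvec(1) v by auto
  have "F (map ?e us @ ?e (\<lambda>f. c * v f) # map ?e ws) p = F (map ?e us @ ((\<lambda>_. c) \<star> ?e v) # map ?e ws) p"
  proof (rule tensor_local[OF F])
    have "((\<lambda>_. c) \<star> ?e v) p = ?e (\<lambda>f. c * v f) p"
      using v by (simp add: extend_tvec tangent_scale smul_def)
    then show "map (\<lambda>X. X p) (map ?e us @ ?e (\<lambda>f. c * v f) # map ?e ws)
        = map (\<lambda>X. X p) (map ?e us @ ((\<lambda>_. c) \<star> ?e v) # map ?e ws)" by simp
  qed (use V V_smul[OF sf_const[of c] V(3)] extend_tvec(1)[OF tangent_scale[OF v]] in auto)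
  also have "\<dots> = c * F (map ?e us @ ?e v # map ?e ws) p"
    using tensor_smul[OF F V(1,2) sf_const V(3), of c] by (simp add: fun_apply)
  finally show "form_of F p (us @ (\<lambda>f. c * v f) # ws) = c * form_of F p (us @ v # ws)"
    using us ws v by (simp add: form_of_def tangent_scale)
qed

lemma form_of_diff_forms: "tensor F \<Longrightarrow> form_of F \<in> diff_forms A"
  using form_of_alternating ev_form_of smoothcD[OF tensor_smoothc]
  by (simp add: diff_forms_def ev_def[symmetric, abs_def])

lemma diff_forms_off: "\<omega> \<in> diff_forms A \<Longrightarrow> \<not> set vs \<subseteq> T p \<Longrightarrow> \<omega> p vs = 0"
  using alternating_multilinearD(1)[of "T p" "\<omega> p" vs] by (simp add: diff_forms_def)

lemma tensor_ev:
  assumes "\<omega> \<in> diff_forms A"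
  shows "tensor (ev \<omega>)"
proof (rule tensorI)
  have alt: "alternating_multilinear (T p) (\<omega> p)" for p using assms by (simp add: diff_forms_def)
  show "smoothc (ev \<omega>)"
    using assms by (auto simp: smoothc_def diff_forms_def ev_def)
  fix us ws and X assume us: "set us \<subseteq> V" and ws: "set ws \<subseteq> V" and X: "X \<in> V"
  show "ev \<omega> (us @ X # X # ws) = 0"
  proof (rule ext)
    fix p
    have "set (map (\<lambda>X. X p) (us @ X # X # ws)) \<subseteq> T p"
      by (rule field_list_tangent) (use us ws X in auto)
    moreover have "\<not> distinct (map (\<lambda>X. X p) (us @ X # X # ws))" by simp
    ultimately have "\<omega> p (map (\<lambda>X. X p) (us @ X # X # ws)) = 0"
      by (rule alternating_multilinearD(4)[OF alt])
    then show "ev \<omega> (us @ X # X # ws) p = 0 p" by (simp add: ev_apply fun_apply)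
  qed
next
  have alt: "alternating_multilinear (T p) (\<omega> p)" for p using assms by (simp add: diff_forms_def)
  fix us ws and f :: "'m \<Rightarrow> real" and X Y
  assume us: "set us \<subseteq> V" and ws: "set ws \<subseteq> V" and f: "f \<in> C" and XY: "X \<in> V" "Y \<in> V"
  show "ev \<omega> (us @ (f \<star> X + Y) # ws) = f * ev \<omega> (us @ X # ws) + ev \<omega> (us @ Y # ws)"
  proof (rule ext)
    fix p
    let ?u = "map (\<lambda>X. X p) us" and ?w = "map (\<lambda>X. X p) ws"
    note t = field_list_tangent[OF us, of p] field_list_tangent[OF ws, of p]
      vf_tangent[OF XY(1), of p] vf_tangent[OF XY(2), of p]
    have "\<omega> p (?u @ (\<lambda>h. (\<lambda>h. f p * X p h) h + Y p h) # ?w) = \<omega> p (?u @ (\<lambda>h. f p * X p h) # ?w) + \<omega> p (?u @ Y p # ?w)"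
      by (rule alternating_multilinearD(2)[OF alt tangent_scale[OF t(3)] t(4,1,2)])
    moreover have "\<omega> p (?u @ (\<lambda>h. f p * X p h) # ?w) = f p * \<omega> p (?u @ X p # ?w)"
      by (rule alternating_multilinearD(3)[OF alt t(3,1,2)])
    moreover have "(f \<star> X + Y) p = (\<lambda>h. f p * X p h + Y p h)"
      by (simp add: fun_eq_iff fun_apply smul_def)
    ultimately show "ev \<omega> (us @ (f \<star> X + Y) # ws) p = (f * ev \<omega> (us @ X # ws) + ev \<omega> (us @ Y # ws)) p"
      by (simp add: ev_apply fun_apply)
  qed
qed

text \<open>Every list of tangent vectors at a point consists of values of global fields, so
  evaluation on fields loses nothing there.\<close>

lemma form_eqI:
  assumes "\<And>p vs. \<not> set vs \<subseteq> T p \<Longrightarrow> \<alpha> p vs = 0" "\<And>p vs. \<not> set vs \<subseteq> T p \<Longrightarrow> \<beta> p vs = 0"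
    and "\<And>Xs. set Xs \<subseteq> V \<Longrightarrow> ev \<alpha> Xs = ev \<beta> Xs"
  shows "\<alpha> = \<beta>"
proof (intro ext)
  fix p vs
  show "\<alpha> p vs = \<beta> p vs"
  proof (cases "set vs \<subseteq> T p")
    case True
    show ?thesis
      using fun_cong[OF assms(3)[OF extend_list(1)[OF True]], of p] extend_list(2)[OF True]
      by (simp only: ev_apply)
  qed (simp add: assms(1,2))
qed

lemma form_of_off: "\<not> set vs \<subseteq> T p \<Longrightarrow> form_of F p vs = 0"
  by (simp add: form_of_def)

end

subsection \<open>The wedge product\<close>

text \<open>The point is fixed, and the evaluations \<open>a\<close> and \<open>b\<close> are
  arbitrary functions of lists, so that they can absorb the contractions and signs created by the
  recursion of \<open>wdg\<close>.\<close>

lemma ev_wedge_aux: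
  assumes "\<And>Us. F Us p = a (map (\<lambda>X. X p) Us)" "\<And>Us. G Us p = b (map (\<lambda>X. X p) Us)"
  shows "wdg F G Xs p = full_shuffle_sum (\<lambda>us ws. a us * b ws) (map (\<lambda>X. X p) Xs)"
  using assms
proof (induction Xs arbitrary: F G a b)
  case Nil
  then show ?case by (simp add: full_shuffle_sum_def shuffle_sum_0 fun_apply)
next
  case (Cons X Xs)
  have "wdg (contr X F) G Xs p = full_shuffle_sum (\<lambda>us ws. a (X p # us) * b ws) (map (\<lambda>X. X p) Xs)"
    by (rule Cons.IH[where a="\<lambda>us. a (X p # us)"]) (simp_all add: Cons.prems)
  moreover have "wdg (bar F) (contr X G) Xs p
      = full_shuffle_sum (\<lambda>us ws. ((-1) ^ length us * a us) * b (X p # ws)) (map (\<lambda>X. X p) Xs)"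
  proof (rule Cons.IH[where a="\<lambda>us. (-1) ^ length us * a us" and b="\<lambda>ws. b (X p # ws)"])
    have "((-1) ^ n * f) p = (-1) ^ n * f p" for n and f :: "'a \<Rightarrow> real"
      by (induction n) (simp_all add: fun_apply)
    then show "bar F Us p = (-1) ^ length (map (\<lambda>X. X p) Us) * a (map (\<lambda>X. X p) Us)" for Us
      by (simp add: bar_apply Cons.prems)
  qed (simp add: Cons.prems)
  ultimately show "wdg F G (X # Xs) p = full_shuffle_sum (\<lambda>us ws. a us * b ws) (map (\<lambda>X. X p) (X # Xs))"
    by (simp add: wdg_Cons full_shuffle_sum_Cons fun_apply mult.assoc)
qed

lemma wedge_full_shuffle_sum: "wedge \<alpha> \<beta> p zs = full_shuffle_sum (\<lambda>us ws. \<alpha> p us * \<beta> p ws) zs"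
  by (auto simp: wedge_def full_shuffle_sum_def shuffle_sum_def Let_def mult.assoc intro!: sum.cong)

lemma ev_wedge: "ev (wedge \<alpha> \<beta>) Xs = wdg (ev \<alpha>) (ev \<beta>) Xs"
  by (rule ext) (simp add: ev_apply wedge_full_shuffle_sum ev_wedge_aux[of "ev \<alpha>" _ "\<alpha> _" "ev \<beta>" "\<beta> _"])

context smooth_manifold begin

lemma shuffle_sum_off:
  assumes "k + l = length zs" "\<not> set zs \<subseteq> S"
    and "\<And>us ws. length us = k \<Longrightarrow> \<not> set us \<subseteq> S \<or> \<not> set ws \<subseteq> S \<Longrightarrow> h us ws = (0::real)"
  shows "shuffle_sum k l h zs = 0"
  unfolding shuffle_sum_def
proof (rule sum.neutral, rule ballI)
  fix \<sigma> assume s: "\<sigma> \<in> unshuffles k l"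
  note p = unshufflesD(1)[OF s]
  obtain z where "z \<in> set zs" "z \<notin> S" using assms(2) by blast
  then obtain i where i: "i < length zs" "zs ! i \<notin> S" by (metis in_set_conv_nth)
  obtain j where j: "\<sigma> j = i" using surjD[OF permutes_surj[OF p], of i] by auto
  have "j < k + l" using permutes_in_image[OF p, of j] j i(1) assms(1) by simp
  then have "\<not> set (map (\<lambda>i. zs ! \<sigma> i) [0..<k]) \<subseteq> S \<or> \<not> set (map (\<lambda>i. zs ! \<sigma> i) [k..<k + l]) \<subseteq> S"
    using j i(2) by (cases "j < k") (auto simp: image_subset_iff)
  then show "of_int (sign \<sigma>) * h (map (\<lambda>i. zs ! \<sigma> i) [0..<k]) (map (\<lambda>i. zs ! \<sigma> i) [k..<k + l]) = 0"
    by (subst assms(3)) auto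
qed

lemma wedge_off:
  assumes "\<And>vs. \<not> set vs \<subseteq> T p \<Longrightarrow> \<alpha> p vs = 0" "\<And>vs. \<not> set vs \<subseteq> T p \<Longrightarrow> \<beta> p vs = 0" "\<not> set zs \<subseteq> T p"
  shows "wedge \<alpha> \<beta> p zs = 0"
  unfolding wedge_full_shuffle_sum full_shuffle_sum_def
  by (rule sum.neutral, rule ballI, rule shuffle_sum_off[OF _ assms(3)]) (use assms(1,2) in auto)

lemma tensor_bar: "tensor F \<Longrightarrow> tensor (bar F)"
proof (rule tensorI)
  assume F: "tensor F"
  show "smoothc (bar F)" by (rule bar_smoothc[OF tensor_smoothc[OF F]])
next
  fix us ws X assume F: "tensor F" and "set us \<subseteq> V" "set ws \<subseteq> V" "X \<in> V"
  then show "bar F (us @ X # X # ws) = 0" using tensor_alt[OF F] by (simp add: bar_apply)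
next
  fix us ws f X Y assume F: "tensor F" and "set us \<subseteq> V" "set ws \<subseteq> V" "f \<in> C" "X \<in> V" "Y \<in> V"
  then show "bar F (us @ (f \<star> X + Y) # ws) = f * bar F (us @ X # ws) + bar F (us @ Y # ws)"
    using tensor_lin[OF F, of us ws f X Y] by (simp add: bar_apply algebra_simps)
qed

lemma wdg_cmul_add_left: "wdg (cmul f F + F') G Xs = f * wdg F G Xs + wdg F' G Xs"
proof (induction Xs arbitrary: F F' G)
  case (Cons X Xs)
  have "bar (cmul f F + F') = cmul f (bar F) + bar F'"
    by (rule ext) (simp add: bar_apply algebra_simps)
  moreover have "wdg (cmul f (contr X F) + contr X F') G Xs = f * wdg (contr X F) G Xs + wdg (contr X F') G Xs"
    "wdg (cmul f (bar F) + bar F') (contr X G) Xs = f * wdg (bar F) (contr X G) Xs + wdg (bar F') (contr X G) Xs"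
    by (rule Cons.IH)+
  ultimately show "wdg (cmul f F + F') G (X # Xs) = f * wdg F G (X # Xs) + wdg F' G (X # Xs)"
    by (simp add: wdg_Cons algebra_simps)
qed (simp add: algebra_simps)

lemma wdg_cmul_add_right: "wdg F (cmul f G + G') Xs = f * wdg F G Xs + wdg F G' Xs"
proof (induction Xs arbitrary: F G G')
  case (Cons X Xs)
  have "wdg (contr X F) (cmul f G + G') Xs = f * wdg (contr X F) G Xs + wdg (contr X F) G' Xs"
    "wdg (bar F) (cmul f (contr X G) + contr X G') Xs = f * wdg (bar F) (contr X G) Xs + wdg (bar F) (contr X G') Xs"
    by (rule Cons.IH)+
  then show "wdg F (cmul f G + G') (X # Xs) = f * wdg F G (X # Xs) + wdg F G' (X # Xs)"
    by (simp add: wdg_Cons algebra_simps)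
qed (simp add: algebra_simps)

lemma wdg_zero_right: "wdg F 0 Xs = 0"
  using wdg_diff_right[of F 0 0 Xs] by simp

lemma tensor_wdg:
  assumes "tensor F" "tensor G"
  shows "tensor (wdg F G)"
proof (rule tensorI)
  show "smoothc (wdg F G)" by (rule wdg_smoothc[OF tensor_smoothc[OF assms(1)] tensor_smoothc[OF assms(2)]])
next
  fix us ws X assume us: "set us \<subseteq> V" and ws: "set ws \<subseteq> V" and X: "X \<in> V"
  show "wdg F G (us @ X # X # ws) = 0"
    using us assms
  proof (induction us arbitrary: F G)
    case Nil
    have "wdg (contr X (contr X F)) G ws = wdg 0 G ws"
      using tensor_alt[OF Nil(2), of "[]" _ X] X by (intro wdg_cong ws) auto
    moreover have "wdg F (contr X (contr X G)) ws = wdg F 0 ws"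
      using tensor_alt[OF Nil(3), of "[]" _ X] X by (intro wdg_cong ws) auto
    \<comment> \<open>The two mixed terms pair \<open>contr X F\<close> with
      \<open>contr X G\<close>; they cancel because \<open>contr X\<close> and \<open>bar\<close>
      anticommute.\<close>
    ultimately show "wdg F G ([] @ X # X # ws) = 0"
      by (simp add: wdg_Cons contr_bar wdg_minus_left bar_bar bar_minus wdg_zero_left wdg_zero_right)
  next
    case (Cons U us)
    then have U: "U \<in> V" "set us \<subseteq> V" by auto
    have "wdg (contr U F) G (us @ X # X # ws) = 0" "wdg (bar F) (contr U G) (us @ X # X # ws) = 0"
      by (rule Cons.IH[OF U(2) tensor_contr[OF Cons.prems(2) U(1)] Cons.prems(3)],
          rule Cons.IH[OF U(2) tensor_bar[OF Cons.prems(2)] tensor_contr[OF Cons.prems(3) U(1)]])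
    then show "wdg F G ((U # us) @ X # X # ws) = 0" by (simp add: wdg_Cons)
  qed
next
  fix us ws f X Y assume us: "set us \<subseteq> V" and ws: "set ws \<subseteq> V" and f: "f \<in> C" and XY: "X \<in> V" "Y \<in> V"
  show "wdg F G (us @ (f \<star> X + Y) # ws) = f * wdg F G (us @ X # ws) + wdg F G (us @ Y # ws)"
    using us assms
  proof (induction us arbitrary: F G)
    case Nil
    have "wdg (contr (f \<star> X + Y) F) G ws = wdg (cmul f (contr X F) + contr Y F) G ws"
      using tensor_lin[OF Nil(2), of "[]" _ f X Y] f XY by (intro wdg_cong ws) auto
    moreover have "wdg (bar F) (contr (f \<star> X + Y) G) ws = wdg (bar F) (cmul f (contr X G) + contr Y G) ws"
      using tensor_lin[OF Nil(3), of "[]" _ f X Y] f XY by (intro wdg_cong ws) auto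
    ultimately show "wdg F G ([] @ (f \<star> X + Y) # ws) = f * wdg F G ([] @ X # ws) + wdg F G ([] @ Y # ws)"
      by (simp only: append_Nil wdg_Cons wdg_cmul_add_left wdg_cmul_add_right) (simp add: algebra_simps)
  next
    case (Cons U us)
    then have U: "U \<in> V" "set us \<subseteq> V" by auto
    have "wdg (contr U F) G (us @ (f \<star> X + Y) # ws) = f * wdg (contr U F) G (us @ X # ws) + wdg (contr U F) G (us @ Y # ws)"
      "wdg (bar F) (contr U G) (us @ (f \<star> X + Y) # ws) = f * wdg (bar F) (contr U G) (us @ X # ws) + wdg (bar F) (contr U G) (us @ Y # ws)"
      by (rule Cons.IH[OF U(2) tensor_contr[OF Cons.prems(2) U(1)] Cons.prems(3)],
          rule Cons.IH[OF U(2) tensor_bar[OF Cons.prems(2)] tensor_contr[OF Cons.prems(3) U(1)]])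
    then show "wdg F G ((U # us) @ (f \<star> X + Y) # ws) = f * wdg F G ((U # us) @ X # ws) + wdg F G ((U # us) @ Y # ws)"
      by (simp only: append_Cons wdg_Cons) (simp add: algebra_simps)
  qed
qed

end

subsection \<open>Insertions\<close>

definition ins_sum :: "nat \<Rightarrow> ('a list \<Rightarrow> 'a list \<Rightarrow> real) \<Rightarrow> 'a list \<Rightarrow> real" where
  "ins_sum k h zs = (if length zs < k then 0 else shuffle_sum k (length zs - k) h zs)"

lemma ins_sum_0: "ins_sum 0 h zs = h [] zs"
  by (simp add: ins_sum_def shuffle_sum_0)

lemma ins_sum_Cons: "ins_sum (Suc k) h (z # zs) =
    ins_sum k (\<lambda>us ws. h (z # us) ws) zs + (-1) ^ Suc k * ins_sum (Suc k) (\<lambda>us ws. h us (z # ws)) zs"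
proof (cases "length zs < k")
  case False
  then have "Suc k + (length zs - k) = Suc (length zs)" by simp
  from shuffle_sum_Cons[OF this, of h z] False show ?thesis
    by (auto simp: ins_sum_def not_less less_Suc_eq_le Suc_le_eq)
qed (simp add: ins_sum_def)

lemma ins_sum_minus: "ins_sum k (\<lambda>us ws. - h us ws) zs = - ins_sum k h zs"
  by (simp add: ins_sum_def shuffle_sum_minus)

lemma insertion_ins_sum: "insertion k K \<omega> x zs = ins_sum (Suc k) (\<lambda>us ws. \<omega> x (K x us # ws)) zs"
proof (cases "length zs < Suc k")
  case False
  then have "Suc k + (length zs - Suc k) = length zs" by simp
  then show ?thesis using False
    by (simp only: insertion_def ins_sum_def shuffle_sum_def Let_def Suc_eq_plus1 if_False)
qed (simp add: insertion_def ins_sum_def)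

context smooth_manifold begin

text \<open>Moving the inserted vector past the first argument changes the sign; \<open>a'\<close> absorbs this sign, so
  that the recursion of the shuffle sum becomes the recursion of the cochain operator.\<close>

lemma swapped_evaluation:
  assumes F: "tensor F" and a: "\<And>Us. set Us \<subseteq> V \<Longrightarrow> F Us p = a (map (\<lambda>X. X p) Us)" and X: "X \<in> V"
  defines "a' \<equiv> \<lambda>l. case l of [] \<Rightarrow> a [X p] | u # ws \<Rightarrow> - a (u # X p # ws)"
  shows "set Us \<subseteq> V \<Longrightarrow> contr X F Us p = a' (map (\<lambda>X. X p) Us)"
proof (cases Us)
  case Nil
  then show ?thesis using a[of "[X]"] X by (simp add: a'_def)
next
  case (Cons U Ws)
  assume "set Us \<subseteq> V"
  then have U: "U \<in> V" "set Ws \<subseteq> V" using Cons by auto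
  have "F (X # U # Ws) p = - F (U # X # Ws) p"
    using tensor_swap[OF F, of "[]" Ws X U] U X by (simp add: fun_apply)
  then show ?thesis using a[of "U # X # Ws"] U X by (simp add: a'_def Cons)
qed

text \<open>Inserting an endomorphism replaces each argument in turn by its image, a derivation with
  zero symbol; \<open>cder\<close> subtracts its action on fields, hence \<open>- K\<close>.\<close>

lemma ins_sum_1:
  assumes "tensor F" "\<And>Us. set Us \<subseteq> V \<Longrightarrow> F Us p = a (map (\<lambda>X. X p) Us)" "set Xs \<subseteq> V"
    and K: "\<And>Y. Y \<in> V \<Longrightarrow> K Y \<in> V" "\<And>Y. Y \<in> V \<Longrightarrow> K Y p = b [Y p]"
  shows "ins_sum (Suc 0) (\<lambda>us ws. a (b us # ws)) (map (\<lambda>X. X p) Xs) = cder 0 (\<lambda>X. - K X) F Xs p"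
  using assms(1-3)
proof (induction Xs arbitrary: F a)
  case Nil
  show "ins_sum (Suc 0) (\<lambda>us ws. a (b us # ws)) (map (\<lambda>X. X p) []) = cder 0 (\<lambda>X. - K X) F [] p"
    by (simp add: ins_sum_def zero_fun_apply)
next
  case (Cons X Xs)
  then have X: "X \<in> V" "set Xs \<subseteq> V" by auto
  note F = Cons.prems(1) and a = Cons.prems(2)
  let ?a' = "\<lambda>l. case l of [] \<Rightarrow> a [X p] | u # ws \<Rightarrow> - a (u # X p # ws)"
  have "ins_sum (Suc 0) (\<lambda>us ws. ?a' (b us # ws)) (map (\<lambda>X. X p) Xs) = cder 0 (\<lambda>X. - K X) (contr X F) Xs p"
    by (rule Cons.IH[of "contr X F" ?a', OF tensor_contr[OF F X(1)] swapped_evaluation[OF F a X(1)] X(2)])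
  then have 1: "ins_sum (Suc 0) (\<lambda>us ws. a (b us # X p # ws)) (map (\<lambda>X. X p) Xs) = - cder 0 (\<lambda>X. - K X) (contr X F) Xs p"
    by (simp add: ins_sum_minus)
  have 2: "F ((- K X) # Xs) p = - a (b [X p] # map (\<lambda>X. X p) Xs)"
    using tensor_minus[OF F, of "[]" Xs "K X"] a[of "K X # Xs"] K X by (simp add: fun_apply)
  show "ins_sum (Suc 0) (\<lambda>us ws. a (b us # ws)) (map (\<lambda>X. X p) (X # Xs)) = cder 0 (\<lambda>X. - K X) F (X # Xs) p"
    by (simp add: ins_sum_Cons ins_sum_0 1 2 fun_apply)
qed

text \<open>A shuffle with the head \<open>X\<close> in its first block inserts the endomorphism
  \<open>K X\<close>, which is the Lie derivative term of Cartan's formula; all others give minus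
  the contraction term. Insertion of a 2-form is thus a differential with zero anchor.\<close>

lemma ins_sum_2:
  assumes "tensor F" "\<And>Us. set Us \<subseteq> V \<Longrightarrow> F Us p = a (map (\<lambda>X. X p) Us)" "set Xs \<subseteq> V"
    and K: "\<And>Y Z. Y \<in> V \<Longrightarrow> Z \<in> V \<Longrightarrow> K Y Z \<in> V" "\<And>Y Z. Y \<in> V \<Longrightarrow> Z \<in> V \<Longrightarrow> K Y Z p = b [Y p, Z p]"
  shows "ins_sum (Suc (Suc 0)) (\<lambda>us ws. a (b us # ws)) (map (\<lambda>X. X p) Xs) = dif (\<lambda>_. 0) (\<lambda>X Y. - K X Y) F Xs p"
  using assms(1-3)
proof (induction Xs arbitrary: F a)
  case Nil
  then show ?case by (simp add: ins_sum_def fun_apply)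
next
  case (Cons X Xs)
  then have X: "X \<in> V" "set Xs \<subseteq> V" by auto
  note F = Cons.prems(1) and a = Cons.prems(2)
  let ?a' = "\<lambda>l. case l of [] \<Rightarrow> a [X p] | u # ws \<Rightarrow> - a (u # X p # ws)"
  have "ins_sum (Suc (Suc 0)) (\<lambda>us ws. ?a' (b us # ws)) (map (\<lambda>X. X p) Xs) = dif (\<lambda>_. 0) (\<lambda>X Y. - K X Y) (contr X F) Xs p"
    by (rule Cons.IH[of "contr X F" ?a', OF tensor_contr[OF F X(1)] swapped_evaluation[OF F a X(1)] X(2)])
  then have 1: "ins_sum (Suc (Suc 0)) (\<lambda>us ws. a (b us # X p # ws)) (map (\<lambda>X. X p) Xs)
      = - dif (\<lambda>_. 0) (\<lambda>X Y. - K X Y) (contr X F) Xs p"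
    by (simp add: ins_sum_minus)
  have 2: "ins_sum (Suc 0) (\<lambda>us ws. a (b (X p # us) # ws)) (map (\<lambda>X. X p) Xs) = cder 0 (\<lambda>Y. - K X Y) F Xs p"
    by (rule ins_sum_1[OF F a X(2), where b="\<lambda>us. b (X p # us)"]) (use K X in auto)
  show "ins_sum (Suc (Suc 0)) (\<lambda>us ws. a (b us # ws)) (map (\<lambda>X. X p) (X # Xs)) = dif (\<lambda>_. 0) (\<lambda>X Y. - K X Y) F (X # Xs) p"
    by (simp add: ins_sum_Cons 1 2 fun_apply)
qed

lemma insertion_off:
  assumes \<omega>: "\<omega> \<in> diff_forms A" and K: "\<And>us. \<not> set us \<subseteq> T p \<Longrightarrow> K p us = (\<lambda>f. 0)"
    and zs: "\<not> set zs \<subseteq> T p"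
  shows "insertion k K \<omega> p zs = 0"
  unfolding insertion_ins_sum ins_sum_def
proof (simp, intro impI, rule shuffle_sum_off[OF _ zs])
  have alt: "alternating_multilinear (T p) (\<omega> p)" using \<omega> by (simp add: diff_forms_def)
  fix us ws :: "'m tvec list" assume "\<not> set us \<subseteq> T p \<or> \<not> set ws \<subseteq> T p"
  then show "\<omega> p (K p us # ws) = 0"
  proof (cases "set ws \<subseteq> T p")
    case True
    then have "K p us = (\<lambda>f. 0)" using K \<open>\<not> set us \<subseteq> T p \<or> \<not> set ws \<subseteq> T p\<close> by blast
    then show ?thesis
      using alternating_multilinearD(3)[OF alt tangent_zero, of "[]" ws 0] True by simp
  qed (simp add: diff_forms_off[OF \<omega>])
qed simp

lemma diff_formsI:
  assumes "tensor (ev \<omega>)" "\<And>p vs. \<not> set vs \<subseteq> T p \<Longrightarrow> \<omega> p vs = 0"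
  shows "\<omega> \<in> diff_forms A"
proof -
  have "\<omega> = form_of (ev \<omega>)"
    by (rule form_eqI) (simp_all add: assms form_of_off ev_form_of)
  then show ?thesis using form_of_diff_forms[OF assms(1)] by simp
qed

end

subsection \<open>The Koszul formula\<close>

lemma nths_Cons_omit:
  "nths (x # xs) (- {0}) = xs" "nths (x # xs) (- {Suc i}) = x # nths xs (- {i})"
  "nths (x # xs) (- {0, Suc j}) = nths xs (- {j})"
  "nths (x # xs) (- {Suc i, Suc j}) = x # nths xs (- {i, j})"
proof -
  have "{j. Suc j \<in> - {0}} = UNIV" "{j. Suc j \<in> - {Suc i}} = - {i}"
    "{i. Suc i \<in> - {0, Suc j}} = - {j}" "{k. Suc k \<in> - {Suc i, Suc j}} = - {i, j}" by auto
  then show "nths (x # xs) (- {0}) = xs" "nths (x # xs) (- {Suc i}) = x # nths xs (- {i})"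
    "nths (x # xs) (- {0, Suc j}) = nths xs (- {j})"
    "nths (x # xs) (- {Suc i, Suc j}) = x # nths xs (- {i, j})"
    by (simp_all add: nths_Cons nths_all)
qed

context smooth_manifold begin

lemma omit_V: "set Xs \<subseteq> V \<Longrightarrow> set (nths Xs I) \<subseteq> V"
  using set_nths_subset[of Xs I] by blast

lemma nth_V: "set Xs \<subseteq> V \<Longrightarrow> i < length Xs \<Longrightarrow> Xs ! i \<in> V"
  using nth_mem by blast

text \<open>\<open>cder\<close> changes an argument in its place, while the Koszul formula puts it
  in front; moving it past \<open>j\<close> entries costs \<open>(-1) ^ j\<close>.\<close>

lemma cder_omit_sum:
  assumes "tensor F" "set Xs \<subseteq> V" and B: "\<And>X. X \<in> V \<Longrightarrow> B X \<in> V"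
  shows "cder 0 B F Xs p = - (\<Sum>j<length Xs. (-1) ^ j * F (B (Xs ! j) # nths Xs (- {j})) p)"
  using assms(1,2)
proof (induction Xs arbitrary: F)
  case Nil
  show "cder 0 B F [] p = - (\<Sum>j<length []. (-1) ^ j * F (B ([] ! j) # nths [] (- {j})) p)"
    by (simp add: zero_fun_apply)
next
  case (Cons X Xs)
  then have X: "X \<in> V" "set Xs \<subseteq> V" by auto
  have sw: "F (B (Xs ! j) # X # nths Xs (- {j})) p = - F (X # B (Xs ! j) # nths Xs (- {j})) p" if "j < length Xs" for j
    using tensor_swap[OF Cons.prems(1), of "[]" "nths Xs (- {j})" "B (Xs ! j)" X]
    by (simp add: X omit_V B nth_V[OF X(2) that] fun_apply)
  have IH: "cder 0 B (contr X F) Xs p = - (\<Sum>j<length Xs. (-1) ^ j * contr X F (B (Xs ! j) # nths Xs (- {j})) p)"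
    by (rule Cons.IH[OF tensor_contr[OF Cons.prems(1) X(1)] X(2)])
  have "(\<Sum>j<length (X # Xs). (-1) ^ j * F (B ((X # Xs) ! j) # nths (X # Xs) (- {j})) p)
      = F (B X # Xs) p + (\<Sum>j<length Xs. (-1) ^ j * F (X # B (Xs ! j) # nths Xs (- {j})) p)"
    unfolding list.size add_0_right add_Suc_right sum.lessThan_Suc_shift
    by (simp add: nths_Cons_omit sw)
  then show "cder 0 B F (X # Xs) p = - (\<Sum>j<length (X # Xs). (-1) ^ j * F (B ((X # Xs) ! j) # nths (X # Xs) (- {j})) p)"
    by (simp add: IH fun_apply)
qed

lemma cder_split: "cder R B F Xs = dd R (F Xs) + cder 0 B F Xs"
  by (induction Xs arbitrary: F) simp_all

text \<open>The terms in which the first field differentiates or enters the bracket make up L_X, and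
  the remaining ones are minus the Koszul formula of the contraction with \<open>X\<close>.
  Tensoriality of \<open>ev \<omega>\<close> is the hypothesis that survives this
  contraction.\<close>

lemma koszul_dif:
  assumes "tensor (ev \<omega>)" "set Xs \<subseteq> V"
  shows "koszul \<omega> Xs p = dif (\<lambda>X. X) lie_bracket (ev \<omega>) Xs p"
  using assms
proof (induction Xs arbitrary: \<omega>)
  case Nil
  then show ?case by (simp add: koszul_def fun_apply)
next
  case (Cons X Xs)
  then have X: "X \<in> V" "set Xs \<subseteq> V" by auto
  note F = Cons.prems(1)
  define \<omega>' where "\<omega>' = (\<lambda>p vs. \<omega> p (X p # vs))"
  have c: "contr X (ev \<omega>) = ev \<omega>'" by (rule ext) (simp add: ev_def \<omega>'_def)
  let ?n = "length Xs"
  let ?o = "\<lambda>j. nths Xs (- {j})"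
  have koszul_ev: "koszul \<omega> Xs p =
     (\<Sum>i<length Xs. (-1) ^ i * (Xs ! i) p (ev \<omega> (nths Xs (- {i})))) +
     (\<Sum>j<length Xs. \<Sum>i<j. (-1) ^ (i + j) * ev \<omega> (lie_bracket (Xs ! i) (Xs ! j) # nths Xs (- {i, j})) p)" for \<omega> Xs
    by (simp add: koszul_def ev_def)
  have 1: "(\<Sum>i<Suc ?n. (-1) ^ i * ((X # Xs) ! i) p (ev \<omega> (nths (X # Xs) (- {i}))))
      = X p (ev \<omega> Xs) - (\<Sum>i<?n. (-1) ^ i * (Xs ! i) p (ev \<omega>' (?o i)))"
    unfolding sum.lessThan_Suc_shift by (simp add: nths_Cons_omit c[symmetric] sum_negf)
  have sw: "ev \<omega> (lie_bracket (Xs ! i) (Xs ! j) # X # nths Xs (- {i, j})) p = - ev \<omega>' (lie_bracket (Xs ! i) (Xs ! j) # nths Xs (- {i, j})) p"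
    if "j < ?n" "i < j" for i j
    using tensor_swap[OF F, of "[]" "nths Xs (- {i, j})" "lie_bracket (Xs ! i) (Xs ! j)" X] that
    by (simp add: X omit_V V_lie_bracket nth_V[OF X(2)] fun_apply c[symmetric])
  have 2: "(\<Sum>j<Suc ?n. \<Sum>i<j. (-1) ^ (i + j) * ev \<omega> (lie_bracket ((X # Xs) ! i) ((X # Xs) ! j) # nths (X # Xs) (- {i, j})) p)
      = - (\<Sum>j<?n. (-1) ^ j * ev \<omega> (lie_bracket X (Xs ! j) # ?o j) p)
        - (\<Sum>j<?n. \<Sum>i<j. (-1) ^ (i + j) * ev \<omega>' (lie_bracket (Xs ! i) (Xs ! j) # nths Xs (- {i, j})) p)"
    (is "_ = - ?P - ?Q")
  proof -
    have "(\<Sum>j<Suc ?n. \<Sum>i<j. (-1) ^ (i + j) * ev \<omega> (lie_bracket ((X # Xs) ! i) ((X # Xs) ! j) # nths (X # Xs) (- {i, j})) p)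
      = (\<Sum>j<?n. - ((-1) ^ j * ev \<omega> (lie_bracket X (Xs ! j) # ?o j) p)
          + - (\<Sum>i<j. (-1) ^ (i + j) * ev \<omega>' (lie_bracket (Xs ! i) (Xs ! j) # nths Xs (- {i, j})) p))"
    proof -
      have "(\<Sum>i<j. (-1) ^ (i + j) * ev \<omega> (lie_bracket (Xs ! i) (Xs ! j) # X # nths Xs (- {i, j})) p)
          = - (\<Sum>i<j. (-1) ^ (i + j) * ev \<omega>' (lie_bracket (Xs ! i) (Xs ! j) # nths Xs (- {i, j})) p)" if "j < ?n" for j
        unfolding sum_negf[symmetric] by (rule sum.cong) (simp_all add: sw[OF that])
      then show ?thesis
        unfolding sum.lessThan_Suc_shift by (simp add: nths_Cons_omit)
    qed
    then show ?thesis by (simp only: sum.distrib sum_negf diff_conv_add_uminus)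
  qed
  have "koszul \<omega> (X # Xs) p = X p (ev \<omega> Xs) - ?P - koszul \<omega>' Xs p"
    unfolding koszul_ev list.size add_0_right add_Suc_right 1 2 by simp
  also have "?P = - cder 0 (lie_bracket X) (ev \<omega>) Xs p"
    using cder_omit_sum[OF F X(2), of "lie_bracket X" p] V_lie_bracket[OF X(1)] by simp
  also have "koszul \<omega>' Xs p = dif (\<lambda>X. X) lie_bracket (contr X (ev \<omega>)) Xs p"
    unfolding c by (rule Cons.IH[OF _ X(2)]) (use tensor_contr[OF F X(1)] c in simp)
  finally show "koszul \<omega> (X # Xs) p = dif (\<lambda>X. X) lie_bracket (ev \<omega>) (X # Xs) p"
    by (simp only: dif.simps cder_split[of X "lie_bracket X"] minus_apply plus_fun_apply dd_def diff_minus_eq_add)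
qed

lemma ext_deriv_form_of:
  assumes "tensor (ev \<omega>)"
  shows "ext_deriv A \<omega> = form_of (dif (\<lambda>X. X) lie_bracket (ev \<omega>))"
  by (intro ext) (simp add: ext_deriv_def form_of_def koszul_dif[OF assms extend_list(1)])

end

section \<open>Transfer of Lie algebroid differentials to differential forms\<close>

context algebroid begin

text \<open>All properties are known for \<open>d\<close> on cochains. They carry over because
  \<open>ev\<close> intertwines \<open>D\<close> with \<open>d\<close> and forms are determined by
  their values on fields.\<close>

lemma cohomology_operator_dif:
  assumes D: "\<And>\<omega>. \<omega> \<in> diff_forms A \<Longrightarrow> D \<omega> = form_of (d (ev \<omega>))"
  shows "cohomology_operator A D"
proof -
  have mem: "D \<omega> \<in> diff_forms A" if "\<omega> \<in> diff_forms A" for \<omega>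
    unfolding D[OF that] by (rule form_of_diff_forms[OF dif_tensor[OF tensor_ev[OF that]]])
  have ev_D: "ev (D \<omega>) Xs = d (ev \<omega>) Xs" if "\<omega> \<in> diff_forms A" "set Xs \<subseteq> V" for \<omega> Xs
    unfolding D[OF that(1)] by (rule ev_form_of[OF dif_tensor[OF tensor_ev[OF that(1)]] that(2)])
  have off: "D \<omega> p vs = 0" if "\<omega> \<in> diff_forms A" "\<not> set vs \<subseteq> T p" for \<omega> p vs
    by (rule diff_forms_off[OF mem[OF that(1)] that(2)])
  note sm = tensor_smoothc[OF tensor_ev]
  have add: "D (\<lambda>p zs. \<alpha> p zs + \<beta> p zs) = (\<lambda>p zs. D \<alpha> p zs + D \<beta> p zs)"
    if ab: "\<alpha> \<in> diff_forms A" "\<beta> \<in> diff_forms A" for \<alpha> \<beta>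
  proof -
    have e: "ev (\<lambda>p zs. \<alpha> p zs + \<beta> p zs) = ev \<alpha> + ev \<beta>" for \<alpha> \<beta> :: "'m form"
      by (intro ext) (simp add: ev_apply fun_apply)
    have t: "tensor (ev \<alpha> + ev \<beta>)"
    proof (rule tensorI)
      show "smoothc (ev \<alpha> + ev \<beta>)" by (intro smoothc_add sm ab)
    next
      fix us ws X assume "set us \<subseteq> V" "set ws \<subseteq> V" "X \<in> V"
      then show "(ev \<alpha> + ev \<beta>) (us @ X # X # ws) = 0"
        using tensor_alt[OF tensor_ev[OF ab(1)]] tensor_alt[OF tensor_ev[OF ab(2)]] by simp
    next
      fix us ws f X Y assume "set us \<subseteq> V" "set ws \<subseteq> V" "f \<in> C" "X \<in> V" "Y \<in> V"
      then show "(ev \<alpha> + ev \<beta>) (us @ (f \<star> X + Y) # ws) = f * (ev \<alpha> + ev \<beta>) (us @ X # ws) + (ev \<alpha> + ev \<beta>) (us @ Y # ws)"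
        using tensor_lin[OF tensor_ev[OF ab(1)], of us ws f X Y] tensor_lin[OF tensor_ev[OF ab(2)], of us ws f X Y]
        by (simp add: algebra_simps)
    qed
    have "(\<lambda>p zs. \<alpha> p zs + \<beta> p zs) \<in> diff_forms A"
      by (rule diff_formsI) (simp_all add: e t diff_forms_off[OF ab(1)] diff_forms_off[OF ab(2)])
    then show ?thesis
      by (intro form_eqI)
        (simp_all add: off ab e ev_D dif_add sm)
  qed
  have scale: "D (\<lambda>p zs. c * \<alpha> p zs) = (\<lambda>p zs. c * D \<alpha> p zs)" if a: "\<alpha> \<in> diff_forms A" for \<alpha> c
  proof -
    have e: "ev (\<lambda>p zs. c * \<alpha> p zs) = cmul (\<lambda>_. c) (ev \<alpha>)" for \<alpha> :: "'m form"
      by (intro ext) (simp add: ev_apply fun_apply)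
    have t: "tensor (cmul (\<lambda>_. c) (ev \<alpha>))"
    proof (rule tensorI)
      show "smoothc (cmul (\<lambda>_. c) (ev \<alpha>))" by (intro smoothc_cmul sm a sf_const)
    next
      fix us ws X assume "set us \<subseteq> V" "set ws \<subseteq> V" "X \<in> V"
      then show "cmul (\<lambda>_. c) (ev \<alpha>) (us @ X # X # ws) = 0"
        using tensor_alt[OF tensor_ev[OF a]] by simp
    next
      fix us ws f X Y assume "set us \<subseteq> V" "set ws \<subseteq> V" "f \<in> C" "X \<in> V" "Y \<in> V"
      then show "cmul (\<lambda>_. c) (ev \<alpha>) (us @ (f \<star> X + Y) # ws) = f * cmul (\<lambda>_. c) (ev \<alpha>) (us @ X # ws) + cmul (\<lambda>_. c) (ev \<alpha>) (us @ Y # ws)"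
        using tensor_lin[OF tensor_ev[OF a], of us ws f X Y] by (simp add: algebra_simps)
    qed
    have "(\<lambda>p zs. c * \<alpha> p zs) \<in> diff_forms A"
      by (rule diff_formsI) (simp_all add: e t diff_forms_off[OF a])
    then show ?thesis
      by (intro form_eqI) (simp_all add: off a e ev_D dif_cmul_const sm)
  qed
  have deg: "D \<alpha> \<in> diff_forms_deg A (k + 1)" if a: "\<alpha> \<in> diff_forms_deg A k" for \<alpha> k
  proof -
    have a': "\<alpha> \<in> diff_forms A" "\<And>p vs. length vs \<noteq> k \<Longrightarrow> \<alpha> p vs = 0" using a by (auto simp: diff_forms_deg_def)
    have "ev \<alpha> Zs = 0" if "length Zs \<noteq> k" for Zs
      by (rule ext) (simp add: ev_apply a'(2) that fun_apply)
    then have "D \<alpha> p vs = 0" if "length vs \<noteq> k + 1" for p vs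
      using dif_degree[of k "ev \<alpha>" "map (extend_tvec A p) vs"] that extend_list(1)[of vs p]
      by (auto simp: D[OF a'(1)] form_of_def fun_apply)
    then show ?thesis using mem[OF a'(1)] by (simp add: diff_forms_deg_def)
  qed
  have leibniz: "D (wedge \<alpha> \<beta>) = (\<lambda>p zs. wedge (D \<alpha>) \<beta> p zs + (-1) ^ (1 * k) * wedge \<alpha> (D \<beta>) p zs)"
    if a: "\<alpha> \<in> diff_forms_deg A k" and b: "\<beta> \<in> diff_forms A" for \<alpha> \<beta> k
  proof -
    have a': "\<alpha> \<in> diff_forms A" "\<And>p vs. length vs \<noteq> k \<Longrightarrow> \<alpha> p vs = 0" using a by (auto simp: diff_forms_deg_def)
    have w: "wedge \<alpha> \<beta> \<in> diff_forms A"
    proof (rule diff_formsI)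
      have "ev (wedge \<alpha> \<beta>) = wdg (ev \<alpha>) (ev \<beta>)" by (rule ext) (rule ev_wedge)
      then show "tensor (ev (wedge \<alpha> \<beta>))" using tensor_wdg[OF tensor_ev[OF a'(1)] tensor_ev[OF b]] by simp
    qed (rule wedge_off[OF diff_forms_off[OF a'(1)] diff_forms_off[OF b]])
    \<comment> \<open>In degree \<open>k\<close> the involution is multiplication by a constant; the
      summand 0 provides the shape of \<open>wdg_cmul_add_left\<close>.\<close>
    have bar_ev: "bar (ev \<alpha>) = cmul (\<lambda>_. (-1) ^ k) (ev \<alpha>) + 0"
    proof (intro ext)
      have p: "((-1) ^ n :: 'm \<Rightarrow> real) p = (-1) ^ n" for n p
        by (induction n) (simp_all add: fun_apply)
      fix Zs p
      show "bar (ev \<alpha>) Zs p = (cmul (\<lambda>_. (-1) ^ k) (ev \<alpha>) + 0) Zs p"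
        by (cases "length Zs = k") (simp_all add: bar_apply p ev_apply a'(2) fun_apply)
    qed
    show ?thesis
    proof (rule form_eqI)
      fix Xs assume Xs: "set Xs \<subseteq> V"
      have "ev (D (wedge \<alpha> \<beta>)) Xs = d (wdg (ev \<alpha>) (ev \<beta>)) Xs"
        unfolding ev_D[OF w Xs] by (rule dif_cong[OF ev_wedge Xs])
      also have "\<dots> = wdg (d (ev \<alpha>)) (ev \<beta>) Xs + wdg (bar (ev \<alpha>)) (d (ev \<beta>)) Xs"
        by (rule dif_wdg[OF sm[OF a'(1)] sm[OF b] Xs])
      also have "wdg (d (ev \<alpha>)) (ev \<beta>) Xs = ev (wedge (D \<alpha>) \<beta>) Xs"
        unfolding ev_wedge by (rule wdg_cong[OF _ refl Xs]) (simp add: ev_D a'(1))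
      also have "wdg (bar (ev \<alpha>)) (d (ev \<beta>)) Xs = (\<lambda>_. (-1) ^ k) * wdg (ev \<alpha>) (d (ev \<beta>)) Xs"
        unfolding bar_ev wdg_cmul_add_left by (simp add: wdg_zero_left)
      also have "wdg (ev \<alpha>) (d (ev \<beta>)) Xs = ev (wedge \<alpha> (D \<beta>)) Xs"
        unfolding ev_wedge by (rule wdg_cong[OF refl _ Xs]) (simp add: ev_D b)
      finally show "ev (D (wedge \<alpha> \<beta>)) Xs = ev (\<lambda>p zs. wedge (D \<alpha>) \<beta> p zs + (-1) ^ (1 * k) * wedge \<alpha> (D \<beta>) p zs) Xs"
        by (simp add: ev_def fun_eq_iff fun_apply)
    next
      fix p vs assume vs: "\<not> set vs \<subseteq> T p"
      show "D (wedge \<alpha> \<beta>) p vs = 0" by (rule off[OF w vs])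
      show "wedge (D \<alpha>) \<beta> p vs + (-1) ^ (1 * k) * wedge \<alpha> (D \<beta>) p vs = 0"
        by (simp add: wedge_off[OF off[OF a'(1)] diff_forms_off[OF b] vs]
            wedge_off[OF diff_forms_off[OF a'(1)] off[OF b] vs])
    qed
  qed
  have square: "D (D \<omega>) = (\<lambda>p zs. 0)" if \<omega>: "\<omega> \<in> diff_forms A" for \<omega>
  proof (rule form_eqI)
    fix Xs assume Xs: "set Xs \<subseteq> V"
    have "ev (D (D \<omega>)) Xs = d (ev (D \<omega>)) Xs" by (rule ev_D[OF mem[OF \<omega>] Xs])
    also have "\<dots> = d (d (ev \<omega>)) Xs" by (rule dif_cong[OF ev_D[OF \<omega>] Xs])
    also have "\<dots> = 0" by (rule dif_dif[OF tensor_ev[OF \<omega>] Xs])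
    finally show "ev (D (D \<omega>)) Xs = ev (\<lambda>p zs. 0) Xs" by (simp add: ev_def zero_fun_def)
  qed (simp_all add: off mem \<omega>)
  show ?thesis
    unfolding cohomology_operator_def graded_derivation_def
    using mem add scale deg leibniz square by blast
qed

end

section \<open>Projections with involutive image\<close>

context smooth_manifold begin

lemma lie_bracket_diff_left: "X \<in> V \<Longrightarrow> Y \<in> V \<Longrightarrow> Z \<in> V \<Longrightarrow> lie_bracket (X - Y) Z = lie_bracket X Z - lie_bracket Y Z"
  and lie_bracket_zero_left: "X \<in> V \<Longrightarrow> lie_bracket 0 X = 0"
  by (rule vf_eqI; simp add: V_intros C_intros dd_lie_bracket dd_add_field dd_diff_field
        dd_add dd_diff dd_zero algebra_simps)+

lemma algebroid_tangent: "algebroid A (\<lambda>X. X) lie_bracket"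
  by unfold_locales (assumption | rule refl V_lie_bracket lie_bracket_right lie_bracket_antisym jacobi)+

end

locale involutive_projection = smooth_manifold A
  for A :: "('m::{t2_space,second_countable_topology}, 'e::real_inner) atlas" +
  fixes N :: "'m vform"
  assumes N_form: "N \<in> vector_forms A 1"
    and N_idem: "\<And>p v. v \<in> T p \<Longrightarrow> N p [N p [v]] = N p [v]"
    and N_inv: "involutive_image A N"
begin

section \<open>The projections N and 1 - N, the torsion and the Bott bracket\<close>

abbreviation "n \<equiv> endo_field N"

text \<open>The projection onto Ker N along Im N, which represents the quotient map to TM / Im
  N.\<close>

definition cpl :: "('m \<Rightarrow> 'm tvec) \<Rightarrow> ('m \<Rightarrow> 'm tvec)" where
  "cpl X = X - n X"

lemma N_alt: "alternating_multilinear (T p) (\<lambda>vs. N p vs f)"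
  using N_form by (simp add: vector_forms_def)

lemma N_off: "\<not> set us \<subseteq> T p \<Longrightarrow> N p us = (\<lambda>f. 0)"
  using alternating_multilinearD(1)[OF N_alt] by blast

lemma n_V: "X \<in> V \<Longrightarrow> n X \<in> V"
proof -
  assume X: "X \<in> V"
  have "\<forall>Xs. set Xs \<subseteq> V \<longrightarrow> (\<lambda>p. N p (map (\<lambda>X. X p) Xs)) \<in> V"
    using N_form by (simp add: vector_forms_def)
  from this[rule_format, of "[X]"] X show ?thesis by (simp add: endo_field_def)
qed

lemma n_lin: "f \<in> C \<Longrightarrow> X \<in> V \<Longrightarrow> Y \<in> V \<Longrightarrow> n (f \<star> X + Y) = f \<star> n X + n Y"
proof (intro ext)
  fix p h assume f: "f \<in> C" and XY: "X \<in> V" "Y \<in> V"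
  note t = vf_tangent[OF XY(1), of p] vf_tangent[OF XY(2), of p]
  have e: "(f \<star> X + Y) p = (\<lambda>h. (\<lambda>h. f p * X p h) h + Y p h)"
    by (simp add: fun_eq_iff fun_apply smul_def)
  have "N p ([] @ (\<lambda>h. (\<lambda>h. f p * X p h) h + Y p h) # []) h = N p ([] @ (\<lambda>h. f p * X p h) # []) h + N p ([] @ Y p # []) h"
    by (rule alternating_multilinearD(2)[OF N_alt tangent_scale[OF t(1)] t(2)]) simp_all
  moreover have "N p ([] @ (\<lambda>h. f p * X p h) # []) h = f p * N p ([] @ X p # []) h"
    by (rule alternating_multilinearD(3)[OF N_alt t(1)]) simp_all
  moreover have "n (f \<star> X + Y) p h = N p [\<lambda>h. f p * X p h + Y p h] h"
    by (simp only: endo_field_def e)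
  ultimately show "n (f \<star> X + Y) p h = (f \<star> n X + n Y) p h"
    by (simp add: endo_field_def fun_apply smul_def)
qed

lemma n_add: "X \<in> V \<Longrightarrow> Y \<in> V \<Longrightarrow> n (X + Y) = n X + n Y"
  using n_lin[of 1 X Y] by (simp add: C_intros)

lemma n_zero: "n 0 = 0"
  using n_add[of 0 0] by (simp add: V_zero)

lemma n_smul: "f \<in> C \<Longrightarrow> X \<in> V \<Longrightarrow> n (f \<star> X) = f \<star> n X"
  using n_lin[of f X 0] by (simp add: V_zero n_zero)

lemma n_minus: "X \<in> V \<Longrightarrow> n (- X) = - n X"
  using n_smul[of "- 1" X] by (simp add: C_intros smul_minus_left)

lemma n_diff: "X \<in> V \<Longrightarrow> Y \<in> V \<Longrightarrow> n (X - Y) = n X - n Y"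
  using n_add[of X "- Y"] n_minus[of Y] V_minus[of Y] by simp

lemma n_idem: "X \<in> V \<Longrightarrow> n (n X) = n X"
  by (rule ext) (simp add: endo_field_def N_idem vf_tangent)

text \<open>Involutivity as an equation: for a projection, membership in the image means being
  fixed.\<close>

lemma n_bracket: "X \<in> V \<Longrightarrow> Y \<in> V \<Longrightarrow> n (lie_bracket (n X) (n Y)) = lie_bracket (n X) (n Y)"
proof (rule ext)
  fix p assume XY: "X \<in> V" "Y \<in> V"
  have "lie_bracket (n X) (n Y) p \<in> (\<lambda>v. N p [v]) ` T p"
    using N_inv XY unfolding involutive_image_def by simp
  then obtain v where v: "v \<in> T p" "lie_bracket (n X) (n Y) p = N p [v]" by (elim imageE)
  have "n (lie_bracket (n X) (n Y)) p = N p [lie_bracket (n X) (n Y) p]" by (simp add: endo_field_def)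
  also have "\<dots> = lie_bracket (n X) (n Y) p" unfolding v(2) by (rule N_idem[OF v(1)])
  finally show "n (lie_bracket (n X) (n Y)) p = lie_bracket (n X) (n Y) p" .
qed

lemma cpl_V: "X \<in> V \<Longrightarrow> cpl X \<in> V"
  by (simp add: cpl_def V_diff n_V)

lemma cpl_lin: "f \<in> C \<Longrightarrow> X \<in> V \<Longrightarrow> Y \<in> V \<Longrightarrow> cpl (f \<star> X + Y) = f \<star> cpl X + cpl Y"
  by (simp add: cpl_def n_lin smul_diff)

lemma cpl_add: "X \<in> V \<Longrightarrow> Y \<in> V \<Longrightarrow> cpl (X + Y) = cpl X + cpl Y"
  by (simp add: cpl_def n_add)

lemma cpl_smul: "f \<in> C \<Longrightarrow> X \<in> V \<Longrightarrow> cpl (f \<star> X) = f \<star> cpl X"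
  by (simp add: cpl_def n_smul smul_diff)

lemma cpl_minus: "X \<in> V \<Longrightarrow> cpl (- X) = - cpl X"
  by (simp add: cpl_def n_minus)

lemma cpl_diff: "X \<in> V \<Longrightarrow> Y \<in> V \<Longrightarrow> cpl (X - Y) = cpl X - cpl Y"
  by (simp add: cpl_def n_diff)

lemma n_cpl: "X \<in> V \<Longrightarrow> n (cpl X) = 0"
  by (simp add: cpl_def n_diff n_idem n_V)

lemma cpl_n: "X \<in> V \<Longrightarrow> cpl (n X) = 0"
  by (simp add: cpl_def n_idem)

text \<open>The curvature of the distribution Ker N. Under idempotence and involutivity it is the
  Nijenhuis torsion (\<open>torsion_field_tor\<close>), in a form that shows its values in Im N and
  its vanishing on Im N.\<close>

definition tor :: "('m \<Rightarrow> 'm tvec) \<Rightarrow> ('m \<Rightarrow> 'm tvec) \<Rightarrow> ('m \<Rightarrow> 'm tvec)" where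
  "tor X Y = n (lie_bracket (cpl X) (cpl Y))"

text \<open>The bracket of the Lie algebroid \<open>F \<ltimes> (TM / F)\<close>, \<open>F = Im N\<close>, in which \<open>F\<close> acts on
  \<open>TM / F\<close> by the Bott connection; the anchor is \<open>N\<close>.\<close>

definition bott :: "('m \<Rightarrow> 'm tvec) \<Rightarrow> ('m \<Rightarrow> 'm tvec) \<Rightarrow> ('m \<Rightarrow> 'm tvec)" where
  "bott X Y = lie_bracket (n X) (n Y) + cpl (lie_bracket (n X) Y) + cpl (lie_bracket X (n Y))"

lemma tor_V: "X \<in> V \<Longrightarrow> Y \<in> V \<Longrightarrow> tor X Y \<in> V"
  by (simp add: tor_def n_V cpl_V V_lie_bracket)

lemma bott_V: "X \<in> V \<Longrightarrow> Y \<in> V \<Longrightarrow> bott X Y \<in> V"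
  by (simp add: bott_def n_V cpl_V V_lie_bracket V_add)

lemma tor_expand: "X \<in> V \<Longrightarrow> Y \<in> V \<Longrightarrow> tor X Y =
    lie_bracket (n X) (n Y) - n (lie_bracket (n X) Y) - n (lie_bracket X (n Y)) + n (lie_bracket X Y)"
  by (simp add: tor_def cpl_def n_V V_intros lie_bracket_diff_left lie_bracket_diff_right n_diff n_bracket)

lemma torsion_field_tor: "X \<in> V \<Longrightarrow> Y \<in> V \<Longrightarrow> torsion_field N X Y = tor X Y"
  by (intro ext) (simp add: torsion_field_def tor_expand n_idem V_lie_bracket fun_apply)

text \<open>The terms before \<open>tor X Y\<close> form the bracket deformed by N, the one that
  belongs to the Lie derivative along N; the torsion is exactly what separates it from
  \<open>bott\<close>.\<close>

lemma bott_tor: "X \<in> V \<Longrightarrow> Y \<in> V \<Longrightarrow>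
    bott X Y = lie_bracket (n X) Y + (lie_bracket X (n Y) - n (lie_bracket X Y)) + tor X Y"
  by (simp add: bott_def tor_expand cpl_def)

text \<open>The derivative of \<open>f\<close> comes multiplied by \<open>cpl Y\<close>, which
  \<open>n\<close> annihilates.\<close>

lemma tor_lin:
  assumes "X \<in> V" "f \<in> C" "Y \<in> V" "Z \<in> V"
  shows "tor X (f \<star> Y + Z) = f \<star> tor X Y + tor X Z"
proof -
  have "tor X (f \<star> Y + Z) = n (f \<star> lie_bracket (cpl X) (cpl Y) + dd (cpl X) f \<star> cpl Y + lie_bracket (cpl X) (cpl Z))"
    using assms by (simp add: tor_def cpl_lin lie_bracket_right cpl_V)
  also have "\<dots> = f \<star> tor X Y + tor X Z"
    using assms by (simp add: tor_def n_add n_smul n_cpl cpl_V V_intros C_intros)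
  finally show ?thesis .
qed

lemma tor_antisym: "X \<in> V \<Longrightarrow> Y \<in> V \<Longrightarrow> tor Y X = - tor X Y"
  by (simp add: tor_def lie_bracket_antisym[of "cpl Y" "cpl X"] n_minus cpl_V V_lie_bracket)

lemma tor_tor: "X \<in> V \<Longrightarrow> Y \<in> V \<Longrightarrow> Z \<in> V \<Longrightarrow> tor X (tor Y Z) = 0"
  by (simp add: tor_def[of X] tor_def[of Y] cpl_n cpl_V V_lie_bracket lie_bracket_zero_right n_zero)

lemma algebroid_torsion: "algebroid A (\<lambda>_. 0) tor"
proof unfold_locales
  fix X Y Z assume XYZ: "X \<in> V" "Y \<in> V" "Z \<in> V"
  have "tor (tor X Y) Z = - tor Z (tor X Y)" by (intro tor_antisym tor_V XYZ)
  then show "tor X (tor Y Z) = tor (tor X Y) Z + tor Y (tor X Z)"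
    using XYZ by (simp add: tor_tor)
qed (simp_all add: V_zero tor_V tor_lin tor_antisym[symmetric] lie_bracket_zero_right)

text \<open>The first bracket contributes the derivative of \<open>f\<close> times
  \<open>n Y\<close>, the second the same derivative times \<open>cpl Y\<close>, together all of
  \<open>Y\<close>; the derivative along \<open>X\<close> in the third multiplies
  \<open>cpl (n Y) = 0\<close>.\<close>

lemma bott_lin:
  assumes "X \<in> V" "f \<in> C" "Y \<in> V" "Z \<in> V"
  shows "bott X (f \<star> Y + Z) = f \<star> bott X Y + dd (n X) f \<star> Y + bott X Z"
proof -
  have 1: "cpl (lie_bracket (n X) (f \<star> Y + Z))
      = f \<star> cpl (lie_bracket (n X) Y) + dd (n X) f \<star> cpl Y + cpl (lie_bracket (n X) Z)"
    using assms by (simp add: lie_bracket_right n_V cpl_add cpl_smul V_intros C_intros)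
  have 2: "cpl (lie_bracket X (f \<star> n Y + n Z)) = f \<star> cpl (lie_bracket X (n Y)) + cpl (lie_bracket X (n Z))"
    using assms by (simp add: lie_bracket_right n_V cpl_add cpl_smul cpl_n V_intros C_intros)
  have 3: "lie_bracket (n X) (f \<star> n Y + n Z) = f \<star> lie_bracket (n X) (n Y) + dd (n X) f \<star> n Y + lie_bracket (n X) (n Z)"
    using assms by (simp add: lie_bracket_right n_V)
  show ?thesis
    unfolding bott_def n_lin[OF assms(2-4)] 1 2 3 by (simp add: cpl_def[of Y] smul_add smul_diff)
qed

lemma bott_antisym: "X \<in> V \<Longrightarrow> Y \<in> V \<Longrightarrow> bott Y X = - bott X Y"
  by (simp add: bott_def lie_bracket_antisym[of "n Y" "n X"] lie_bracket_antisym[of "n Y" X]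
      lie_bracket_antisym[of Y "n X"] cpl_minus n_V V_lie_bracket)

lemma n_bott: "X \<in> V \<Longrightarrow> Y \<in> V \<Longrightarrow> n (bott X Y) = lie_bracket (n X) (n Y)"
  by (simp add: bott_def n_add n_cpl n_bracket n_V cpl_V V_intros)

text \<open>The Bott connection is well defined on the quotient: changing \<open>W\<close> by a
  field in Im N changes the bracket by a field in Im N.\<close>

lemma cpl_bracket_cpl:
  assumes "X \<in> V" "W \<in> V"
  shows "cpl (lie_bracket (n X) (cpl W)) = cpl (lie_bracket (n X) W)"
proof -
  have "cpl (lie_bracket (n X) (n W)) = 0"
    using assms by (simp add: cpl_def n_bracket)
  moreover have "lie_bracket (n X) W = lie_bracket (n X) (cpl W) + lie_bracket (n X) (n W)"
    using assms by (simp add: cpl_def lie_bracket_diff_right n_V)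
  ultimately show ?thesis using assms by (simp add: cpl_add n_V cpl_V V_intros)
qed

text \<open>All inner projections disappear, leaving double Lie brackets under at most one outer
  \<open>cpl\<close>. In this form the Jacobi identity of \<open>bott\<close> can be read off from
  that of vector fields.\<close>

lemma bott_bott:
  assumes "X \<in> V" "Y \<in> V" "Z \<in> V"
  shows "bott X (bott Y Z) = lie_bracket (n X) (lie_bracket (n Y) (n Z)) +
    cpl (lie_bracket (n X) (lie_bracket (n Y) Z) + lie_bracket (n X) (lie_bracket Y (n Z)) +
      lie_bracket X (lie_bracket (n Y) (n Z)))"
proof -
  let ?b = "lie_bracket (n Y) (n Z)"
  have b: "?b \<in> V" "n ?b = ?b" using assms by (simp_all add: n_V V_lie_bracket n_bracket)
  have "cpl (lie_bracket (n X) ?b) = 0"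
    using n_bracket[OF assms(1) b(1)] b(2) by (simp add: cpl_def)
  then have "cpl (lie_bracket (n X) (bott Y Z)) =
      cpl (lie_bracket (n X) (lie_bracket (n Y) Z)) + cpl (lie_bracket (n X) (lie_bracket Y (n Z)))"
    using assms by (simp add: bott_def lie_bracket_add_right cpl_add cpl_bracket_cpl n_V cpl_V V_intros)
  then show ?thesis
    using assms by (simp add: bott_def[of X] n_bott cpl_add n_V V_intros)
qed

lemma algebroid_bott: "algebroid A n bott"
proof unfold_locales
  fix X Y Z assume XYZ: "X \<in> V" "Y \<in> V" "Z \<in> V"
  note v = XYZ n_V[OF XYZ(1)] n_V[OF XYZ(2)] n_V[OF XYZ(3)]
  have "bott (bott X Y) Z = - bott Z (bott X Y)" by (intro bott_antisym bott_V XYZ)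
  also have "\<dots> = lie_bracket (lie_bracket (n X) (n Y)) (n Z) +
    cpl (lie_bracket (lie_bracket (n X) Y) (n Z) + lie_bracket (lie_bracket X (n Y)) (n Z) +
      lie_bracket (lie_bracket (n X) (n Y)) Z)"
    unfolding bott_bott[OF XYZ(3,1,2)]
    by (simp add: lie_bracket_antisym[of "n Z"] lie_bracket_antisym[of Z] cpl_add cpl_diff cpl_minus v V_intros)
  finally have 1: "bott (bott X Y) Z = lie_bracket (lie_bracket (n X) (n Y)) (n Z) +
    cpl (lie_bracket (lie_bracket (n X) Y) (n Z) + lie_bracket (lie_bracket X (n Y)) (n Z) +
      lie_bracket (lie_bracket (n X) (n Y)) Z)" .
  show "bott X (bott Y Z) = bott (bott X Y) Z + bott Y (bott X Z)"
    \<comment> \<open>One Jacobi identity has N applied to all three fields; the three others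
      correspond to the argument to which N is not applied.\<close>
    unfolding 1 bott_bott[OF XYZ] bott_bott[OF XYZ(2,1,3)]
      jacobi[OF v(4,5,6)] jacobi[OF v(4,5,3)] jacobi[OF v(4,2,6)] jacobi[OF v(1,5,6)]
    by (simp add: cpl_add v V_intros)
qed (assumption | rule n_V bott_V n_lin bott_lin bott_antisym n_bott)+

text \<open>Contraction with \<open>Y\<close> gives both sides the same recursion. On the right,
  commuting i_N with L_Y yields the Lie derivative of N along Y, and contracting i_N yields L along
  N Y; with the torsion they add up, by \<open>bott_tor\<close>, to the Lie derivative belonging to
  \<open>bott\<close>.\<close>

lemma dif_bott:
  assumes "tensor F" "set Xs \<subseteq> V"
  shows "dif n bott F Xs = cder 0 (\<lambda>X. - n X) (dif (\<lambda>X. X) lie_bracket F) Xs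
    - dif (\<lambda>X. X) lie_bracket (cder 0 (\<lambda>X. - n X) F) Xs + dif (\<lambda>_. 0) tor F Xs"
proof -
  define R :: "'m cochain \<Rightarrow> 'm cochain" where
    "R F Xs = cder 0 (\<lambda>X. - n X) (dif (\<lambda>X. X) lie_bracket F) Xs
      - dif (\<lambda>X. X) lie_bracket (cder 0 (\<lambda>X. - n X) F) Xs + dif (\<lambda>_. 0) tor F Xs" for F Xs
  have "dif n bott F Xs = R F Xs"
    using assms
  proof (induction Xs arbitrary: F)
    case Nil
    show "dif n bott F [] = R F []" by (simp add: R_def)
  next
    case (Cons Y Ys)
    then have Y: "Y \<in> V" "set Ys \<subseteq> V" by auto
    note F = Cons.prems(1) and sF = tensor_smoothc[OF Cons.prems(1)]
    let ?d = "dif (\<lambda>X. X) lie_bracket"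
    let ?i = "cder 0 (\<lambda>X. - n X)"
    let ?L = "\<lambda>X. cder X (lie_bracket X)"
    interpret d0: algebroid A "\<lambda>X. X" lie_bracket by (rule algebroid_tangent)
    have B: "- n X \<in> V" if "X \<in> V" for X using that by (intro V_minus n_V)
    have c: "smoothc (contr Z F)" if "Z \<in> V" for Z using sF that by (rule smoothc_contr)
    have si: "smoothc (?i G)" if "smoothc G" for G by (rule cder_smoothc[OF that V_zero B])
    have 1: "?i (contr Y (?d F)) Ys = ?i (?L Y F) Ys - ?i (?d (contr Y F)) Ys"
      unfolding contr_dif by (rule cder_diff[OF V_zero B Y(2) d0.L_smoothc[OF sF Y(1)] d0.dif_smoothc[OF c[OF Y(1)]]])
    have 2: "?L (- n Y) F Ys - ?d (contr (- n Y) F) Ys = - (?L (n Y) F Ys - ?d (contr (n Y) F) Ys)"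
      using tensor_minus[OF d0.dif_tensor[OF F], of "[]" Ys "n Y"] Y n_V by simp
    have "?d (contr (- n Y) F) Ys = ?d (- contr (n Y) F) Ys"
      using tensor_minus[OF F, of "[]" _ "n Y"] Y n_V by (intro d0.dif_cong Y) simp
    also have "\<dots> = - ?d (contr (n Y) F) Ys"
      by (rule d0.dif_minus[OF c[OF n_V[OF Y(1)]] Y(2)])
    finally have 3: "?d (contr Y (?i F)) Ys = ?d (?i (contr Y F)) Ys + ?d (contr (n Y) F) Ys"
      unfolding contr_cder
      using d0.dif_diff[OF si[OF c[OF Y(1)]] c[OF B[OF Y(1)]] Y(2)] by simp
    \<comment> \<open>The Lie derivative of the endomorphism N along \<open>Y\<close>.\<close>
    let ?K = "\<lambda>Z. lie_bracket Y (n Z) - n (lie_bracket Y Z)"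
    have K: "?K Z \<in> V" if "Z \<in> V" for Z using that Y by (simp add: V_intros n_V)
    have 4: "?i (?L Y F) Ys - ?L Y (?i F) Ys = cder 0 ?K F Ys"
    proof -
      have "?i (?L Y F) Ys - ?L Y (?i F) Ys = cder (lie_bracket 0 Y) ?K F Ys"
      proof (rule cder_commute[OF F V_zero Y B V_lie_bracket[OF Y(1)]])
        show "?K X = - n (lie_bracket Y X) - lie_bracket Y (- n X)" if "X \<in> V" for X
          using that Y by (simp add: lie_bracket_minus_right n_V)
      qed
      then show ?thesis by (simp add: lie_bracket_zero_left[OF Y(1)])
    qed
    have 5: "cder (n Y) (bott Y) F Ys = ?L (n Y) F Ys + (cder 0 ?K F Ys + cder 0 (tor Y) F Ys)"
    proof -
      \<comment> \<open>The factor 1 and the zero field give the sum the shape of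
        \<open>cder_param\<close>, which splits off one summand of the bracket at a time.\<close>
      have "cder (1 \<star> n Y + 0) (bott Y) F Ys = 1 * ?L (n Y) F Ys + cder 0 (\<lambda>Z. ?K Z + tor Y Z) F Ys"
      proof (rule cder_param[OF F C_intros(2) _ _ Y(2)])
        show "bott Y X = 1 \<star> lie_bracket (n Y) X + (?K X + tor Y X)" if "X \<in> V" for X
          using bott_tor[OF Y(1) that] by (simp add: add.assoc)
      qed (use Y in \<open>simp_all add: V_intros n_V tor_V\<close>)
      moreover have "cder (1 \<star> 0 + 0) (\<lambda>Z. ?K Z + tor Y Z) F Ys = 1 * cder 0 ?K F Ys + cder 0 (tor Y) F Ys"
        by (rule cder_param[OF F C_intros(2) K tor_V[OF Y(1)] Y(2)]) simp_all
      ultimately show ?thesis by simp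
    qed
    have IH: "dif n bott (contr Y F) Ys = R (contr Y F) Ys"
      by (rule Cons.IH[OF tensor_contr[OF F Y(1)] Y(2)])
    show "dif n bott F (Y # Ys) = R F (Y # Ys)"
      unfolding R_def dif.simps(2) cder.simps(2) 1 3 2 IH R_def 5 4[symmetric] by (simp add: algebra_simps)
  qed
  then show ?thesis by (simp only: R_def)
qed

section \<open>Both operators on forms as Lie algebroid differentials\<close>

lemma ev_insertion_N:
  assumes "\<omega> \<in> diff_forms A" "set Xs \<subseteq> V"
  shows "ev (insertion 0 N \<omega>) Xs = cder 0 (\<lambda>X. - n X) (ev \<omega>) Xs"
proof (rule ext)
  fix p
  show "ev (insertion 0 N \<omega>) Xs p = cder 0 (\<lambda>X. - n X) (ev \<omega>) Xs p"
    unfolding ev_apply[of "insertion 0 N \<omega>"] insertion_ins_sum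
    by (rule ins_sum_1[OF tensor_ev[OF assms(1)] _ assms(2)]) (simp_all add: ev_apply n_V, simp add: endo_field_def)
qed

lemma tensor_insertion_N: "tensor F \<Longrightarrow> tensor (cder 0 (\<lambda>X. - n X) F)"
  by (rule tensor_cder) (simp_all add: V_zero V_minus n_V n_lin smul_minus)

lemma lie_deriv_N:
  assumes \<omega>: "\<omega> \<in> diff_forms A"
  shows "set Xs \<subseteq> V \<Longrightarrow> ev (lie_deriv A 0 N \<omega>) Xs = cder 0 (\<lambda>X. - n X) (dif (\<lambda>X. X) lie_bracket (ev \<omega>)) Xs
    - dif (\<lambda>X. X) lie_bracket (cder 0 (\<lambda>X. - n X) (ev \<omega>)) Xs"
    and "\<not> set vs \<subseteq> T p \<Longrightarrow> lie_deriv A 0 N \<omega> p vs = 0"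
proof -
  let ?i = "cder 0 (\<lambda>X. - n X)" and ?d = "dif (\<lambda>X. X) lie_bracket"
  interpret d0: algebroid A "\<lambda>X. X" lie_bracket by (rule algebroid_tangent)
  note t = tensor_ev[OF \<omega>]
  have e: "ext_deriv A \<omega> = form_of (?d (ev \<omega>))" by (rule ext_deriv_form_of[OF t])
  have ed: "ext_deriv A \<omega> \<in> diff_forms A" unfolding e by (rule form_of_diff_forms[OF d0.dif_tensor[OF t]])
  \<comment> \<open>\<open>ext_deriv_form_of\<close> asks for tensoriality of the evaluated form,
    which the insertion inherits from its description on fields.\<close>
  have ti: "tensor (ev (insertion 0 N \<omega>))"
    by (rule tensor_cong[OF tensor_insertion_N[OF t] ev_insertion_N[OF \<omega>]])
  have ei: "ext_deriv A (insertion 0 N \<omega>) = form_of (?d (ev (insertion 0 N \<omega>)))"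
    by (rule ext_deriv_form_of[OF ti])
  show "lie_deriv A 0 N \<omega> p vs = 0" if "\<not> set vs \<subseteq> T p"
    using insertion_off[where k=0, OF ed N_off that] by (simp add: lie_deriv_def ei form_of_off that)
  assume Xs: "set Xs \<subseteq> V"
  have 1: "ev (insertion 0 N (ext_deriv A \<omega>)) Xs = ?i (?d (ev \<omega>)) Xs"
    unfolding ev_insertion_N[OF ed Xs]
    by (rule cder_cong[OF _ _ Xs]) (simp_all add: e ev_form_of[OF d0.dif_tensor[OF t]] V_minus n_V)
  have 2: "ev (ext_deriv A (insertion 0 N \<omega>)) Xs = ?d (?i (ev \<omega>)) Xs"
    unfolding ei ev_form_of[OF d0.dif_tensor[OF ti] Xs] by (rule d0.dif_cong[OF ev_insertion_N[OF \<omega>] Xs])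
  have "ev (lie_deriv A 0 N \<omega>) Xs = ev (insertion 0 N (ext_deriv A \<omega>)) Xs - ev (ext_deriv A (insertion 0 N \<omega>)) Xs"
    by (rule ext) (simp add: ev_apply lie_deriv_def fun_apply)
  then show "ev (lie_deriv A 0 N \<omega>) Xs = ?i (?d (ev \<omega>)) Xs - ?d (?i (ev \<omega>)) Xs"
    unfolding 1 2 .
qed

text \<open>A vector-valued form is a family of scalar forms indexed by the function
  \<open>f\<close> that its values differentiate; for each \<open>f\<close> the results on scalar
  cochains apply.\<close>

definition torsion_cochain :: "('m \<Rightarrow> real) \<Rightarrow> 'm cochain" where
  "torsion_cochain f Xs = (if length Xs = 2 then - dd (tor (Xs ! 0) (Xs ! 1)) f else 0)"

lemma tensor_torsion_cochain: "tensor (torsion_cochain f)"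
proof (rule tensorI)
  have "dd X f \<in> C" if "X \<in> V" for X
    using that by (cases "f \<in> C") (simp_all add: C_intros dd_nonsmooth)
  then show "smoothc (torsion_cochain f)"
    by (auto simp: smoothc_def torsion_cochain_def C_intros tor_V nth_V)
next
  fix us ws X assume us: "set us \<subseteq> V" and ws: "set ws \<subseteq> V" and X: "X \<in> V"
  have "tor X X = 0" by (rule algebroid.br_self[OF algebroid_torsion X])
  then show "torsion_cochain f (us @ X # X # ws) = 0" by (simp add: torsion_cochain_def)
next
  fix us ws g X Y assume us: "set us \<subseteq> V" and ws: "set ws \<subseteq> V" and g: "g \<in> C" and XY: "X \<in> V" "Y \<in> V"
  \<comment> \<open>The cochain lives in degree 2, so exactly one further argument stands before or
    after the distinguished one.\<close>
  consider W where "us = []" "ws = [W]" | U where "us = [U]" "ws = []" | "length us + length ws \<noteq> 1"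
    by (cases us; cases ws) auto
  then show "torsion_cochain f (us @ (g \<star> X + Y) # ws) = g * torsion_cochain f (us @ X # ws) + torsion_cochain f (us @ Y # ws)"
  proof cases
    case 1
    then have W: "W \<in> V" using ws by simp
    have "tor (g \<star> X + Y) W = - tor W (g \<star> X + Y)" by (intro tor_antisym W V_add V_smul g XY)
    also have "\<dots> = g \<star> tor X W + tor Y W"
      by (simp add: tor_lin[OF W g XY] tor_antisym[OF XY(1) W] tor_antisym[OF XY(2) W] smul_minus)
    finally show ?thesis by (simp add: 1 torsion_cochain_def dd_add_field dd_smul)
  next
    case 2
    then have "U \<in> V" using us by simp
    then show ?thesis by (simp add: 2 torsion_cochain_def tor_lin[OF _ g XY] dd_add_field dd_smul)
  next
    case 3
    then show ?thesis by (simp add: torsion_cochain_def)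
  qed
qed

definition tau :: "'m vform" where
  "tau = (\<lambda>p vs f. - nijenhuis_torsion A N p vs f)"

lemma tau_form_of: "tau p vs f = form_of (torsion_cochain f) p vs"
proof (cases "length vs = 2 \<and> set vs \<subseteq> T p")
  case True
  then have "vs ! 0 \<in> T p" "vs ! 1 \<in> T p" by (auto simp: subset_iff)
  then show ?thesis using True
    by (simp add: tau_def nijenhuis_torsion_def form_of_def torsion_cochain_def torsion_field_tor extend_tvec dd_def fun_apply)
qed (auto simp: tau_def nijenhuis_torsion_def form_of_def torsion_cochain_def fun_apply)

lemma tau_fields: "set Xs \<subseteq> V \<Longrightarrow> tau p (map (\<lambda>X. X p) Xs) f = torsion_cochain f Xs p"
  using fun_cong[OF ev_form_of[OF tensor_torsion_cochain, of Xs f], of p] by (simp add: tau_form_of ev_apply)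

lemma tau_pair: "X \<in> V \<Longrightarrow> Y \<in> V \<Longrightarrow> tau p [X p, Y p] = (- tor X Y) p"
  using tau_fields[of "[X, Y]" p] by (simp add: fun_eq_iff torsion_cochain_def dd_def fun_apply)

lemma tau_vector_form: "tau \<in> vector_forms A 2"
  unfolding vector_forms_def
proof (intro CollectI conjI allI impI)
  fix p f vs
  show "tau p vs f = 0" if "length vs \<noteq> 2"
    using that by (simp add: tau_def nijenhuis_torsion_def)
  show "alternating_multilinear (T p) (\<lambda>vs. tau p vs f)"
    unfolding tau_form_of by (rule form_of_alternating[OF tensor_torsion_cochain])
  show "tau p vs \<in> T p"
  proof (cases "length vs = 2 \<and> set vs \<subseteq> T p")
    case True
    then have v: "vs ! 0 \<in> T p" "vs ! 1 \<in> T p" by (auto simp: subset_iff)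
    have "tau p vs = (\<lambda>f. (- 1) * torsion_field N (extend_tvec A p (vs ! 0)) (extend_tvec A p (vs ! 1)) p f)"
      using True by (simp add: tau_def nijenhuis_torsion_def)
    moreover have "torsion_field N (extend_tvec A p (vs ! 0)) (extend_tvec A p (vs ! 1)) p \<in> T p"
      using v by (simp add: torsion_field_tor extend_tvec tor_V vf_tangent)
    ultimately show ?thesis by (simp only: tangent_scale)
  next
    case False
    then have "tau p vs = (\<lambda>f. 0)" by (auto simp: tau_def nijenhuis_torsion_def)
    then show ?thesis using tangent_zero by simp
  qed
next
  fix Xs assume Xs: "set Xs \<subseteq> V"
  have "(\<lambda>p. tau p (map (\<lambda>X. X p) Xs)) = (if length Xs = 2 then - tor (Xs ! 0) (Xs ! 1) else 0)"
    by (intro ext) (simp add: tau_fields[OF Xs] torsion_cochain_def dd_def fun_apply)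
  moreover have "\<dots> \<in> V" using Xs by (simp add: V_zero V_minus tor_V nth_V)
  ultimately show "(\<lambda>p. tau p (map (\<lambda>X. X p) Xs)) \<in> V" by simp
qed

lemma insertion_tau:
  assumes \<omega>: "\<omega> \<in> diff_forms A"
  shows "set Xs \<subseteq> V \<Longrightarrow> ev (insertion 1 tau \<omega>) Xs = dif (\<lambda>_. 0) tor (ev \<omega>) Xs"
    and "\<not> set vs \<subseteq> T p \<Longrightarrow> insertion 1 tau \<omega> p vs = 0"
proof -
  show "\<not> set vs \<subseteq> T p \<Longrightarrow> insertion 1 tau \<omega> p vs = 0"
    by (rule insertion_off[OF \<omega>]) (auto simp: tau_form_of form_of_off fun_eq_iff)
  assume Xs: "set Xs \<subseteq> V"
  show "ev (insertion 1 tau \<omega>) Xs = dif (\<lambda>_. 0) tor (ev \<omega>) Xs"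
  proof (rule ext)
    fix p
    \<comment> \<open>The sign in L = -T_N cancels the sign of \<open>ins_sum_2\<close>, and the
      bracket becomes \<open>tor\<close> itself.\<close>
    have "ins_sum (Suc (Suc 0)) (\<lambda>us ws. \<omega> p (tau p us # ws)) (map (\<lambda>X. X p) Xs)
        = dif (\<lambda>_. 0) (\<lambda>X Y. - (- tor X Y)) (ev \<omega>) Xs p"
      by (rule ins_sum_2[OF tensor_ev[OF \<omega>] _ Xs]) (simp_all only: ev_apply V_minus tor_V tau_pair)
    then show "ev (insertion 1 tau \<omega>) Xs p = dif (\<lambda>_. 0) tor (ev \<omega>) Xs p"
      by (simp add: ev_apply insertion_ins_sum)
  qed
qed

lemma cohomology_operator_insertion: "cohomology_operator A (insertion 1 tau)"
proof (rule algebroid.cohomology_operator_dif[OF algebroid_torsion])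
  fix \<omega> assume \<omega>: "\<omega> \<in> diff_forms A"
  note t = algebroid.dif_tensor[OF algebroid_torsion tensor_ev[OF \<omega>]]
  show "insertion 1 tau \<omega> = form_of (dif (\<lambda>_. 0) tor (ev \<omega>))"
  proof (rule form_eqI)
    fix Xs assume Xs: "set Xs \<subseteq> V"
    show "ev (insertion 1 tau \<omega>) Xs = ev (form_of (dif (\<lambda>_. 0) tor (ev \<omega>))) Xs"
      by (simp only: insertion_tau(1)[OF \<omega> Xs] ev_form_of[OF t Xs])
  qed (rule insertion_tau(2)[OF \<omega>], assumption, rule form_of_off)
qed

lemma cohomology_operator_lie_deriv:
  "cohomology_operator A (\<lambda>\<omega> p zs. lie_deriv A 0 N \<omega> p zs + insertion 1 tau \<omega> p zs)"
proof (rule algebroid.cohomology_operator_dif[OF algebroid_bott])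
  fix \<omega> assume \<omega>: "\<omega> \<in> diff_forms A"
  note t = algebroid.dif_tensor[OF algebroid_bott tensor_ev[OF \<omega>]]
  show "(\<lambda>p zs. lie_deriv A 0 N \<omega> p zs + insertion 1 tau \<omega> p zs) = form_of (dif n bott (ev \<omega>))"
  proof (rule form_eqI)
    fix p vs assume vs: "\<not> set vs \<subseteq> T p"
    show "lie_deriv A 0 N \<omega> p vs + insertion 1 tau \<omega> p vs = 0"
      using lie_deriv_N(2)[OF \<omega> vs] insertion_tau(2)[OF \<omega> vs] by simp
    show "form_of (dif n bott (ev \<omega>)) p vs = 0" by (rule form_of_off[OF vs])
  next
    fix Xs assume Xs: "set Xs \<subseteq> V"
    have "ev (\<lambda>p zs. lie_deriv A 0 N \<omega> p zs + insertion 1 tau \<omega> p zs) Xs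
        = ev (lie_deriv A 0 N \<omega>) Xs + ev (insertion 1 tau \<omega>) Xs"
      by (rule ext) (simp add: ev_apply fun_apply)
    also have "\<dots> = dif n bott (ev \<omega>) Xs"
      by (simp only: lie_deriv_N(1)[OF \<omega> Xs] insertion_tau(1)[OF \<omega> Xs] dif_bott[OF tensor_ev[OF \<omega>] Xs])
    finally show "ev (\<lambda>p zs. lie_deriv A 0 N \<omega> p zs + insertion 1 tau \<omega> p zs) Xs
        = ev (form_of (dif n bott (ev \<omega>))) Xs"
      by (simp only: ev_form_of[OF t Xs])
  qed
qed

end

theorem theorem5p3:
  fixes A :: "('m::{t2_space,second_countable_topology}, 'e::real_inner) atlas"
    and N L :: "'m vform"
  assumes "smooth_atlas A"
    and "connected (UNIV :: 'm set)"
    and "N \<in> vector_forms A 1"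
    and "\<And>p v. v \<in> tangent_space A p \<Longrightarrow> N p [N p [v]] = N p [v]"
    and "involutive_image A N"
    and "L = (\<lambda>p vs f. - nijenhuis_torsion A N p vs f)"
  shows "L \<in> vector_forms A 2
    \<and> cohomology_operator A (\<lambda>\<omega> p zs. lie_deriv A 0 N \<omega> p zs + insertion 1 L \<omega> p zs)
    \<and> cohomology_operator A (insertion 1 L)"
proof -
  interpret involutive_projection A N
    by unfold_locales (use assms in auto)
  have "L = tau" by (simp add: assms(6) tau_def)
  then show ?thesis
    using tau_vector_form cohomology_operator_lie_deriv cohomology_operator_insertion by simp
qed

end
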